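(* Suppose that $\varepsilon\le p^v(x,z^v)\le \varepsilon^{-1}$ for all $v\in V$ and $x,z\in\mathbb{X}$, where $$1>\varepsilon>\varepsilon_0=\Big(1-\frac{1}{18\Delta^2}\Big)^{1/(2\Delta)} .$$ Let $\beta=-(2r)^{-1}\log\big(18\Delta^2(1-\varepsilon^{2\Delta})\big)>0$. If $\sigma(s)=s \pmod m$ for $s\in\mathbb{N}$, then for every $v\in V$, every $n\ge 0$ and every $x\in\mathbb{X}$, $$\frac1m\sum_{k=0}^{m-1}\|\pi^x_{n-k}-\tilde\pi^x_{n-k}\|_v\ \le\ \frac{8e^{-\beta}}{1-e^{-\beta}}(1-\varepsilon^{2\Delta})\,\vartheta_m(v)\ \le\ \frac{8e^{-\beta}}{1-e^{-\beta}}(1-\varepsilon^{2\Delta})\exp\Big[-\beta\, e^{-\beta(\Delta_d(v)-\nabla_d(v))}\,\frac1m\,\theta_m(v)\Big],$$ where $\theta_m(v)=\frac1m\sum_{j=0}^{m-1}d(v,\partial K_j(v))$ and $\vartheta_m(v)=\frac1m\sum_{j=0}^{m-1}e^{-\beta d(v,\partial K_j(v))}$.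
   Context: Model. $G=(V,E)$ is a finite undirected graph and $d(v,v')$ is the graph (shortest path) distance; for $A\subseteq V$, $d(v,A)=\min_{u\in A}d(v,u)$. $\mathbb{X}=\prod_{v\in V}\mathbb{X}^v$ and $\mathbb{Y}=\prod_{v\in V}\mathbb{Y}^v$ are products of Polish spaces with product reference measures $\psi=\bigotimes_v\psi^v$, $\varphi=\bigotimes_v\varphi^v$. For $J\subseteq V$, $x^J=(x^j)_{j\in J}$. $(X_n)_{n\ge0}$ is a Markov chain on $\mathbb{X}$ with transition density (with respect to $\psi$) $p(x,z)=\prod_{v\in V}p^v(x,z^v)$, where $p^v:\mathbb{X}\times\mathbb{X}^v\to\mathbb{R}_+$ is a transition density with respect to $\psi^v$. The observations $(Y_n)$ are conditionally independent given $(X_n)$, with observation density (with respect to $\varphi$) $g(x,y)=\prod_{v\in V}g^v(x^v,y^v)$, where $g^v:\mathbb{X}^v\times\mathbb{Y}^v\to\mathbb{R}_+$. Fix $r\in\mathbb{N}$, $r\ge1$, and put $N(v)=\{v'\in V:d(v,v')\le r\}$. The dynamics are local: $p^v(x,z^v)=p^v(\tilde x,z^v)$ whenever $x^{N(v)}=\tilde x^{N(v)}$. Let $\Delta=\max_{v\in V}\mathrm{card}\,N(v)$. Partitions. $\mathcal{K}_0,\dots,\mathcal{K}_{m-1}$ ($m\ge1$) are partitions of $V$ into disjoint non-empty blocks. $K_j(v)$ denotes the block of $\mathcal{K}_j$ containing $v$. The border of a block $K$ is $\partial K=\{v'\in K: N(v')\not\subseteq K\}$. Put $\Delta_d(v)=\max_{0\le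 j\le m-1}d(v,\partial K_j(v))$ and $\nabla_d(v)=\min_{0\le j\le m-1}d(v,\partial K_j(v))$. The map $\sigma:\mathbb{N}\to\{0,\dots,m-1\}$ selects the partition used at each time. Operators. For a probability measure $\rho$ on $\mathbb{X}$: $(\mathsf{P}\rho)(f)=\int f(x')p(x,x')\psi(dx')\rho(dx)$; $(\mathsf{C}_n\rho)(f)=\dfrac{\int f(x)g(x,Y_n)\rho(dx)}{\int g(x,Y_n)\rho(dx)}$ (denominators are understood to be positive and finite); for a partition $\mathcal{K}$ of $V$, $\mathsf{B}(\mathcal{K})\rho=\bigotimes_{K\in\mathcal{K}}\mathsf{B}^K\rho$, where $\mathsf{B}^K\rho$ is the marginal of $\rho$ on $\prod_{v\in K}\mathbb{X}^v$. Set $\mathsf{F}_n=\mathsf{C}_n\mathsf{P}$ and $\tilde{\mathsf{F}}_n=\mathsf{C}_n\mathsf{B}(\mathcal{K}_{\sigma(n)})\mathsf{P}$. For an initial probability measure $\mu$, the exact filter is $\pi_n^\mu=\mathsf{F}_n\cdots\mathsf{F}_1\mu$ and the ideal adaptively blocked filter is $\tilde\pi_n^\mu=\tilde{\mathsf{F}}_n\cdots\tilde{\mathsf{F}}_1\mu$, with $\pi_0^\mu=\tilde\pi_0^\mu=\mu$. Write $\pi_n^x,\tilde\pi_n^x$ when $\mu=\delta_x$. The observations $Y_1,Y_2,\dots$ are given. Norm. For probability measures $\rho,\rho'$ on $\mathbb{X}$ and $J\subseteq V$, $\|\rho-\rho'\|_J=\sup|\rho(f)-\rho'(f)|$, the supremum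 being over measurable $f:\mathbb{X}\to\mathbb{R}$ with $|f|\le1$ such that $f(x)=f(\tilde x)$ whenever $x^J=\tilde x^J$; $\|\cdot\|_v=\|\cdot\|_{\{v\}}$. Convention: $\|\pi^x_{n-k}-\tilde\pi^x_{n-k}\|_v:=0$ when $n-k<0$. *)

theory Defs
  imports "HOL-Probability.Probability" "Graph_Theory.Shortest_Path"
begin

section \<open>Graph distance, neighborhoods, partitions and borders\<close>

text \<open>A finite undirected graph is a symmetric digraph (locale \<^locale>\<open>graph\<close>). Distances are
  extended reals: infinite between different components, and infinite to the empty set.\<close>

definition gdist :: "('v, 'e) pre_digraph \<Rightarrow> 'v \<Rightarrow> 'v \<Rightarrow> ereal" where
  "gdist G u v = wf_digraph.\<mu> G (\<lambda>_. 1) u v"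

definition gdist_set :: "('v, 'e) pre_digraph \<Rightarrow> 'v \<Rightarrow> 'v set \<Rightarrow> ereal" where
  "gdist_set G v A = (INF u\<in>A. gdist G v u)"

definition nbhd :: "('v, 'e) pre_digraph \<Rightarrow> nat \<Rightarrow> 'v \<Rightarrow> 'v set" where
  "nbhd G r v = {v' \<in> verts G. gdist G v v' \<le> ereal (real r)}"

definition max_nbhd :: "('v, 'e) pre_digraph \<Rightarrow> nat \<Rightarrow> nat" where
  "max_nbhd G r = (MAX v\<in>verts G. card (nbhd G r v))"

definition block :: "'v set set \<Rightarrow> 'v \<Rightarrow> 'v set" where
  "block \<K> v = (THE K. K \<in> \<K> \<and> v \<in> K)"

definition border :: "('v, 'e) pre_digraph \<Rightarrow> nat \<Rightarrow> 'v set \<Rightarrow> 'v set" where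
  "border G r K = {v' \<in> K. \<not> nbhd G r v' \<subseteq> K}"

definition border_dist :: "('v, 'e) pre_digraph \<Rightarrow> nat \<Rightarrow> 'v set set \<Rightarrow> 'v \<Rightarrow> ereal" where
  "border_dist G r \<K> v = gdist_set G v (border G r (block \<K> v))"

section \<open>Arithmetic with possibly infinite distances\<close>

fun exp_ereal :: "ereal \<Rightarrow> ereal" where
  "exp_ereal (ereal x) = ereal (exp x)"
| "exp_ereal PInfty = \<infinity>"
| "exp_ereal MInfty = 0"

text \<open>The library has \<^prop>\<open>(\<infinity>::ereal) - \<infinity> = \<infinity>\<close>. The difference of the largest and the smallest
  border distance has to vanish when all border distances agree, also when all are infinite.\<close>

definition ereal_gap :: "ereal \<Rightarrow> ereal \<Rightarrow> ereal" where
  "ereal_gap a b = (if a = b then 0 else a - b)"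

definition max_border_dist ::
    "('v, 'e) pre_digraph \<Rightarrow> nat \<Rightarrow> nat \<Rightarrow> (nat \<Rightarrow> 'v set set) \<Rightarrow> 'v \<Rightarrow> ereal" where
  "max_border_dist G r m \<K> v = (MAX j\<in>{..<m}. border_dist G r (\<K> j) v)"

definition min_border_dist ::
    "('v, 'e) pre_digraph \<Rightarrow> nat \<Rightarrow> nat \<Rightarrow> (nat \<Rightarrow> 'v set set) \<Rightarrow> 'v \<Rightarrow> ereal" where
  "min_border_dist G r m \<K> v = (MIN j\<in>{..<m}. border_dist G r (\<K> j) v)"

definition mean_border_dist ::
    "('v, 'e) pre_digraph \<Rightarrow> nat \<Rightarrow> nat \<Rightarrow> (nat \<Rightarrow> 'v set set) \<Rightarrow> 'v \<Rightarrow> ereal" where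
  "mean_border_dist G r m \<K> v = ereal (1 / real m) * (\<Sum>j<m. border_dist G r (\<K> j) v)"

definition mean_exp_border_dist ::
    "real \<Rightarrow> ('v, 'e) pre_digraph \<Rightarrow> nat \<Rightarrow> nat \<Rightarrow> (nat \<Rightarrow> 'v set set) \<Rightarrow> 'v \<Rightarrow> ereal" where
  "mean_exp_border_dist \<beta> G r m \<K> v =
     ereal (1 / real m) * (\<Sum>j<m. exp_ereal (- (ereal \<beta> * border_dist G r (\<K> j) v)))"

section \<open>Polish spaces and densities\<close>

text \<open>Polish spaces are given as topologies on a carrier, so that the spaces attached to
  different vertices may differ.\<close>

definition Polish :: "'a topology \<Rightarrow> bool" where
  "Polish T \<longleftrightarrow> completely_metrizable_space T \<and> separable_space T"

definition borel_of :: "'a topology \<Rightarrow> 'a measure" where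
  "borel_of T = sigma (topspace T) {U. openin T U}"

definition reference_measure :: "'a topology \<Rightarrow> 'a measure \<Rightarrow> bool" where
  "reference_measure T M \<longleftrightarrow> sets M = sets (borel_of T) \<and> sigma_finite_measure M"

definition transition_density :: "'a measure \<Rightarrow> 'b measure \<Rightarrow> ('a \<Rightarrow> 'b \<Rightarrow> real) \<Rightarrow> bool" where
  "transition_density M N q \<longleftrightarrow>
     (\<lambda>(x, z). q x z) \<in> borel_measurable (M \<Otimes>\<^sub>M N) \<and>
     (\<forall>x\<in>space M. \<forall>z\<in>space N. 0 \<le> q x z) \<and>
     (\<forall>x\<in>space M. (\<integral>\<^sup>+ z. ennreal (q x z) \<partial>N) = 1)"

section \<open>Filter operators\<close>

definition joint_trans :: "'v set \<Rightarrow> ('v \<Rightarrow> ('v \<Rightarrow> 'a) \<Rightarrow> 'a \<Rightarrow> real) \<Rightarrow>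
    ('v \<Rightarrow> 'a) \<Rightarrow> ('v \<Rightarrow> 'a) \<Rightarrow> real" where
  "joint_trans V p x z = (\<Prod>v\<in>V. p v x (z v))"

definition joint_obs :: "'v set \<Rightarrow> ('v \<Rightarrow> 'a \<Rightarrow> 'b \<Rightarrow> real) \<Rightarrow>
    ('v \<Rightarrow> 'a) \<Rightarrow> ('v \<Rightarrow> 'b) \<Rightarrow> real" where
  "joint_obs V g x y = (\<Prod>v\<in>V. g v (x v) (y v))"

definition predict :: "'v set \<Rightarrow> ('v \<Rightarrow> 'a measure) \<Rightarrow> ('v \<Rightarrow> ('v \<Rightarrow> 'a) \<Rightarrow> 'a \<Rightarrow> real) \<Rightarrow>
    ('v \<Rightarrow> 'a) measure \<Rightarrow> ('v \<Rightarrow> 'a) measure" where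
  "predict V \<psi> p \<rho> = \<rho> \<bind> (\<lambda>x. density (PiM V \<psi>) (\<lambda>z. ennreal (joint_trans V p x z)))"

definition likelihood :: "'v set \<Rightarrow> ('v \<Rightarrow> 'a \<Rightarrow> 'b \<Rightarrow> real) \<Rightarrow> ('v \<Rightarrow> 'b) \<Rightarrow>
    ('v \<Rightarrow> 'a) measure \<Rightarrow> ennreal" where
  "likelihood V g y \<rho> = (\<integral>\<^sup>+ x. ennreal (joint_obs V g x y) \<partial>\<rho>)"

definition correct :: "'v set \<Rightarrow> ('v \<Rightarrow> 'a \<Rightarrow> 'b \<Rightarrow> real) \<Rightarrow> ('v \<Rightarrow> 'b) \<Rightarrow>
    ('v \<Rightarrow> 'a) measure \<Rightarrow> ('v \<Rightarrow> 'a) measure" where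
  "correct V g y \<rho> = density \<rho> (\<lambda>x. ennreal (joint_obs V g x y) / likelihood V g y \<rho>)"

definition marginal :: "('v \<Rightarrow> 'a measure) \<Rightarrow> 'v set \<Rightarrow> ('v \<Rightarrow> 'a) measure \<Rightarrow>
    ('v \<Rightarrow> 'a) measure" where
  "marginal \<psi> K \<rho> = distr \<rho> (PiM K \<psi>) (\<lambda>x. restrict x K)"

text \<open>The product of the block marginals lives on families indexed by the blocks; the outer
  \<^const>\<open>distr\<close> glues such a family into a configuration on \<^term>\<open>V\<close>.\<close>

definition blocking :: "'v set \<Rightarrow> ('v \<Rightarrow> 'a measure) \<Rightarrow> 'v set set \<Rightarrow>
    ('v \<Rightarrow> 'a) measure \<Rightarrow> ('v \<Rightarrow> 'a) measure" where
  "blocking V \<psi> \<K> \<rho> =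
     distr (PiM \<K> (\<lambda>K. marginal \<psi> K \<rho>)) (PiM V \<psi>) (\<lambda>\<omega>. \<lambda>v\<in>V. \<omega> (block \<K> v) v)"

primrec exact_filter :: "'v set \<Rightarrow> ('v \<Rightarrow> 'a measure) \<Rightarrow>
    ('v \<Rightarrow> ('v \<Rightarrow> 'a) \<Rightarrow> 'a \<Rightarrow> real) \<Rightarrow> ('v \<Rightarrow> 'a \<Rightarrow> 'b \<Rightarrow> real) \<Rightarrow> (nat \<Rightarrow> 'v \<Rightarrow> 'b) \<Rightarrow>
    ('v \<Rightarrow> 'a) measure \<Rightarrow> nat \<Rightarrow> ('v \<Rightarrow> 'a) measure" where
  "exact_filter V \<psi> p g y \<mu> 0 = \<mu>"
| "exact_filter V \<psi> p g y \<mu> (Suc n) =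
     correct V g (y (Suc n)) (predict V \<psi> p (exact_filter V \<psi> p g y \<mu> n))"

primrec blocked_filter :: "'v set \<Rightarrow> ('v \<Rightarrow> 'a measure) \<Rightarrow>
    ('v \<Rightarrow> ('v \<Rightarrow> 'a) \<Rightarrow> 'a \<Rightarrow> real) \<Rightarrow> ('v \<Rightarrow> 'a \<Rightarrow> 'b \<Rightarrow> real) \<Rightarrow> (nat \<Rightarrow> 'v \<Rightarrow> 'b) \<Rightarrow>
    (nat \<Rightarrow> 'v set set) \<Rightarrow> (nat \<Rightarrow> nat) \<Rightarrow>
    ('v \<Rightarrow> 'a) measure \<Rightarrow> nat \<Rightarrow> ('v \<Rightarrow> 'a) measure" where
  "blocked_filter V \<psi> p g y \<K> \<sigma> \<mu> 0 = \<mu>"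
| "blocked_filter V \<psi> p g y \<K> \<sigma> \<mu> (Suc n) =
     correct V g (y (Suc n))
       (blocking V \<psi> (\<K> (\<sigma> (Suc n))) (predict V \<psi> p (blocked_filter V \<psi> p g y \<K> \<sigma> \<mu> n)))"

definition local_dist :: "('v \<Rightarrow> 'a) measure \<Rightarrow> 'v set \<Rightarrow>
    ('v \<Rightarrow> 'a) measure \<Rightarrow> ('v \<Rightarrow> 'a) measure \<Rightarrow> real" where
  "local_dist M J \<rho> \<rho>' =
     (SUP f \<in> {f \<in> borel_measurable M. (\<forall>x\<in>space M. \<bar>f x\<bar> \<le> 1) \<and>
                (\<forall>x\<in>space M. \<forall>x'\<in>space M. (\<forall>j\<in>J. x j = x' j) \<longrightarrow> f x = f x')}.
       \<bar>(\<integral>x. f x \<partial>\<rho>) - (\<integral>x. f x \<partial>\<rho>')\<bar>)"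

end

theory Submission
  imports Defs "HOL-Real_Asymp.Real_Asymp"
begin

text \<open>At every time both filters have densities, bounded above and below, with respect to one product of
  probability measures: \<open>g\<^sup>v(\<cdot>, y\<^sup>v) \<psi>\<^sup>v\<close> after normalisation, and point masses at time \<open>0\<close>. They are
  compared through the conditional laws of one coordinate given the others, tilted by arbitrary local
  factors with values in \<open>[\<epsilon>, 1/\<epsilon>]\<close>. Such factors arise because the conditional law of \<open>v\<close> at time
  \<open>n + 1\<close> is an average over the configuration at time \<open>n\<close> under a law tilted by the transition
  densities of the other vertices; the kernel that is averaged depends on the configuration in \<open>N(v)\<close> only.

  Dobrushin's comparison theorem at time \<open>n\<close> shows in this way that the influence between the
  coordinates of the exact filter stays summable against \<open>exp (\<beta> d(v, v'))\<close>, and that the distance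
  \<open>w\<^sub>n(v)\<close> of the conditional laws satisfies
  \<open>w\<^sub>n\<^sub>+\<^sub>1(v) \<le> e\<^sup>-\<^sup>\<beta> (w\<^sub>n(v) + (1 - \<epsilon>\<^sup>2\<^sup>\<Delta>) exp (-\<beta> d(v, \<partial>K(v))))\<close>: replacing all transition
  densities by those of the block \<open>K(v)\<close> changes the tilt only at vertices whose neighbourhood leaves \<open>K(v)\<close>.
  Summing over \<open>m\<close> consecutive times, every partition contributes once to each power of \<open>e\<^sup>-\<^sup>\<beta>\<close>.\<close>

section \<open>Weighted averages and total variation\<close>

text \<open>Observation densities may vanish or be unbounded, so with respect to
  \<open>\<psi>\<close> the filters need not have densities bounded above and below. Once the
  observation is part of the reference measure, what remains is an integral of transition densities;
  only its ratios matter, so averages are taken with unnormalised densities. The induction over time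
  has to carry arbitrary tilts: conditioning one coordinate of the predicted law reweights the
  previous law by transition densities, so a statement about untilted laws would not reproduce
  itself. Decay of influence is carried for the exact filter only. Dobrushin's comparison uses the
  influence matrix of one of its two laws, so the blocked law enters through distances of
  conditional laws. With R = exp (\<beta> r), the rate \<beta> is chosen so that 18 \<Delta>^2 (1 -
  \<epsilon>^(2 \<Delta>)) R^2 = 1. Changing the at most \<Delta> factors that see a vertex moves
  its conditional law by at most 1 - \<epsilon>^(2 \<Delta>), and at most \<Delta>^2 neighbourhoods
  meet a given one, each at weight at most R^2. The constant 18 leaves room to reproduce the row
  bound 1/3 and to gain 1/R per step.\<close>

definition wavg :: "'a measure \<Rightarrow> ('a \<Rightarrow> real) \<Rightarrow> ('a \<Rightarrow> real) \<Rightarrow> real" where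
  "wavg N d f = (\<integral>z. f z * d z \<partial>N) / (\<integral>z. d z \<partial>N)"

text \<open>The bounds hold at every point and not almost everywhere, so the property depends on the
  measurable space alone. It survives a change of measure and restriction to a section along one
  coordinate.\<close>

definition pos_density :: "'a measure \<Rightarrow> ('a \<Rightarrow> real) \<Rightarrow> bool" where
  "pos_density N d \<longleftrightarrow>
     d \<in> borel_measurable N \<and> (\<exists>l u. 0 < l \<and> (\<forall>z\<in>space N. l \<le> d z \<and> d z \<le> u))"

text \<open>The averages are normalised, so \<open>c\<close> bounds the total variation distance
  with values in [0, 1], half of the norm taken over |f| \<le> 1. Testing against the oscillation of
  \<open>f\<close> makes additive constants irrelevant; \<open>\<delta>\<close> is any upper bound
  for it, so no supremum is formed.\<close>

definition tv_le :: "'a measure \<Rightarrow> ('a \<Rightarrow> real) \<Rightarrow> ('a \<Rightarrow> real) \<Rightarrow> real \<Rightarrow> bool" where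
  "tv_le N d d' c \<longleftrightarrow>
     (\<forall>f \<delta>. f \<in> borel_measurable N \<longrightarrow> (\<forall>z\<in>space N. \<forall>z'\<in>space N. \<bar>f z - f z'\<bar> \<le> \<delta>) \<longrightarrow>
        \<bar>wavg N d f - wavg N d' f\<bar> \<le> c * \<delta>)"

lemma pos_densityI:
  "d \<in> borel_measurable N \<Longrightarrow> 0 < l \<Longrightarrow> (\<And>z. z \<in> space N \<Longrightarrow> l \<le> d z) \<Longrightarrow>
   (\<And>z. z \<in> space N \<Longrightarrow> d z \<le> u) \<Longrightarrow> pos_density N d"
  unfolding pos_density_def by blast

lemma pos_density_measurable: "pos_density N d \<Longrightarrow> d \<in> borel_measurable N"
  unfolding pos_density_def by blast

lemma pos_densityE:
  assumes "pos_density N d"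
  obtains l u where "0 < l" "0 < u" "\<And>z. z \<in> space N \<Longrightarrow> l \<le> d z" "\<And>z. z \<in> space N \<Longrightarrow> d z \<le> u"
proof -
  from assms obtain l u where "0 < l" "\<forall>z\<in>space N. l \<le> d z \<and> d z \<le> u"
    unfolding pos_density_def by blast
  then show ?thesis by (intro that[of l "max l u"]) auto
qed

lemma pos_density_pos: "pos_density N d \<Longrightarrow> z \<in> space N \<Longrightarrow> 0 < d z"
  unfolding pos_density_def by force

lemma pos_density_const: "0 < c \<Longrightarrow> pos_density N (\<lambda>_. c)"
  by (rule pos_densityI[of _ _ c c]) auto

lemma pos_density_mult:
  assumes "pos_density N d" "pos_density N e"
  shows "pos_density N (\<lambda>z. d z * e z)"
proof -
  obtain l u where "0 < l" "0 < u" "\<And>z. z \<in> space N \<Longrightarrow> l \<le> d z" "\<And>z. z \<in> space N \<Longrightarrow> d z \<le> u"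
    using pos_densityE[OF assms(1)] by blast
  moreover obtain l' u' where "0 < l'" "0 < u'"
      "\<And>z. z \<in> space N \<Longrightarrow> l' \<le> e z" "\<And>z. z \<in> space N \<Longrightarrow> e z \<le> u'"
    using pos_densityE[OF assms(2)] by blast
  ultimately show ?thesis
    using assms[THEN pos_density_measurable] assms[THEN pos_density_pos]
    by (intro pos_densityI[of _ _ "l * l'" "u * u'"] borel_measurable_times mult_mono)
       (auto intro: less_imp_le order_trans)
qed

lemma pos_density_prod:
  assumes "finite A" "\<And>w. w \<in> A \<Longrightarrow> pos_density N (q w)"
  shows "pos_density N (\<lambda>z. \<Prod>w\<in>A. q w z)"
  using assms by (induction A) (auto intro: pos_density_const pos_density_mult)

lemma pos_density_comp:
  assumes "pos_density N d" "g \<in> measurable N' N"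
  shows "pos_density N' (\<lambda>z. d (g z))"
proof -
  obtain l u where "0 < l" "0 < u" "\<And>z. z \<in> space N \<Longrightarrow> l \<le> d z" "\<And>z. z \<in> space N \<Longrightarrow> d z \<le> u"
    using pos_densityE[OF assms(1)] by blast
  then show ?thesis
    using measurable_space[OF assms(2)] assms(2) pos_density_measurable[OF assms(1)]
    by (intro pos_densityI[of _ _ l u]) (auto intro: measurable_compose)
qed

lemma pos_density_sets_cong:
  assumes "sets N = sets N'"
  shows "pos_density N d \<longleftrightarrow> pos_density N' d"
  unfolding pos_density_def using assms sets_eq_imp_space_eq[OF assms] measurable_cong_sets[OF assms refl]
  by auto

lemma wavg_cong:
  "(\<And>z. z \<in> space N \<Longrightarrow> d z = d' z) \<Longrightarrow> (\<And>z. z \<in> space N \<Longrightarrow> f z = f' z) \<Longrightarrow>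
   wavg N d f = wavg N d' f'"
  unfolding wavg_def by (simp cong: Bochner_Integration.integral_cong)

lemma wavg_scale: "k \<noteq> 0 \<Longrightarrow> wavg N (\<lambda>z. k * d z) f = wavg N d f"
  unfolding wavg_def by (simp add: mult.left_commute)

lemma tv_leD:
  "tv_le N d d' c \<Longrightarrow> f \<in> borel_measurable N \<Longrightarrow>
   (\<And>z z'. z \<in> space N \<Longrightarrow> z' \<in> space N \<Longrightarrow> \<bar>f z - f z'\<bar> \<le> \<delta>) \<Longrightarrow>
   \<bar>wavg N d f - wavg N d' f\<bar> \<le> c * \<delta>"
  unfolding tv_le_def by blast

lemma tv_le_trans: "tv_le N d d' c \<Longrightarrow> tv_le N d' d'' c' \<Longrightarrow> tv_le N d d'' (c + c')"
proof (unfold tv_le_def, intro allI impI)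
  fix f :: "'a \<Rightarrow> real" and \<delta>
  assume A: "\<forall>f \<delta>. f \<in> borel_measurable N \<longrightarrow> (\<forall>z\<in>space N. \<forall>z'\<in>space N. \<bar>f z - f z'\<bar> \<le> \<delta>) \<longrightarrow>
      \<bar>wavg N d f - wavg N d' f\<bar> \<le> c * \<delta>"
    "\<forall>f \<delta>. f \<in> borel_measurable N \<longrightarrow> (\<forall>z\<in>space N. \<forall>z'\<in>space N. \<bar>f z - f z'\<bar> \<le> \<delta>) \<longrightarrow>
      \<bar>wavg N d' f - wavg N d'' f\<bar> \<le> c' * \<delta>"
    "f \<in> borel_measurable N" "\<forall>z\<in>space N. \<forall>z'\<in>space N. \<bar>f z - f z'\<bar> \<le> \<delta>"
  have "\<bar>wavg N d f - wavg N d' f\<bar> \<le> c * \<delta>" "\<bar>wavg N d' f - wavg N d'' f\<bar> \<le> c' * \<delta>"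
    using A by blast+
  then show "\<bar>wavg N d f - wavg N d'' f\<bar> \<le> (c + c') * \<delta>"
    unfolding distrib_right by linarith
qed

lemma tv_le_cong:
  "(\<And>z. z \<in> space N \<Longrightarrow> d z = e z) \<Longrightarrow> (\<And>z. z \<in> space N \<Longrightarrow> d' z = e' z) \<Longrightarrow>
   tv_le N d d' c \<longleftrightarrow> tv_le N e e' c"
  unfolding tv_le_def using wavg_cong[of N d e] wavg_cong[of N d' e'] by auto

lemma tv_le_scale:
  "k \<noteq> 0 \<Longrightarrow> k' \<noteq> 0 \<Longrightarrow> tv_le N (\<lambda>z. k * d z) (\<lambda>z. k' * d' z) c \<longleftrightarrow> tv_le N d d' c"
  unfolding tv_le_def by (simp add: wavg_scale)

lemma tv_le_0: "(\<And>f. wavg N d f = wavg N d' f) \<Longrightarrow> tv_le N d d' 0"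
  unfolding tv_le_def by simp

lemma tv_le_refl: "tv_le N d d 0"
  by (rule tv_le_0) simp

section \<open>Averages over probability spaces and the minorisation bound\<close>

context prob_space
begin

lemma tv_le_mono:
  assumes "tv_le M d d' c" "c \<le> c'"
  shows "tv_le M d d' c'"
  unfolding tv_le_def
proof (intro allI impI)
  fix f :: "'a \<Rightarrow> real" and \<delta>
  assume f: "f \<in> borel_measurable M" "\<forall>z\<in>space M. \<forall>z'\<in>space M. \<bar>f z - f z'\<bar> \<le> \<delta>"
  obtain z0 where "z0 \<in> space M" using not_empty by blast
  then have "0 \<le> \<delta>" using f(2) abs_ge_zero order_trans by blast
  then have "c * \<delta> \<le> c' * \<delta>" using assms(2) by (rule mult_right_mono[rotated])
  moreover have "\<bar>wavg M d f - wavg M d' f\<bar> \<le> c * \<delta>"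
    using assms(1) f unfolding tv_le_def by blast
  ultimately show "\<bar>wavg M d f - wavg M d' f\<bar> \<le> c' * \<delta>" by linarith
qed

lemma bounded_integrable:
  assumes "f \<in> borel_measurable M" "\<And>z. z \<in> space M \<Longrightarrow> \<bar>f z\<bar> \<le> (B::real)"
  shows "integrable M f"
  using assms by (intro integrable_const_bound[of _ B]) auto

lemma bounded_osc_bound:
  assumes "\<And>z z'. z \<in> space M \<Longrightarrow> z' \<in> space M \<Longrightarrow> \<bar>f z - f z'\<bar> \<le> (\<delta>::real)"
  shows "\<exists>B. \<forall>z\<in>space M. \<bar>f z\<bar> \<le> B"
proof -
  obtain z0 where "z0 \<in> space M" using not_empty by blast
  then have "\<bar>f z\<bar> \<le> \<bar>f z0\<bar> + \<delta>" if "z \<in> space M" for z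
    using assms[OF that, of z0] by linarith
  then show ?thesis by blast
qed

lemma pos_density_integrable:
  assumes d: "pos_density M d"
  shows "integrable M d"
proof -
  obtain l u where u: "0 < l" "0 < u" "\<And>z. z \<in> space M \<Longrightarrow> l \<le> d z" "\<And>z. z \<in> space M \<Longrightarrow> d z \<le> u"
    using pos_densityE[OF d] by blast
  show ?thesis
  proof (rule bounded_integrable[of _ u])
    show "\<bar>d z\<bar> \<le> u" if "z \<in> space M" for z
      using u(4)[OF that] pos_density_pos[OF d that] by simp
  qed (rule pos_density_measurable[OF d])
qed

lemma pos_density_integrable_mult:
  assumes "pos_density M d" "f \<in> borel_measurable M" "\<And>z. z \<in> space M \<Longrightarrow> \<bar>f z\<bar> \<le> (B::real)"
  shows "integrable M (\<lambda>z. f z * d z)"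
proof -
  obtain l u where u: "0 < l" "0 < u" "\<And>z. z \<in> space M \<Longrightarrow> l \<le> d z" "\<And>z. z \<in> space M \<Longrightarrow> d z \<le> u"
    using pos_densityE[OF assms(1)] by blast
  show ?thesis
  proof (rule bounded_integrable[of _ "B * u"])
    fix z assume z: "z \<in> space M"
    show "\<bar>f z * d z\<bar> \<le> B * u"
      unfolding abs_mult using assms(3)[OF z] u(3,4)[OF z] u(1)
      by (intro mult_mono) auto
  qed (rule borel_measurable_times[OF assms(2) pos_density_measurable[OF assms(1)]])
qed

lemma pos_density_integral_pos:
  assumes "pos_density M d"
  shows "0 < (\<integral>z. d z \<partial>M)"
proof -
  obtain l where l: "0 < l" "\<And>z. z \<in> space M \<Longrightarrow> l \<le> d z"
    using assms unfolding pos_density_def by blast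
  have "l \<le> (\<integral>z. d z \<partial>M)"
    by (rule integral_ge_const[OF pos_density_integrable[OF assms]]) (simp add: l(2))
  with l show ?thesis by simp
qed

lemma wavg_bounds:
  assumes "pos_density M d" "f \<in> borel_measurable M"
    and "\<And>z. z \<in> space M \<Longrightarrow> lo \<le> f z" "\<And>z. z \<in> space M \<Longrightarrow> f z \<le> hi"
  shows "lo \<le> wavg M d f" "wavg M d f \<le> hi"
proof -
  have b: "\<bar>f z\<bar> \<le> \<bar>lo\<bar> + \<bar>hi\<bar>" if "z \<in> space M" for z using assms(3,4)[OF that] by auto
  note i = pos_density_integrable_mult[OF assms(1,2) b] pos_density_integrable[OF assms(1)]
  note p = pos_density_integral_pos[OF assms(1)]
  have "(\<integral>z. lo * d z \<partial>M) \<le> (\<integral>z. f z * d z \<partial>M)"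
    using i assms(3) pos_density_pos[OF assms(1)] by (intro integral_mono) (auto intro: mult_right_mono less_imp_le)
  then show "lo \<le> wavg M d f" unfolding wavg_def using p by (simp add: field_simps)
  have "(\<integral>z. f z * d z \<partial>M) \<le> (\<integral>z. hi * d z \<partial>M)"
    using i assms(4) pos_density_pos[OF assms(1)] by (intro integral_mono) (auto intro: mult_right_mono less_imp_le)
  then show "wavg M d f \<le> hi" unfolding wavg_def using p by (simp add: field_simps)
qed

lemma wavg_diff:
  assumes "pos_density M d" "f \<in> borel_measurable M" "\<And>z. z \<in> space M \<Longrightarrow> \<bar>f z\<bar> \<le> (B::real)"
    and "g \<in> borel_measurable M" "\<And>z. z \<in> space M \<Longrightarrow> \<bar>g z\<bar> \<le> (C::real)"
  shows "wavg M d (\<lambda>z. f z - g z) = wavg M d f - wavg M d g"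
  unfolding wavg_def left_diff_distrib
  using pos_density_integrable_mult[OF assms(1-3)] pos_density_integrable_mult[OF assms(1,4,5)]
  by (simp add: diff_divide_distrib)

lemma wavg_abs_diff_le:
  assumes d: "pos_density M d" and f: "f \<in> borel_measurable M" "\<And>z. z \<in> space M \<Longrightarrow> \<bar>f z\<bar> \<le> (B::real)"
    and g: "g \<in> borel_measurable M" "\<And>z. z \<in> space M \<Longrightarrow> \<bar>g z\<bar> \<le> (C::real)"
    and le: "\<And>z. z \<in> space M \<Longrightarrow> \<bar>f z - g z\<bar> \<le> \<delta>"
  shows "\<bar>wavg M d f - wavg M d g\<bar> \<le> \<delta>"
proof -
  have b: "- \<delta> \<le> f z - g z" "f z - g z \<le> \<delta>" if "z \<in> space M" for z
    using le[OF that] by linarith+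
  have m: "(\<lambda>z. f z - g z) \<in> borel_measurable M" using f g by simp
  have "- \<delta> \<le> wavg M d (\<lambda>z. f z - g z)" by (rule wavg_bounds[OF d m b])
  moreover have "wavg M d (\<lambda>z. f z - g z) \<le> \<delta>" by (rule wavg_bounds[OF d m b])
  ultimately show ?thesis
    using wavg_diff[OF d f g] by simp
qed

text \<open>Both normalised densities dominate \<open>l / u\<close> times the normalised density \<open>e\<close>.\<close>

lemma tv_le_ratio:
  assumes e: "pos_density M e" and t: "t \<in> borel_measurable M" "t' \<in> borel_measurable M"
    and l: "0 < l"
    and tb: "\<And>z. z \<in> space M \<Longrightarrow> l \<le> t z" "\<And>z. z \<in> space M \<Longrightarrow> t z \<le> u"
      "\<And>z. z \<in> space M \<Longrightarrow> l \<le> t' z" "\<And>z. z \<in> space M \<Longrightarrow> t' z \<le> u"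
  shows "tv_le M (\<lambda>z. e z * t z) (\<lambda>z. e z * t' z) (1 - l / u)"
  unfolding tv_le_def
proof (intro allI impI)
  fix f :: "'a \<Rightarrow> real" and \<delta> assume f: "f \<in> borel_measurable M" and osc: "\<forall>z\<in>space M. \<forall>z'\<in>space M. \<bar>f z - f z'\<bar> \<le> \<delta>"
  obtain z0 where z0: "z0 \<in> space M" using not_empty by blast
  have u: "0 < u" using l tb[OF z0] by linarith
  define lo where "lo = (INF z\<in>space M. f z)"
  obtain B where B: "\<And>z. z \<in> space M \<Longrightarrow> \<bar>f z\<bar> \<le> B"
    using bounded_osc_bound[of f \<delta>] osc by blast
  have bdd: "bdd_below (f ` space M)"
    using B by (intro bdd_belowI2[of _ "-B"]) force
  have lo: "lo \<le> f z" if "z \<in> space M" for z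
    unfolding lo_def using that bdd by (rule cINF_lower[rotated])
  have hi: "f z \<le> lo + \<delta>" if "z \<in> space M" for z
  proof -
    have "f z - \<delta> \<le> f z'" if "z' \<in> space M" for z'
    proof -
      have "\<bar>f z - f z'\<bar> \<le> \<delta>" using osc that \<open>z \<in> space M\<close> by blast
      then show ?thesis by linarith
    qed
    then have "f z - \<delta> \<le> lo"
      unfolding lo_def using not_empty by (intro cINF_greatest)
    then show ?thesis by simp
  qed
  \<comment> \<open>The law of \<open>e * s\<close> consists of the share \<open>l / u\<close> of
    the law of \<open>e\<close> and a remainder of mass \<open>1 - l / u\<close>, on which
    \<open>f\<close> stays between \<open>lo\<close> and \<open>lo + \<delta>\<close>. The resulting
    interval has length \<open>(1 - l / u) * \<delta>\<close> and does not depend on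
    \<open>s\<close>, so it contains both averages.\<close>
  have \<kappa>: "lo + (l / u) * (wavg M e f - lo) \<le> wavg M (\<lambda>z. e z * s z) f \<and>
      wavg M (\<lambda>z. e z * s z) f \<le> lo + \<delta> - (l / u) * (lo + \<delta> - wavg M e f)"
    if s: "s \<in> borel_measurable M" "\<And>z. z \<in> space M \<Longrightarrow> l \<le> s z" "\<And>z. z \<in> space M \<Longrightarrow> s z \<le> u" for s
  proof -
    have sp: "pos_density M s" using s l by (intro pos_densityI)
    note es = pos_density_mult[OF e sp]
    let ?S = "\<integral>z. e z * s z \<partial>M" and ?E = "\<integral>z. e z \<partial>M"
    have ie: "integrable M e" and ies: "integrable M (\<lambda>z. e z * s z)"
      by (rule pos_density_integrable[OF e], rule pos_density_integrable[OF es])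
    have ife: "integrable M (\<lambda>z. f z * e z)" and ifes: "integrable M (\<lambda>z. f z * (e z * s z))"
      by (rule pos_density_integrable_mult[OF e f B] pos_density_integrable_mult[OF es f B], assumption)+
    have pos: "0 < ?S" "0 < ?E" using pos_density_integral_pos e es by auto
    have S_le: "?S \<le> u * ?E"
    proof -
      have "?S \<le> (\<integral>z. u * e z \<partial>M)"
        using ies ie s(3) pos_density_pos[OF e]
        by (intro integral_mono) (auto simp: mult.commute[of u] intro: mult_left_mono less_imp_le)
      then show ?thesis by simp
    qed
    \<comment> \<open>The minorisation tested with nonnegative functions: \<open>f - lo\<close>
      yields the lower end of the interval, \<open>lo + \<delta> - f\<close> the upper end.\<close>
    have main: "l * (\<integral>z. g z * e z \<partial>M) / (u * ?E) \<le> (\<integral>z. g z * (e z * s z) \<partial>M) / ?S"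
      if g: "integrable M (\<lambda>z. g z * e z)" "integrable M (\<lambda>z. g z * (e z * s z))"
        "\<And>z. z \<in> space M \<Longrightarrow> 0 \<le> g z" for g
    proof -
      have "l * (\<integral>z. g z * e z \<partial>M) = (\<integral>z. l * (g z * e z) \<partial>M)" by simp
      also have "\<dots> \<le> (\<integral>z. g z * (e z * s z) \<partial>M)"
      proof (rule integral_mono)
        fix z assume z: "z \<in> space M"
        have "(g z * e z) * l \<le> (g z * e z) * s z"
          using g(3)[OF z] pos_density_pos[OF e z] s(2)[OF z] by (intro mult_left_mono) auto
        then show "l * (g z * e z) \<le> g z * (e z * s z)" by (simp add: mult_ac)
      qed (use g in auto)
      finally have 1: "l * (\<integral>z. g z * e z \<partial>M) \<le> (\<integral>z. g z * (e z * s z) \<partial>M)" .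
      have 0: "0 \<le> (\<integral>z. g z * e z \<partial>M)"
        using g(3) pos_density_pos[OF e] by (intro Bochner_Integration.integral_nonneg) (auto intro: mult_nonneg_nonneg less_imp_le)
      have 2: "0 \<le> (\<integral>z. g z * (e z * s z) \<partial>M)"
        using 1 mult_nonneg_nonneg[OF less_imp_le[OF l] 0] by linarith
      show ?thesis by (rule frac_le[OF 2 1 pos(1) S_le])
    qed
    have "l * (\<integral>z. (f z - lo) * e z \<partial>M) / (u * ?E) \<le> (\<integral>z. (f z - lo) * (e z * s z) \<partial>M) / ?S"
      using ife ifes ie ies lo by (intro main) (auto simp: left_diff_distrib)
    moreover have "l * (\<integral>z. (lo + \<delta> - f z) * e z \<partial>M) / (u * ?E) \<le> (\<integral>z. (lo + \<delta> - f z) * (e z * s z) \<partial>M) / ?S"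
      using ife ifes ie ies hi by (intro main) (auto simp: left_diff_distrib)
    moreover have "l * (\<integral>z. (f z - lo) * e z \<partial>M) / (u * ?E) = l / u * (wavg M e f - lo)"
      "l * (\<integral>z. (lo + \<delta> - f z) * e z \<partial>M) / (u * ?E) = l / u * (lo + \<delta> - wavg M e f)"
      unfolding wavg_def left_diff_distrib using ife ie pos u by (simp_all add: field_simps)
    moreover have "(\<integral>z. (f z - lo) * (e z * s z) \<partial>M) / ?S = wavg M (\<lambda>z. e z * s z) f - lo"
      "(\<integral>z. (lo + \<delta> - f z) * (e z * s z) \<partial>M) / ?S = lo + \<delta> - wavg M (\<lambda>z. e z * s z) f"
      unfolding wavg_def left_diff_distrib using ifes ies pos by (simp_all add: diff_divide_distrib)
    ultimately show ?thesis by linarith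
  qed
  have "\<bar>wavg M (\<lambda>z. e z * t z) f - wavg M (\<lambda>z. e z * t' z) f\<bar> \<le> \<delta> - l / u * \<delta>"
    using \<kappa>[OF t(1) tb(1,2)] \<kappa>[OF t(2) tb(3,4)] by (simp add: right_diff_distrib distrib_left abs_le_iff)
  then show "\<bar>wavg M (\<lambda>z. e z * t z) f - wavg M (\<lambda>z. e z * t' z) f\<bar> \<le> (1 - l / u) * \<delta>"
    by (simp add: left_diff_distrib)
qed

text \<open>Factors outside \<open>S\<close> are constant in \<open>z\<close> and cancel on
  normalisation, even if the two families have different constants there. At most \<Delta> factors
  with values in [\<epsilon>, 1/\<epsilon>] remain, so the ratio of the bounds is \<epsilon>^(2
  \<Delta>).\<close>

lemma tv_le_tilt:
  assumes e: "pos_density M e" and V: "finite V" "S \<subseteq> V" "card S \<le> \<Delta>" and \<epsilon>: "0 < \<epsilon>" "\<epsilon> < 1"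
    and q: "\<And>w. w \<in> V \<Longrightarrow> q w \<in> borel_measurable M" "\<And>w z. w \<in> V \<Longrightarrow> z \<in> space M \<Longrightarrow> \<epsilon> \<le> q w z \<and> q w z \<le> 1 / \<epsilon>"
    and q': "\<And>w. w \<in> V \<Longrightarrow> q' w \<in> borel_measurable M" "\<And>w z. w \<in> V \<Longrightarrow> z \<in> space M \<Longrightarrow> \<epsilon> \<le> q' w z \<and> q' w z \<le> 1 / \<epsilon>"
    and const: "\<And>w z z'. w \<in> V - S \<Longrightarrow> z \<in> space M \<Longrightarrow> z' \<in> space M \<Longrightarrow> q w z = q w z' \<and> q' w z = q' w z'"
  shows "tv_le M (\<lambda>z. e z * (\<Prod>w\<in>V. q w z)) (\<lambda>z. e z * (\<Prod>w\<in>V. q' w z))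
     (if \<forall>w\<in>S. \<forall>z\<in>space M. q w z = q' w z then 0 else 1 - \<epsilon> ^ (2 * \<Delta>))"
proof -
  obtain z0 where z0: "z0 \<in> space M" using not_empty by blast
  have fin: "finite S" using V finite_subset by blast
  have split: "(\<Prod>w\<in>V. k w z) = (\<Prod>w\<in>V - S. k w z0) * (\<Prod>w\<in>S. k w z)"
    if "\<And>w. w \<in> V - S \<Longrightarrow> k w z = k w z0" for k :: "'b \<Rightarrow> 'a \<Rightarrow> real" and z
    using prod.subset_diff[OF V(2,1), of "\<lambda>w. k w z"] that by simp
  have A: "0 < (\<Prod>w\<in>V - S. q w z0)" "0 < (\<Prod>w\<in>V - S. q' w z0)"
    using q(2)[OF _ z0] q'(2)[OF _ z0] \<epsilon>(1) by (auto intro!: prod_pos, force+)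
  have "tv_le M (\<lambda>z. e z * (\<Prod>w\<in>S. q w z)) (\<lambda>z. e z * (\<Prod>w\<in>S. q' w z))
     (if \<forall>w\<in>S. \<forall>z\<in>space M. q w z = q' w z then 0 else 1 - \<epsilon> ^ (2 * \<Delta>))"
  proof (cases "\<forall>w\<in>S. \<forall>z\<in>space M. q w z = q' w z")
    case True
    then have "tv_le M (\<lambda>z. e z * (\<Prod>w\<in>S. q w z)) (\<lambda>z. e z * (\<Prod>w\<in>S. q' w z)) 0"
      by (subst tv_le_cong[of _ _ "\<lambda>z. e z * (\<Prod>w\<in>S. q' w z)" _ "\<lambda>z. e z * (\<Prod>w\<in>S. q' w z)"])
         (auto simp: tv_le_refl)
    with True show ?thesis by simp
  next
    case False
    have b: "\<epsilon> ^ \<Delta> \<le> (\<Prod>w\<in>S. k w z) \<and> (\<Prod>w\<in>S. k w z) \<le> (1 / \<epsilon>) ^ \<Delta>"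
      if "\<And>w. w \<in> S \<Longrightarrow> \<epsilon> \<le> k w z \<and> k w z \<le> 1 / \<epsilon>" for k :: "'b \<Rightarrow> 'a \<Rightarrow> real" and z
    proof
      have "\<epsilon> ^ \<Delta> \<le> \<epsilon> ^ card S" using V(3) \<epsilon> by (intro power_decreasing) auto
      also have "\<dots> = (\<Prod>w\<in>S. \<epsilon>)" by simp
      also have "\<dots> \<le> (\<Prod>w\<in>S. k w z)" using that \<epsilon> by (intro prod_mono) auto
      finally show "\<epsilon> ^ \<Delta> \<le> (\<Prod>w\<in>S. k w z)" .
      have "(\<Prod>w\<in>S. k w z) \<le> (\<Prod>w\<in>S. 1 / \<epsilon>)" using that \<epsilon> by (intro prod_mono) (auto, force)
      also have "\<dots> = (1 / \<epsilon>) ^ card S" by simp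
      also have "\<dots> \<le> (1 / \<epsilon>) ^ \<Delta>" using V(3) \<epsilon> by (intro power_increasing) auto
      finally show "(\<Prod>w\<in>S. k w z) \<le> (1 / \<epsilon>) ^ \<Delta>" .
    qed
    have "tv_le M (\<lambda>z. e z * (\<Prod>w\<in>S. q w z)) (\<lambda>z. e z * (\<Prod>w\<in>S. q' w z)) (1 - \<epsilon> ^ \<Delta> / (1 / \<epsilon>) ^ \<Delta>)"
      using V(2) q q' \<epsilon> b by (intro tv_le_ratio[OF e]) (auto intro!: borel_measurable_prod, blast+)
    moreover have "\<epsilon> ^ \<Delta> / (1 / \<epsilon>) ^ \<Delta> = \<epsilon> ^ (2 * \<Delta>)"
      using \<epsilon> by (simp add: power_divide mult_2 power_add)
    ultimately show ?thesis using False by auto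
  qed
  then have "tv_le M (\<lambda>z. (\<Prod>w\<in>V - S. q w z0) * (e z * (\<Prod>w\<in>S. q w z)))
      (\<lambda>z. (\<Prod>w\<in>V - S. q' w z0) * (e z * (\<Prod>w\<in>S. q' w z)))
      (if \<forall>w\<in>S. \<forall>z\<in>space M. q w z = q' w z then 0 else 1 - \<epsilon> ^ (2 * \<Delta>))"
    using A by (subst tv_le_scale) auto
  then show ?thesis
  proof (subst tv_le_cong)
    fix z assume z: "z \<in> space M"
    show "e z * (\<Prod>w\<in>V. q w z) = (\<Prod>w\<in>V - S. q w z0) * (e z * (\<Prod>w\<in>S. q w z))"
      using split[of q z] const[OF _ z z0] by simp
    show "e z * (\<Prod>w\<in>V. q' w z) = (\<Prod>w\<in>V - S. q' w z0) * (e z * (\<Prod>w\<in>S. q' w z))"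
      using split[of q' z] const[OF _ z z0] by simp
  qed
qed

end

lemma (in prob_space) wavg_real_density:
  assumes "pos_density M h" "f \<in> borel_measurable M"
  shows "(\<integral>x. f x \<partial>density M (\<lambda>x. ennreal (h x / (\<integral>x. h x \<partial>M)))) = wavg M h f"
proof -
  have "(\<integral>x. f x \<partial>density M (\<lambda>x. ennreal (h x / (\<integral>x. h x \<partial>M)))) = (\<integral>x. h x / (\<integral>x. h x \<partial>M) * f x \<partial>M)"
    using assms pos_density_measurable[OF assms(1)] pos_density_integral_pos[OF assms(1)] pos_density_pos[OF assms(1)]
    by (subst integral_density) (auto intro!: AE_I2 divide_nonneg_pos intro: less_imp_le)
  also have "\<dots> = (\<integral>x. f x * h x / (\<integral>x. h x \<partial>M) \<partial>M)"
    by (simp add: mult_ac)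
  finally show ?thesis by (simp add: wavg_def)
qed

text \<open>Over a point mass every normalised average is the value of \<open>f\<close> at
  \<open>a\<close>, whatever the density. Hence at time 0 the conditional laws react neither to
  tilts nor to other coordinates.\<close>

lemma tv_le_return:
  assumes a: "a \<in> space M" and d: "pos_density M d" "pos_density M d'"
  shows "tv_le (return M a) d d' 0"
proof -
  have "wavg (return M a) e f = f a" if e: "pos_density M e" and f: "f \<in> borel_measurable (return M a)" for e f
  proof -
    have [measurable]: "e \<in> borel_measurable M" "f \<in> borel_measurable M"
      using pos_density_measurable[OF e] f by auto
    have "(\<integral>z. f z * e z \<partial>return M a) = f a * e a" by (rule integral_return[OF a]) measurable
    moreover have "(\<integral>z. e z \<partial>return M a) = e a" by (rule integral_return[OF a]) measurable
    ultimately show ?thesis unfolding wavg_def using pos_density_pos[OF e a] by simp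
  qed
  then show ?thesis unfolding tv_le_def using d by simp
qed

lemma pos_density_integral_fst:
  assumes "prob_space A" and F: "pos_density (A \<Otimes>\<^sub>M B) (\<lambda>(x, z). F x z)"
  shows "pos_density B (\<lambda>z. \<integral>x. F x z \<partial>A)"
proof -
  interpret A: prob_space A by fact
  obtain l u where l: "0 < l" "0 < u" "\<And>z. z \<in> space (A \<Otimes>\<^sub>M B) \<Longrightarrow> l \<le> (\<lambda>(x, z). F x z) z"
      "\<And>z. z \<in> space (A \<Otimes>\<^sub>M B) \<Longrightarrow> (\<lambda>(x, z). F x z) z \<le> u"
    using pos_densityE[OF F] by blast
  have lb: "l \<le> F x z" "F x z \<le> u" if "x \<in> space A" "z \<in> space B" for x z
    using l(3,4)[of "(x, z)"] that by (auto simp: space_pair_measure)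
  note m[measurable] = pos_density_measurable[OF F]
  have m': "(\<lambda>x. F x z) \<in> borel_measurable A" if "z \<in> space B" for z
    using measurable_compose[OF measurable_Pair2'[OF that] m] by simp
  have int: "integrable A (\<lambda>x. F x z)" if "z \<in> space B" for z
    using lb[OF _ that] l(1,2) by (intro A.bounded_integrable[OF m'[OF that], of u]) (smt (verit))
  show ?thesis
  proof (rule pos_densityI[OF _ l(1)])
    show "(\<lambda>z. \<integral>x. F x z \<partial>A) \<in> borel_measurable B"
      by (rule A.borel_measurable_lebesgue_integral) (measurable)
    show "l \<le> (\<integral>x. F x z \<partial>A)" "(\<integral>x. F x z \<partial>A) \<le> u" if "z \<in> space B" for z
      using lb[OF _ that] by (auto intro!: A.integral_ge_const A.integral_le_const int that)
  qed
qed

lemma pos_density_integral_snd: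
  assumes "prob_space B" and F: "pos_density (A \<Otimes>\<^sub>M B) (\<lambda>(x, z). F x z)"
  shows "pos_density A (\<lambda>x. \<integral>z. F x z \<partial>B)"
  using pos_density_integral_fst[OF assms(1), of A "\<lambda>z x. F x z"]
    pos_density_comp[OF F measurable_pair_swap'] by (simp add: case_prod_unfold)

section \<open>Dobrushin's comparison theorem\<close>

definition coord_osc_le :: "'i set \<Rightarrow> ('i \<Rightarrow> 'a measure) \<Rightarrow> (('i \<Rightarrow> 'a) \<Rightarrow> real) \<Rightarrow> ('i \<Rightarrow> real) \<Rightarrow> bool" where
  "coord_osc_le I M f \<delta> \<longleftrightarrow>
     (\<forall>i\<in>I. \<forall>x\<in>space (PiM I M). \<forall>z\<in>space (M i). \<bar>f (x(i := z)) - f x\<bar> \<le> \<delta> i)"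

lemma coord_osc_leD:
  "coord_osc_le I M f \<delta> \<Longrightarrow> i \<in> I \<Longrightarrow> x \<in> space (PiM I M) \<Longrightarrow> z \<in> space (M i) \<Longrightarrow>
   \<bar>f (x(i := z)) - f x\<bar> \<le> \<delta> i"
  unfolding coord_osc_le_def by blast

lemma space_PiM_fun_upd:
  "i \<in> I \<Longrightarrow> x \<in> space (PiM I M) \<Longrightarrow> z \<in> space (M i) \<Longrightarrow> x(i := z) \<in> space (PiM I M)"
  by (auto simp: space_PiM PiE_iff extensional_def)

lemma measurable_PiM_fun_upd:
  assumes "i \<in> I"
  shows "(\<lambda>(x, z). x(i := z)) \<in> measurable (PiM I M \<Otimes>\<^sub>M M i) (PiM I M)"
  using measurable_add_dim[of i I M] assms by (simp add: insert_absorb)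

lemma measurable_PiM_fun_upd1:
  assumes "i \<in> I" "x \<in> space (PiM I M)"
  shows "(\<lambda>z. x(i := z)) \<in> measurable (M i) (PiM I M)"
  using measurable_compose[OF measurable_Pair1'[OF assms(2)] measurable_PiM_fun_upd[OF assms(1)]] by simp

context finite_product_prob_space
begin

abbreviation "P \<equiv> PiM I M"

lemma coord_osc_le_nonneg:
  assumes "coord_osc_le I M f \<delta>" "i \<in> I"
  shows "0 \<le> \<delta> i"
proof -
  obtain x where x: "x \<in> space P" using not_empty by blast
  obtain z where z: "z \<in> space (M i)" using M.not_empty by blast
  show ?thesis using coord_osc_leD[OF assms x z] by linarith
qed

text \<open>Telescoping: \<open>x\<close> is turned into \<open>y\<close> one coordinate at a
  time.\<close>

lemma coord_osc_le_total:
  assumes f: "coord_osc_le I M f \<delta>" and x: "x \<in> space P" and y: "y \<in> space P"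
  shows "\<bar>f y - f x\<bar> \<le> (\<Sum>i\<in>I. \<delta> i)"
proof -
  have "(\<lambda>i. if i \<in> S then y i else x i) \<in> space P \<and>
      \<bar>f (\<lambda>i. if i \<in> S then y i else x i) - f x\<bar> \<le> (\<Sum>i\<in>S. \<delta> i)" if "finite S" "S \<subseteq> I" for S
    using that
  proof (induction S)
    case empty
    then show ?case using x by simp
  next
    case (insert i S)
    let ?u = "\<lambda>j. if j \<in> S then y j else x j"
    have eq: "(\<lambda>j. if j \<in> insert i S then y j else x j) = ?u(i := y i)" by auto
    have i: "i \<in> I" and yi: "y i \<in> space (M i)" using insert y by (auto simp: space_PiM)
    show ?case unfolding eq
    proof
      show "?u(i := y i) \<in> space P" using insert i yi by (intro space_PiM_fun_upd) auto
      show "\<bar>f (?u(i := y i)) - f x\<bar> \<le> (\<Sum>i\<in>insert i S. \<delta> i)"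
        using coord_osc_leD[OF f i _ yi, of ?u] insert by auto
    qed
  qed
  from this[of I] have "\<bar>f (\<lambda>i. if i \<in> I then y i else x i) - f x\<bar> \<le> (\<Sum>i\<in>I. \<delta> i)"
    using finite_index by blast
  moreover have "(\<lambda>i. if i \<in> I then y i else x i) = y"
    using x y by (auto simp: space_PiM PiE_iff extensional_def)
  ultimately show ?thesis by simp
qed

text \<open>Under a product of probability measures a coordinate can be redrawn independently. The
  redrawn function no longer depends on coordinate \<open>i\<close>, so splitting off this
  coordinate turns both sides into the same integral over the others.\<close>

lemma integral_resample:
  fixes F :: "('a \<Rightarrow> 'b) \<Rightarrow> real"
  assumes i: "i \<in> I" and F: "F \<in> borel_measurable P" "\<And>x. x \<in> space P \<Longrightarrow> \<bar>F x\<bar> \<le> B"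
  shows "(\<integral>x. F x \<partial>P) = (\<integral>x. (\<integral>z. F (x(i := z)) \<partial>M i) \<partial>P)"
proof -
  let ?J = "I - {i}"
  let ?G = "\<lambda>x. \<integral>z. F (x(i := z)) \<partial>M i"
  have I: "insert i ?J = I" "finite ?J" "i \<notin> ?J" using i finite_index by auto
  have G: "?G \<in> borel_measurable P"
    using measurable_compose[OF measurable_PiM_fun_upd[OF i] F(1)]
    by (intro M.borel_measurable_lebesgue_integral) (simp add: case_prod_unfold)
  have Gb: "\<bar>?G x\<bar> \<le> B" if x: "x \<in> space P" for x
  proof -
    have m: "(\<lambda>z. F (x(i := z))) \<in> borel_measurable (M i)"
      using measurable_compose[OF measurable_PiM_fun_upd1[OF i x] F(1)] .
    have b: "\<bar>F (x(i := z))\<bar> \<le> B" if "z \<in> space (M i)" for z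
      using F(2) space_PiM_fun_upd[OF i x that] by blast
    have "\<bar>?G x\<bar> \<le> (\<integral>z. \<bar>F (x(i := z))\<bar> \<partial>M i)" by (rule integral_abs_bound)
    also have "\<dots> \<le> B"
      using M.bounded_integrable[OF m b] b by (intro M.integral_le_const) auto
    finally show ?thesis .
  qed
  have iF: "integrable (PiM (insert i ?J) M) F" and iG: "integrable (PiM (insert i ?J) M) ?G"
    using I bounded_integrable[OF F] bounded_integrable[OF G Gb] by auto
  have "(\<integral>x. F x \<partial>P) = (\<integral>x. ?G x \<partial>PiM ?J M)"
    using product_integral_insert[OF I(2,3) iF] I by simp
  also have "\<dots> = (\<integral>x. (\<integral>z. ?G (x(i := z)) \<partial>M i) \<partial>PiM ?J M)"
    by (simp add: M.prob_space)
  also have "\<dots> = (\<integral>x. ?G x \<partial>P)"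
    using product_integral_insert[OF I(2,3) iG] I by simp
  finally show ?thesis .
qed

text \<open>The conditional expectation of \<open>f\<close> given the coordinates other than
  \<open>i\<close>, for the law with density proportional to \<open>h\<close>.\<close>

definition cond_avg :: "(('a \<Rightarrow> 'b) \<Rightarrow> real) \<Rightarrow> 'a \<Rightarrow> (('a \<Rightarrow> 'b) \<Rightarrow> real) \<Rightarrow> ('a \<Rightarrow> 'b) \<Rightarrow> real" where
  "cond_avg h i f x = wavg (M i) (\<lambda>z. h (x(i := z))) (\<lambda>z. f (x(i := z)))"

lemma pos_density_fun_upd:
  "pos_density P h \<Longrightarrow> i \<in> I \<Longrightarrow> x \<in> space P \<Longrightarrow> pos_density (M i) (\<lambda>z. h (x(i := z)))"
  by (rule pos_density_comp[OF _ measurable_PiM_fun_upd1])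

lemma measurable_cond_avg:
  assumes "i \<in> I" "h \<in> borel_measurable P" "f \<in> borel_measurable P"
  shows "cond_avg h i f \<in> borel_measurable P"
proof -
  have [measurable]: "(\<lambda>(x, z). F (x(i := z))) \<in> borel_measurable (P \<Otimes>\<^sub>M M i)" if "F \<in> borel_measurable P"
    for F :: "('a \<Rightarrow> 'b) \<Rightarrow> real"
    using measurable_compose[OF measurable_PiM_fun_upd[OF assms(1)] that] by (simp add: case_prod_unfold)
  note assms(2,3)[measurable]
  show ?thesis unfolding cond_avg_def[abs_def] wavg_def by measurable
qed

lemma cond_avg_abs_le:
  assumes h: "pos_density P h" and i: "i \<in> I" and f: "f \<in> borel_measurable P"
    and B: "\<And>x. x \<in> space P \<Longrightarrow> \<bar>f x\<bar> \<le> B" and x: "x \<in> space P"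
  shows "\<bar>cond_avg h i f x\<bar> \<le> B"
proof -
  have b: "- B \<le> f (x(i := z))" "f (x(i := z)) \<le> B" if "z \<in> space (M i)" for z
    using B[OF space_PiM_fun_upd[OF i x that]] by linarith+
  note w = M.wavg_bounds[OF pos_density_fun_upd[OF h i x]
      measurable_compose[OF measurable_PiM_fun_upd1[OF i x] f] b]
  show ?thesis unfolding cond_avg_def using w by (simp add: abs_le_iff)
qed

text \<open>Tower property; equivalently, the law of \<open>h\<close> is invariant under redrawing
  one site from its conditional law. The integral of \<open>h\<close> over coordinate
  \<open>i\<close> cancels the denominator of the conditional average.\<close>

lemma wavg_cond_avg:
  assumes h: "pos_density P h" and i: "i \<in> I" and f: "f \<in> borel_measurable P"
    and B: "\<And>x. x \<in> space P \<Longrightarrow> \<bar>f x\<bar> \<le> B"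
  shows "wavg P h (cond_avg h i f) = wavg P h f"
proof -
  note hm = pos_density_measurable[OF h]
  obtain l u where u: "0 < l" "0 < u" "\<And>z. z \<in> space P \<Longrightarrow> l \<le> h z" "\<And>z. z \<in> space P \<Longrightarrow> h z \<le> u"
    using pos_densityE[OF h] by blast
  note gm = measurable_cond_avg[OF i hm f] and gb = cond_avg_abs_le[OF h i f B]
  have hb: "\<bar>F x * h x\<bar> \<le> B * u" if "x \<in> space P" "\<bar>F x\<bar> \<le> B" for F :: "('a \<Rightarrow> 'b) \<Rightarrow> real" and x
    unfolding abs_mult using u(3,4)[OF that(1)] u(1) that by (intro mult_mono) auto
  have "(\<integral>x. cond_avg h i f x * h x \<partial>P) =
      (\<integral>x. (\<integral>z. cond_avg h i f (x(i := z)) * h (x(i := z)) \<partial>M i) \<partial>P)"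
    using hb[of _ "cond_avg h i f"] gb by (intro integral_resample[OF i]) (auto intro!: borel_measurable_times gm hm)
  also have "\<dots> = (\<integral>x. (\<integral>z. f (x(i := z)) * h (x(i := z)) \<partial>M i) \<partial>P)"
  proof (rule Bochner_Integration.integral_cong[OF refl])
    fix x assume x: "x \<in> space P"
    have "0 < (\<integral>z. h (x(i := z)) \<partial>M i)"
      using M.pos_density_integral_pos[OF pos_density_fun_upd[OF h i x]] .
    then show "(\<integral>z. cond_avg h i f (x(i := z)) * h (x(i := z)) \<partial>M i) = (\<integral>z. f (x(i := z)) * h (x(i := z)) \<partial>M i)"
      by (simp add: cond_avg_def wavg_def)
  qed
  also have "\<dots> = (\<integral>x. f x * h x \<partial>P)"
    using hb[of _ f] B by (intro integral_resample[OF i, symmetric]) (auto intro!: borel_measurable_times f hm)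
  finally show ?thesis unfolding wavg_def by simp
qed

text \<open>Dobrushin's comparison: resampling the sites one after another improves the trivial
  estimate \<open>w + 1\<close> to \<open>w + 1/2\<close>, \<open>w + 1/4\<close>, and so on.\<close>

theorem dobrushin_comparison:
  assumes h: "pos_density P h" and h': "pos_density P h'"
    and infl: "\<And>i j x b. i \<in> I \<Longrightarrow> j \<in> I \<Longrightarrow> i \<noteq> j \<Longrightarrow> x \<in> space P \<Longrightarrow> b \<in> space (M j) \<Longrightarrow>
      tv_le (M i) (\<lambda>z. h (x(i := z))) (\<lambda>z. h ((x(j := b))(i := z))) (C i j)"
    and diff: "\<And>i x. i \<in> I \<Longrightarrow> x \<in> space P \<Longrightarrow>
      tv_le (M i) (\<lambda>z. h (x(i := z))) (\<lambda>z. h' (x(i := z))) (b i)"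
    and C: "\<And>i j. i \<in> I \<Longrightarrow> j \<in> I \<Longrightarrow> 0 \<le> C i j" and row: "\<And>i. i \<in> I \<Longrightarrow> (\<Sum>j\<in>I. C i j) \<le> 1 / 2"
    and w: "\<And>i. i \<in> I \<Longrightarrow> 0 \<le> w i" and super: "\<And>i. i \<in> I \<Longrightarrow> (\<Sum>j\<in>I. C i j * w j) + b i \<le> w i"
    and f: "f \<in> borel_measurable P" and osc: "coord_osc_le I M f \<delta>"
  shows "\<bar>wavg P h f - wavg P h' f\<bar> \<le> (\<Sum>i\<in>I. \<delta> i * w i)"
proof -
  \<comment> \<open>The weights \<open>a\<close> have to serve all test functions at once, because
    the estimate is applied again to a test function that has been resampled.\<close>
  define est where "est a \<longleftrightarrow> (\<forall>f \<delta>. f \<in> borel_measurable P \<longrightarrow> coord_osc_le I M f \<delta> \<longrightarrow>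
    \<bar>wavg P h f - wavg P h' f\<bar> \<le> (\<Sum>i\<in>I. \<delta> i * a i))" for a
  have est_mono: "est a'" if "est a" "\<And>i. i \<in> I \<Longrightarrow> a i \<le> a' i" for a a'
    unfolding est_def
  proof (intro allI impI)
    fix f \<delta> assume f: "f \<in> borel_measurable P" "coord_osc_le I M f \<delta>"
    have "(\<Sum>i\<in>I. \<delta> i * a i) \<le> (\<Sum>i\<in>I. \<delta> i * a' i)"
      using that(2) coord_osc_le_nonneg[OF f(2)] by (intro sum_mono mult_left_mono)
    with f that(1) show "\<bar>wavg P h f - wavg P h' f\<bar> \<le> (\<Sum>i\<in>I. \<delta> i * a' i)"
      unfolding est_def by force
  qed
  \<comment> \<open>The crude bound: total variation is at most 1, and the oscillation of
    \<open>f\<close> is at most the sum of its coordinate oscillations.\<close>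
  have est_1: "est (\<lambda>_. 1)"
    unfolding est_def
  proof (intro allI impI)
    fix f \<delta> assume f: "f \<in> borel_measurable P" "coord_osc_le I M f \<delta>"
    have "\<bar>wavg P h f - wavg P h' f\<bar> \<le> 1 * (\<Sum>i\<in>I. \<delta> i)"
    proof (rule tv_leD[OF _ f(1)])
      obtain l u where u: "0 < l" "0 < u" "\<And>z. z \<in> space P \<Longrightarrow> l \<le> h z" "\<And>z. z \<in> space P \<Longrightarrow> h z \<le> u"
        using pos_densityE[OF h] by blast
      obtain l' u' where u': "0 < l'" "0 < u'" "\<And>z. z \<in> space P \<Longrightarrow> l' \<le> h' z" "\<And>z. z \<in> space P \<Longrightarrow> h' z \<le> u'"
        using pos_densityE[OF h'] by blast
      have "tv_le P (\<lambda>z. 1 * h z) (\<lambda>z. 1 * h' z) (1 - min l l' / max u u')"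
        using u u' h h' by (intro tv_le_ratio) (auto intro: pos_density_const pos_density_measurable simp: min_le_iff_disj le_max_iff_disj)
      then show "tv_le P h h' 1" using u u' by (auto intro: tv_le_mono simp: max_def)
    qed (use coord_osc_le_total[OF f(2)] in blast)
    then show "\<bar>wavg P h f - wavg P h' f\<bar> \<le> (\<Sum>i\<in>I. \<delta> i * 1)" by simp
  qed
  have est_upd: "est (a(i := (\<Sum>j\<in>I - {i}. C i j * a j) + b i))" if a: "est a" and i: "i \<in> I" for a i
    unfolding est_def
  proof (intro allI impI)
    fix f \<delta> assume f: "f \<in> borel_measurable P" and osc: "coord_osc_le I M f \<delta>"
    obtain B where B: "\<And>x. x \<in> space P \<Longrightarrow> \<bar>f x\<bar> \<le> B"
      using bounded_osc_bound[of f "sum \<delta> I"] coord_osc_le_total[OF osc] by blast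
    \<comment> \<open>Averaging over site \<open>i\<close> removes the dependence on
      \<open>i\<close>, but the conditional law at \<open>i\<close> reacts to coordinate
      \<open>j\<close>; this passes \<open>\<delta> i\<close> on to \<open>j\<close> with weight
      \<open>C i j\<close>.\<close>
    define \<delta>' where "\<delta>' j = (if j = i then 0 else \<delta> j + C i j * \<delta> i)" for j
    have fu: "(\<lambda>z. f (x(i := z))) \<in> borel_measurable (M i)" if "x \<in> space P" for x
      using measurable_compose[OF measurable_PiM_fun_upd1[OF i that] f] .
    have fb: "\<bar>f (x(i := z))\<bar> \<le> B" if "x \<in> space P" "z \<in> space (M i)" for x z
      using B[OF space_PiM_fun_upd[OF i that]] .
    have fo: "\<bar>f (x(i := z)) - f (x(i := z'))\<bar> \<le> \<delta> i" if "x \<in> space P" "z \<in> space (M i)" "z' \<in> space (M i)" for x z z'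
      using coord_osc_leD[OF osc i space_PiM_fun_upd[OF i that(1,3)] that(2)] by simp
    have "coord_osc_le I M (cond_avg h i f) \<delta>'"
      unfolding coord_osc_le_def
    proof (intro ballI)
      fix j x c assume j: "j \<in> I" and x: "x \<in> space P" and c: "c \<in> space (M j)"
      note xc = space_PiM_fun_upd[OF j x c]
      show "\<bar>cond_avg h i f (x(j := c)) - cond_avg h i f x\<bar> \<le> \<delta>' j"
      proof (cases "j = i")
        case True
        then show ?thesis by (simp add: cond_avg_def \<delta>'_def)
      next
        case False
        have "\<bar>wavg (M i) (\<lambda>z. h (x(j := c, i := z))) (\<lambda>z. f (x(j := c, i := z))) -
            wavg (M i) (\<lambda>z. h (x(j := c, i := z))) (\<lambda>z. f (x(i := z)))\<bar> \<le> \<delta> j"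
        proof (rule M.wavg_abs_diff_le[OF pos_density_fun_upd[OF h i xc] fu[OF xc] fb[OF xc] fu[OF x] fb[OF x]])
          fix z assume z: "z \<in> space (M i)"
          show "\<bar>f (x(j := c, i := z)) - f (x(i := z))\<bar> \<le> \<delta> j"
            using coord_osc_leD[OF osc j space_PiM_fun_upd[OF i x z] c] False by (simp add: fun_upd_twist)
        qed
        moreover have "\<bar>wavg (M i) (\<lambda>z. h (x(i := z))) (\<lambda>z. f (x(i := z))) -
            wavg (M i) (\<lambda>z. h (x(j := c, i := z))) (\<lambda>z. f (x(i := z)))\<bar> \<le> C i j * \<delta> i"
          using False by (intro tv_leD[OF infl[OF i j _ x c] fu[OF x] fo[OF x]]) auto
        ultimately show ?thesis using False unfolding cond_avg_def \<delta>'_def by auto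
      qed
    qed
    then have 1: "\<bar>wavg P h (cond_avg h i f) - wavg P h' (cond_avg h i f)\<bar> \<le> (\<Sum>j\<in>I. \<delta>' j * a j)"
      using a measurable_cond_avg[OF i pos_density_measurable[OF h] f] unfolding est_def by blast
    \<comment> \<open>The law of \<open>h'\<close> is invariant under its own resampling, not under
      that of \<open>h\<close>. Exchanging the two kernels costs the distance \<open>b i\<close> of
      the conditional laws.\<close>
    have "\<bar>wavg P h' (cond_avg h i f) - wavg P h' (cond_avg h' i f)\<bar> \<le> b i * \<delta> i"
    proof (rule wavg_abs_diff_le[OF h' _ cond_avg_abs_le[OF h i f B] _ cond_avg_abs_le[OF h' i f B]])
      fix x assume x: "x \<in> space P"
      show "\<bar>cond_avg h i f x - cond_avg h' i f x\<bar> \<le> b i * \<delta> i"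
        unfolding cond_avg_def by (rule tv_leD[OF diff[OF i x] fu[OF x] fo[OF x]])
    qed (use measurable_cond_avg[OF i pos_density_measurable f] h h' in auto)
    moreover have "wavg P h (cond_avg h i f) = wavg P h f" "wavg P h' (cond_avg h' i f) = wavg P h' f"
      by (rule wavg_cond_avg[OF h i f], erule B) (rule wavg_cond_avg[OF h' i f], erule B)
    ultimately have "\<bar>wavg P h f - wavg P h' f\<bar> \<le> (\<Sum>j\<in>I. \<delta>' j * a j) + b i * \<delta> i"
      using 1 by linarith
    also have "(\<Sum>j\<in>I. \<delta>' j * a j) = (\<Sum>j\<in>I - {i}. \<delta> j * a j + C i j * a j * \<delta> i)"
      unfolding sum.remove[OF finite_index i] by (auto simp: \<delta>'_def algebra_simps intro!: sum.cong)
    also have "\<dots> + b i * \<delta> i = (\<Sum>j\<in>I. \<delta> j * (a(i := (\<Sum>j\<in>I - {i}. C i j * a j) + b i)) j)"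
      unfolding sum.remove[OF finite_index i] by (simp add: sum.distrib sum_distrib_left algebra_simps)
    finally show "\<bar>wavg P h f - wavg P h' f\<bar> \<le> (\<Sum>j\<in>I. \<delta> j * (a(i := (\<Sum>j\<in>I - {i}. C i j * a j) + b i)) j)" .
  qed
  \<comment> \<open>One sweep through the sites. Updated or not, every site is bounded by
    \<open>w + t\<close>; the row sum 1/2 halves \<open>t\<close>, and the supersolution inequality
    absorbs the terms in \<open>w\<close> and \<open>b\<close>.\<close>
  have halve: "est (\<lambda>i. w i + t / 2)" if t: "est (\<lambda>i. w i + t)" "0 \<le> t" for t
  proof -
    have "est (\<lambda>i. if i \<in> S then w i + t / 2 else w i + t)" if "finite S" "S \<subseteq> I" for S
      using that
    proof (induction S)
      case empty
      then show ?case using t by simp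
    next
      case (insert i S)
      let ?a = "\<lambda>i. if i \<in> S then w i + t / 2 else w i + t"
      have i: "i \<in> I" using insert by auto
      have "(\<Sum>j\<in>I - {i}. C i j * ?a j) \<le> (\<Sum>j\<in>I - {i}. C i j * (w j + t))"
        using C[OF i] t by (intro sum_mono mult_left_mono) auto
      also have "\<dots> \<le> (\<Sum>j\<in>I. C i j * (w j + t))"
        using C[OF i] t w finite_index by (intro sum_mono2) auto
      also have "\<dots> = (\<Sum>j\<in>I. C i j * w j) + (\<Sum>j\<in>I. C i j) * t"
        by (simp add: distrib_left sum.distrib sum_distrib_right)
      also have "\<dots> \<le> (\<Sum>j\<in>I. C i j * w j) + 1 / 2 * t"
        using row[OF i] t by (intro add_left_mono mult_right_mono)
      finally have le: "(\<Sum>j\<in>I - {i}. C i j * ?a j) + b i \<le> w i + t / 2" using super[OF i] by linarith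
      have "est ?a" using insert by blast
      then have "est (?a(i := (\<Sum>j\<in>I - {i}. C i j * ?a j) + b i))" using i by (rule est_upd)
      then show ?case
      proof (rule est_mono)
        fix j
        show "(?a(i := (\<Sum>j\<in>I - {i}. C i j * ?a j) + b i)) j \<le> (if j \<in> insert i S then w j + t / 2 else w j + t)"
          using le by (cases "j = i") simp_all
      qed
    qed
    from this[OF finite_index subset_refl] show ?thesis by (rule est_mono) simp
  qed
  have "est (\<lambda>i. w i + (1 / 2) ^ k)" for k
  proof (induction k)
    case 0
    then show ?case using w by (intro est_mono[OF est_1]) simp
  next
    case (Suc k)
    then show ?case using halve[of "(1 / 2) ^ k"] by simp
  qed
  then have le: "\<bar>wavg P h f - wavg P h' f\<bar> \<le> (\<Sum>i\<in>I. \<delta> i * w i) + (\<Sum>i\<in>I. \<delta> i) * (1 / 2) ^ k" for k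
    using f osc unfolding est_def by (simp add: distrib_left sum.distrib sum_distrib_right)
  have "(\<lambda>k. (\<Sum>i\<in>I. \<delta> i * w i) + (\<Sum>i\<in>I. \<delta> i) * (1 / 2) ^ k) \<longlonglongrightarrow> (\<Sum>i\<in>I. \<delta> i * w i) + (\<Sum>i\<in>I. \<delta> i) * 0"
    by (intro tendsto_intros LIMSEQ_power_zero) simp
  from LIMSEQ_le_const[OF this] le show ?thesis by auto
qed

end

text \<open>\<open>W\<close> is the Neumann series of 1/(1 - C) applied to a family of right-hand
  sides indexed by \<open>l\<close>, obtained as the increasing limit of its partial sums. The
  weighted sum runs over the right-hand sides; the weight is moved from \<open>i\<close> to
  \<open>j\<close> at the price \<open>q i j\<close>, and the weighted row sum 1/2 reproduces the
  bound: half of \<open>2 * B\<close>, plus \<open>B\<close>.\<close>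

lemma supersolution_exists:
  fixes C q :: "'i \<Rightarrow> 'i \<Rightarrow> real" and E b :: "'i \<Rightarrow> 'l \<Rightarrow> real"
  assumes fin: "finite I" "finite L"
    and C: "\<And>i j. i \<in> I \<Longrightarrow> j \<in> I \<Longrightarrow> 0 \<le> C i j" and b: "\<And>i l. i \<in> I \<Longrightarrow> l \<in> L \<Longrightarrow> 0 \<le> b i l"
    and E: "\<And>i l. i \<in> I \<Longrightarrow> l \<in> L \<Longrightarrow> 1 \<le> E i l"
    and q0: "\<And>i j. i \<in> I \<Longrightarrow> j \<in> I \<Longrightarrow> 0 \<le> q i j"
    and q: "\<And>i j l. i \<in> I \<Longrightarrow> j \<in> I \<Longrightarrow> l \<in> L \<Longrightarrow> E i l \<le> q i j * E j l"
    and row: "\<And>i. i \<in> I \<Longrightarrow> (\<Sum>j\<in>I. q i j * C i j) \<le> 1 / 2"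
    and B: "0 \<le> B" "\<And>i. i \<in> I \<Longrightarrow> (\<Sum>l\<in>L. E i l * b i l) \<le> B"
  obtains W where "\<And>i l. i \<in> I \<Longrightarrow> l \<in> L \<Longrightarrow> 0 \<le> W i l"
    "\<And>i l. i \<in> I \<Longrightarrow> l \<in> L \<Longrightarrow> (\<Sum>j\<in>I. C i j * W j l) + b i l \<le> W i l"
    "\<And>i. i \<in> I \<Longrightarrow> (\<Sum>l\<in>L. E i l * W i l) \<le> 2 * B"
proof -
  define a where "a = rec_nat (\<lambda>i l. 0) (\<lambda>_ a i l. (\<Sum>j\<in>I. C i j * a j l) + b i l)"
  have a0: "a 0 i l = 0" and aS: "a (Suc k) i l = (\<Sum>j\<in>I. C i j * a k j l) + b i l" for k i l
    by (simp_all add: a_def)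
  have nonneg: "0 \<le> a k i l" if "i \<in> I" "l \<in> L" for k i l
    using that by (induction k arbitrary: i) (auto simp: a0 aS intro!: add_nonneg_nonneg sum_nonneg mult_nonneg_nonneg C b)
  have mono: "a k i l \<le> a (Suc k) i l" if "i \<in> I" "l \<in> L" for k i l
    using that
  proof (induction k arbitrary: i)
    case 0
    then show ?case using nonneg[of i l "Suc 0"] by (simp add: a0)
  next
    case (Suc k)
    have "(\<Sum>j\<in>I. C i j * a k j l) \<le> (\<Sum>j\<in>I. C i j * a (Suc k) j l)"
      using Suc C by (intro sum_mono mult_left_mono) auto
    then show ?case by (simp add: aS)
  qed
  have S: "(\<Sum>l\<in>L. E i l * a k i l) \<le> 2 * B" if "i \<in> I" for k i
    using that
  proof (induction k arbitrary: i)
    case 0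
    then show ?case using B by (simp add: a0)
  next
    case (Suc k)
    have "(\<Sum>l\<in>L. E i l * (\<Sum>j\<in>I. C i j * a k j l)) = (\<Sum>l\<in>L. \<Sum>j\<in>I. C i j * (E i l * a k j l))"
      by (simp add: sum_distrib_left mult_ac)
    also have "\<dots> \<le> (\<Sum>l\<in>L. \<Sum>j\<in>I. C i j * ((q i j * E j l) * a k j l))"
      using Suc C q nonneg by (intro sum_mono mult_left_mono mult_right_mono) auto
    also have "\<dots> = (\<Sum>j\<in>I. (q i j * C i j) * (\<Sum>l\<in>L. E j l * a k j l))"
      by (subst sum.swap) (simp add: sum_distrib_left mult_ac)
    also have "\<dots> \<le> (\<Sum>j\<in>I. (q i j * C i j) * (2 * B))"
      using Suc C q0 by (intro sum_mono mult_left_mono) auto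
    also have "\<dots> \<le> 1 / 2 * (2 * B)"
      unfolding sum_distrib_right[symmetric] using row[OF Suc.prems] B by (intro mult_right_mono) auto
    finally show ?case using B(2)[OF Suc.prems] by (simp add: aS distrib_left sum.distrib)
  qed
  \<comment> \<open>Weights of at least 1 let the weighted sum control each entry, so the increasing
    sequence converges.\<close>
  have bdd: "a k i l \<le> 2 * B" if "i \<in> I" "l \<in> L" for k i l
  proof -
    have "1 * a k i l \<le> E i l * a k i l"
      using E[OF that] nonneg[OF that] by (intro mult_right_mono) auto
    also have "\<dots> \<le> (\<Sum>l\<in>L. E i l * a k i l)"
    proof (rule member_le_sum[of l L "\<lambda>l. E i l * a k i l"])
      show "0 \<le> E i l' * a k i l'" if "l' \<in> L - {l}" for l'
        using E[OF \<open>i \<in> I\<close>, of l'] nonneg[OF \<open>i \<in> I\<close>, of l' k] that by auto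
    qed (use that fin in auto)
    finally show ?thesis using S[OF that(1), of k] by simp
  qed
  define W where "W i l = lim (\<lambda>k. a k i l)" for i l
  have lim: "(\<lambda>k. a k i l) \<longlonglongrightarrow> W i l" if "i \<in> I" "l \<in> L" for i l
  proof -
    have "incseq (\<lambda>k. a k i l)" using mono[OF that] by (rule incseq_SucI)
    moreover have "\<forall>k. a k i l \<le> 2 * B" using bdd[OF that] by blast
    ultimately have "convergent (\<lambda>k. a k i l)" using incseq_convergent convergentI by metis
    then show ?thesis unfolding W_def convergent_LIMSEQ_iff .
  qed
  show ?thesis
  proof (rule that)
    show "0 \<le> W i l" if "i \<in> I" "l \<in> L" for i l
      using LIMSEQ_le_const[OF lim[OF that]] nonneg[OF that] by blast
    show "(\<Sum>j\<in>I. C i j * W j l) + b i l \<le> W i l" if "i \<in> I" "l \<in> L" for i l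
    proof -
      have "(\<lambda>k. a (Suc k) i l) \<longlonglongrightarrow> (\<Sum>j\<in>I. C i j * W j l) + b i l"
        unfolding aS using lim that by (intro tendsto_intros) auto
      then show ?thesis using LIMSEQ_unique LIMSEQ_Suc[OF lim[OF that]] by fastforce
    qed
    show "(\<Sum>l\<in>L. E i l * W i l) \<le> 2 * B" if "i \<in> I" for i
    proof -
      have "(\<lambda>k. \<Sum>l\<in>L. E i l * a k i l) \<longlonglongrightarrow> (\<Sum>l\<in>L. E i l * W i l)"
        using lim that by (intro tendsto_intros) auto
      then show ?thesis using LIMSEQ_le_const2 S[OF that] by blast
    qed
  qed
qed

section \<open>Conditional laws under local dynamics\<close>

text \<open>\<open>\<omega> v w\<close> stands for exp (\<beta> d(v, w)) and \<open>R\<close> for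
  exp (\<beta> r). Only a multiplicative triangle inequality and the bound on neighbourhoods are
  kept of the distance, so truncated distances qualify as well. Locality is stated for the change of
  one coordinate, the form in which influences are measured.\<close>

locale local_dynamics =
  fixes V :: "'v set" and N :: "'v \<Rightarrow> 'v set" and \<omega> :: "'v \<Rightarrow> 'v \<Rightarrow> real"
    and \<epsilon> R :: real and \<Delta> :: nat
    and \<psi> :: "'v \<Rightarrow> 'a measure" and p :: "'v \<Rightarrow> ('v \<Rightarrow> 'a) \<Rightarrow> 'a \<Rightarrow> real"
  assumes finite_V: "finite V"
    and N_sub: "v \<in> V \<Longrightarrow> N v \<subseteq> V"
    and N_sym: "v \<in> V \<Longrightarrow> w \<in> V \<Longrightarrow> w \<in> N v \<Longrightarrow> v \<in> N w"
    and N_card: "v \<in> V \<Longrightarrow> card (N v) \<le> \<Delta>" and \<Delta>_pos: "1 \<le> \<Delta>"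
    and \<omega>_ge_1: "v \<in> V \<Longrightarrow> w \<in> V \<Longrightarrow> 1 \<le> \<omega> v w" and \<omega>_refl: "v \<in> V \<Longrightarrow> \<omega> v v = 1"
    and \<omega>_triangle: "u \<in> V \<Longrightarrow> v \<in> V \<Longrightarrow> w \<in> V \<Longrightarrow> \<omega> u w \<le> \<omega> u v * \<omega> v w"
    and \<omega>_N: "v \<in> V \<Longrightarrow> w \<in> N v \<Longrightarrow> \<omega> v w \<le> R" and R: "1 \<le> R"
    and \<epsilon>: "0 < \<epsilon>" "\<epsilon> < 1" and small: "18 * (real \<Delta>)\<^sup>2 * (1 - \<epsilon> ^ (2 * \<Delta>)) * R\<^sup>2 \<le> 1"
    and p_measurable: "u \<in> V \<Longrightarrow> (\<lambda>(x, z). p u x z) \<in> borel_measurable (PiM V \<psi> \<Otimes>\<^sub>M \<psi> u)"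
    and p_bounds: "u \<in> V \<Longrightarrow> x \<in> space (PiM V \<psi>) \<Longrightarrow> z \<in> space (\<psi> u) \<Longrightarrow> \<epsilon> \<le> p u x z \<and> p u x z \<le> 1 / \<epsilon>"
    and p_local: "u \<in> V \<Longrightarrow> a \<in> V - N u \<Longrightarrow> x \<in> space (PiM V \<psi>) \<Longrightarrow> b \<in> space (\<psi> a) \<Longrightarrow>
      z \<in> space (\<psi> u) \<Longrightarrow> p u (x(a := b)) z = p u x z"
begin

abbreviation "\<eta> \<equiv> 1 - \<epsilon> ^ (2 * \<Delta>)"
abbreviation "S \<equiv> PiM V \<psi>"

text \<open>The library requires the factors of a product measure to be sigma-finite at every index,
  also outside \<open>V\<close>; families of reference measures are therefore total.\<close>

definition refs :: "('v \<Rightarrow> 'a measure) \<Rightarrow> bool" where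
  "refs L \<longleftrightarrow> (\<forall>i. prob_space (L i)) \<and> (\<forall>i\<in>V. sets (L i) = sets (\<psi> i))"

text \<open>The factor attached to \<open>w\<close> reads the configuration in \<open>N w\<close>
  only. Since \<open>N\<close> is symmetric, a given coordinate is seen by at most \<Delta>
  factors.\<close>

definition tilt_family :: "('v \<Rightarrow> ('v \<Rightarrow> 'a) \<Rightarrow> real) \<Rightarrow> bool" where
  "tilt_family q \<longleftrightarrow> (\<forall>w\<in>V. q w \<in> borel_measurable S \<and>
     (\<forall>x\<in>space S. \<epsilon> \<le> q w x \<and> q w x \<le> 1 / \<epsilon> \<and>
        (\<forall>a\<in>V - N w. \<forall>b\<in>space (\<psi> a). q w (x(a := b)) = q w x)))"

definition tilted :: "(('v \<Rightarrow> 'a) \<Rightarrow> real) \<Rightarrow> ('v \<Rightarrow> ('v \<Rightarrow> 'a) \<Rightarrow> real) \<Rightarrow> ('v \<Rightarrow> 'a) \<Rightarrow> real" where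
  "tilted h q x = h x * (\<Prod>w\<in>V. q w x)"

text \<open>One influence matrix serves all tilts, because the tilt that the next time step applies
  is not known beforehand. The weighted row bound 1/3 implies the row bound 1/2 of the comparison
  theorem and leaves room for the explicit supersolution
  \<open>2 * B * \<omega> v j\<close>.\<close>

definition decay :: "('v \<Rightarrow> 'a measure) \<Rightarrow> (('v \<Rightarrow> 'a) \<Rightarrow> real) \<Rightarrow> ('v \<Rightarrow> 'v \<Rightarrow> real) \<Rightarrow> bool" where
  "decay L h c \<longleftrightarrow> (\<forall>q i j x b. tilt_family q \<longrightarrow> i \<in> V \<longrightarrow> j \<in> V \<longrightarrow> i \<noteq> j \<longrightarrow> x \<in> space S \<longrightarrow> b \<in> space (\<psi> j) \<longrightarrow>
     tv_le (L i) (\<lambda>z. tilted h q (x(i := z))) (\<lambda>z. tilted h q (x(j := b, i := z))) (c i j)) \<and>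
     (\<forall>i\<in>V. \<forall>j\<in>V. 0 \<le> c i j) \<and> (\<forall>i\<in>V. (\<Sum>j\<in>V. \<omega> i j * c i j) \<le> 1 / 3)"

definition close :: "('v \<Rightarrow> 'a measure) \<Rightarrow> (('v \<Rightarrow> 'a) \<Rightarrow> real) \<Rightarrow> (('v \<Rightarrow> 'a) \<Rightarrow> real) \<Rightarrow> ('v \<Rightarrow> real) \<Rightarrow> bool" where
  "close L h h' w \<longleftrightarrow> (\<forall>q i x. tilt_family q \<longrightarrow> i \<in> V \<longrightarrow> x \<in> space S \<longrightarrow>
     tv_le (L i) (\<lambda>z. tilted h q (x(i := z))) (\<lambda>z. tilted h' q (x(i := z))) (w i))"

text \<open>Up to normalisation, the density with respect to \<open>\<psi>\<close> of a block
  marginal of the predicted law, if \<open>h\<close> is the density of the current law over the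
  product of \<open>L\<close>. The observation does not appear, as it goes into the next reference
  measure.\<close>

definition block_density :: "('v \<Rightarrow> 'a measure) \<Rightarrow> (('v \<Rightarrow> 'a) \<Rightarrow> real) \<Rightarrow> 'v set \<Rightarrow> ('v \<Rightarrow> 'a) \<Rightarrow> real" where
  "block_density L h K z = (\<integral>x. (\<Prod>w\<in>K. p w x (z w)) * h x \<partial>PiM V L)"

text \<open>The partition \<open>{V}\<close> yields the exact filter, so both filters are instances
  of one formula.\<close>

definition next_density :: "('v \<Rightarrow> 'a measure) \<Rightarrow> (('v \<Rightarrow> 'a) \<Rightarrow> real) \<Rightarrow> 'v set set \<Rightarrow> ('v \<Rightarrow> 'a) \<Rightarrow> real" where
  "next_density L h \<K> z = (\<Prod>K\<in>\<K>. block_density L h K z)"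

lemma \<eta>_bounds: "0 \<le> \<eta>" "\<eta> \<le> 1"
  using \<epsilon> by (auto simp: power_le_one)

lemma \<eta>\<Delta>R: "\<eta> * real \<Delta> * R \<le> 1 / 18" "\<eta> * (real \<Delta> * R)\<^sup>2 \<le> 1 / 18" "\<eta> * real \<Delta> * R \<le> 1 / (18 * R)"
proof -
  have 1: "1 \<le> real \<Delta> * R" using \<Delta>_pos R mult_mono[of 1 "real \<Delta>" 1 R] by simp
  show 2: "\<eta> * (real \<Delta> * R)\<^sup>2 \<le> 1 / 18" using small by (simp add: power_mult_distrib mult_ac)
  have "real \<Delta> * R * 1 \<le> real \<Delta> * R * (real \<Delta> * R)" using 1 by (intro mult_left_mono) auto
  then have "\<eta> * (real \<Delta> * R) \<le> \<eta> * (real \<Delta> * R)\<^sup>2"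
    using \<eta>_bounds by (intro mult_left_mono) (auto simp: power2_eq_square)
  with 2 show "\<eta> * real \<Delta> * R \<le> 1 / 18" unfolding mult.assoc by linarith
  have "(real \<Delta> * R) * R \<le> (real \<Delta> * R) * (real \<Delta> * R)"
    using 1 R \<Delta>_pos by (intro mult_left_mono) auto
  then have "\<eta> * (real \<Delta> * R * R) \<le> \<eta> * (real \<Delta> * R)\<^sup>2"
    using \<eta>_bounds by (intro mult_left_mono) (auto simp: power2_eq_square)
  with 2 have "\<eta> * real \<Delta> * R * R \<le> 1 / 18" unfolding mult.assoc by linarith
  then show "\<eta> * real \<Delta> * R \<le> 1 / (18 * R)" using R by (simp add: field_simps)
qed

lemma \<omega>_nonneg: "v \<in> V \<Longrightarrow> w \<in> V \<Longrightarrow> 0 \<le> \<omega> v w"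
  using \<omega>_ge_1[of v w] by simp

lemma refs_prob_space: "refs L \<Longrightarrow> prob_space (L i)"
  unfolding refs_def by blast

lemma refs_sets: "refs L \<Longrightarrow> i \<in> V \<Longrightarrow> sets (L i) = sets (\<psi> i)"
  unfolding refs_def by blast

lemma refs_space: "refs L \<Longrightarrow> i \<in> V \<Longrightarrow> space (L i) = space (\<psi> i)"
  by (rule sets_eq_imp_space_eq) (rule refs_sets)

lemma borel_refs: "refs L \<Longrightarrow> i \<in> V \<Longrightarrow> borel_measurable (L i) = borel_measurable (\<psi> i)"
  by (rule measurable_cong_sets[OF refs_sets refl])

lemma refs_tv_leI:
  assumes L: "refs L" and i: "i \<in> V"
    and le: "\<And>f \<delta> C. f \<in> borel_measurable (\<psi> i) \<Longrightarrow>
      (\<And>z z'. z \<in> space (\<psi> i) \<Longrightarrow> z' \<in> space (\<psi> i) \<Longrightarrow> \<bar>f z - f z'\<bar> \<le> \<delta>) \<Longrightarrow>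
      (\<And>z. z \<in> space (\<psi> i) \<Longrightarrow> \<bar>f z\<bar> \<le> C) \<Longrightarrow> \<bar>wavg (L i) d f - wavg (L i) d' f\<bar> \<le> c * \<delta>"
  shows "tv_le (L i) d d' c"
  unfolding tv_le_def borel_refs[OF L i] refs_space[OF L i]
proof (intro allI impI)
  fix f :: "'a \<Rightarrow> real" and \<delta>
  assume f: "f \<in> borel_measurable (\<psi> i)" and "\<forall>z\<in>space (\<psi> i). \<forall>z'\<in>space (\<psi> i). \<bar>f z - f z'\<bar> \<le> \<delta>"
  then have osc: "\<And>z z'. z \<in> space (\<psi> i) \<Longrightarrow> z' \<in> space (\<psi> i) \<Longrightarrow> \<bar>f z - f z'\<bar> \<le> \<delta>" by blast
  obtain C where "\<forall>z\<in>space (\<psi> i). \<bar>f z\<bar> \<le> C"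
    using prob_space.bounded_osc_bound[OF refs_prob_space[OF L], of i f \<delta>] osc refs_space[OF L i] by auto
  then show "\<bar>wavg (L i) d f - wavg (L i) d' f\<bar> \<le> c * \<delta>" by (intro le[OF f osc, of C]) auto
qed

lemma refs_PiM_sets: "refs L \<Longrightarrow> sets (PiM V L) = sets S"
  by (rule sets_PiM_cong[OF refl]) (rule refs_sets)

lemma refs_PiM_space: "refs L \<Longrightarrow> space (PiM V L) = space S"
  by (rule sets_eq_imp_space_eq) (rule refs_PiM_sets)

lemma refs_finite_product_prob_space:
  assumes "refs L"
  shows "finite_product_prob_space L V"
proof -
  interpret prob_space "L i" for i by (rule refs_prob_space[OF assms])
  show ?thesis by unfold_locales (rule finite_V)
qed

lemma space_upd: "i \<in> V \<Longrightarrow> x \<in> space S \<Longrightarrow> z \<in> space (\<psi> i) \<Longrightarrow> x(i := z) \<in> space S"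
  by (rule space_PiM_fun_upd)

lemma measurable_upd: "i \<in> V \<Longrightarrow> x \<in> space S \<Longrightarrow> (\<lambda>z. x(i := z)) \<in> measurable (\<psi> i) S"
  by (rule measurable_PiM_fun_upd1)

lemma pos_density_upd:
  "refs L \<Longrightarrow> i \<in> V \<Longrightarrow> x \<in> space S \<Longrightarrow> pos_density S h \<Longrightarrow> pos_density (L i) (\<lambda>z. h (x(i := z)))"
  by (subst pos_density_sets_cong[OF refs_sets]) (auto intro: pos_density_comp[OF _ measurable_upd])

lemma component_space: "z \<in> space S \<Longrightarrow> w \<in> V \<Longrightarrow> z w \<in> space (\<psi> w)"
  by (auto simp: space_PiM)

lemma tilt_familyD:
  assumes "tilt_family q" "w \<in> V"
  shows "q w \<in> borel_measurable S" "x \<in> space S \<Longrightarrow> \<epsilon> \<le> q w x" "x \<in> space S \<Longrightarrow> q w x \<le> 1 / \<epsilon>"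
    "x \<in> space S \<Longrightarrow> a \<in> V - N w \<Longrightarrow> b \<in> space (\<psi> a) \<Longrightarrow> q w (x(a := b)) = q w x"
  using assms unfolding tilt_family_def by blast+

lemma tilt_family_1: "tilt_family (\<lambda>_ _. 1)"
  unfolding tilt_family_def using \<epsilon> by auto

lemma pos_density_tilt: "tilt_family q \<Longrightarrow> w \<in> V \<Longrightarrow> pos_density S (q w)"
  using \<epsilon> by (intro pos_densityI[of _ _ \<epsilon> "1 / \<epsilon>"]) (auto dest: tilt_familyD)

lemma pos_density_tilted: "pos_density S h \<Longrightarrow> tilt_family q \<Longrightarrow> pos_density S (tilted h q)"
  unfolding tilted_def[abs_def]
  by (intro pos_density_mult pos_density_prod finite_V) (auto intro: pos_density_tilt)

text \<open>By symmetry of \<open>N\<close>, the factors that see coordinate \<open>v\<close> are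
  those attached to \<open>N v\<close>. \<open>same\<close> is an arbitrary proposition under which
  these factors agree; the distance then vanishes, even if factors farther away differ.\<close>

lemma tilt_tv:
  assumes L: "refs L" and e: "pos_density (L v) e" and v: "v \<in> V"
    and q: "tilt_family q" "tilt_family q'" and x: "x \<in> space S" "x' \<in> space S"
    and eq: "\<And>w a. same \<Longrightarrow> a \<in> space (\<psi> v) \<Longrightarrow> w \<in> N v \<Longrightarrow> q w (x(v := a)) = q' w (x'(v := a))"
  shows "tv_le (L v) (\<lambda>a. e a * (\<Prod>w\<in>V. q w (x(v := a)))) (\<lambda>a. e a * (\<Prod>w\<in>V. q' w (x'(v := a))))
    (if same then 0 else \<eta>)"
proof -
  interpret Lv: prob_space "L v" by (rule refs_prob_space[OF L])
  note sp = refs_space[OF L v]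
  have meas: "(\<lambda>a. q w (x(v := a))) \<in> borel_measurable (L v)"
    if "tilt_family q" "x \<in> space S" "w \<in> V" for q x w
    unfolding borel_refs[OF L v]
    by (rule measurable_compose[OF measurable_upd[OF v that(2)] tilt_familyD(1)[OF that(1,3)]])
  have bounds: "\<epsilon> \<le> q w (x(v := a)) \<and> q w (x(v := a)) \<le> 1 / \<epsilon>"
    if "tilt_family q" "x \<in> space S" "w \<in> V" "a \<in> space (L v)" for q x w a
    using tilt_familyD(2,3)[OF that(1,3) space_upd[OF v that(2)]] that(4) sp by simp
  have const: "q w (x(v := a)) = q w (x(v := a'))"
    if "tilt_family q" "x \<in> space S" "w \<in> V - N v" "a \<in> space (L v)" "a' \<in> space (L v)" for q x w a a'
  proof -
    have "w \<in> V" "v \<in> V - N w" using v N_sym[of w v] that(3) by auto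
    from tilt_familyD(4)[OF that(1) this(1) that(2) this(2)] show ?thesis using that(4,5) sp by simp
  qed
  have "tv_le (L v) (\<lambda>a. e a * (\<Prod>w\<in>V. q w (x(v := a)))) (\<lambda>a. e a * (\<Prod>w\<in>V. q' w (x'(v := a))))
    (if \<forall>w\<in>N v. \<forall>a\<in>space (L v). q w (x(v := a)) = q' w (x'(v := a)) then 0 else \<eta>)"
    by (rule Lv.tv_le_tilt[OF e finite_V N_sub[OF v] N_card[OF v] \<epsilon>])
       (intro conjI meas bounds const q x; assumption)+
  moreover have "(if \<forall>w\<in>N v. \<forall>a\<in>space (L v). q w (x(v := a)) = q' w (x'(v := a)) then 0 else \<eta>)
      \<le> (if same then 0 else \<eta>)"
    using eq \<eta>_bounds sp by auto
  ultimately show ?thesis by (rule Lv.tv_le_mono)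
qed

lemma tilt_change:
  assumes L: "refs L" and h: "pos_density S h" and q: "tilt_family q" "tilt_family q'" and i: "i \<in> V" and x: "x \<in> space S"
    and eq: "\<And>w z. same \<Longrightarrow> w \<in> N i \<Longrightarrow> q w z = q' w z"
  shows "tv_le (L i) (\<lambda>z. tilted h q (x(i := z))) (\<lambda>z. tilted h q' (x(i := z))) (if same then 0 else \<eta>)"
  unfolding tilted_def by (rule tilt_tv[OF L pos_density_upd[OF L i x h] i q x x]) (rule eq)

lemma pos_density_p:
  assumes "w \<in> V"
  shows "pos_density (S \<Otimes>\<^sub>M \<psi> w) (\<lambda>(x, z). p w x z)"
  using p_measurable[OF assms] p_bounds[OF assms] \<epsilon>
  by (intro pos_densityI[of _ _ \<epsilon> "1 / \<epsilon>"]) (auto simp: space_pair_measure)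

lemma pos_density_p_fst:
  assumes "w \<in> V" "z \<in> space (\<psi> w)"
  shows "pos_density S (\<lambda>x. p w x z)"
  using pos_density_comp[OF pos_density_p[OF assms(1)] measurable_Pair2'[OF assms(2)]] by simp

lemma pos_density_p_snd:
  assumes "w \<in> V" "x \<in> space S"
  shows "pos_density (\<psi> w) (\<lambda>z. p w x z)"
  using pos_density_comp[OF pos_density_p[OF assms(1)] measurable_Pair1'[OF assms(2)]] by simp

lemma pos_density_block_density:
  assumes L: "refs L" and h: "pos_density S h" and K: "K \<subseteq> V"
  shows "pos_density S (block_density L h K)"
proof -
  interpret finite_product_prob_space L V by (rule refs_finite_product_prob_space[OF L])
  have "pos_density (S \<Otimes>\<^sub>M S) (\<lambda>y. (\<Prod>w\<in>K. p w (fst y) (snd y w)) * h (fst y))"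
  proof (intro pos_density_mult pos_density_prod)
    show "finite K" using K finite_V finite_subset by blast
    show "pos_density (S \<Otimes>\<^sub>M S) (\<lambda>y. h (fst y))" using h by (rule pos_density_comp) simp
    fix w assume "w \<in> K"
    then have w: "w \<in> V" using K by blast
    have "(\<lambda>y. (fst y, snd y w)) \<in> S \<Otimes>\<^sub>M S \<rightarrow>\<^sub>M S \<Otimes>\<^sub>M \<psi> w" using w by measurable
    from pos_density_comp[OF pos_density_p[OF w] this]
    show "pos_density (S \<Otimes>\<^sub>M S) (\<lambda>y. p w (fst y) (snd y w))" by simp
  qed
  then have "pos_density (PiM V L \<Otimes>\<^sub>M S) (\<lambda>(x, z). (\<Prod>w\<in>K. p w x (z w)) * h x)"
    by (subst pos_density_sets_cong[OF sets_pair_measure_cong[OF refs_PiM_sets[OF L] refl]]) (simp add: case_prod_unfold)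
  from pos_density_integral_fst[OF prob_space_axioms this]
  show ?thesis unfolding block_density_def[abs_def] .
qed

lemma pos_density_next_density:
  assumes "refs L" "pos_density S h" "finite \<K>" "\<Union>\<K> \<subseteq> V"
  shows "pos_density S (next_density L h \<K>)"
  unfolding next_density_def[abs_def] using assms
  by (intro pos_density_prod pos_density_block_density) auto

section \<open>One time step as an average over the previous configuration\<close>

definition site_mass :: "('v \<Rightarrow> 'a measure) \<Rightarrow> 'v \<Rightarrow> ('a \<Rightarrow> real) \<Rightarrow> ('v \<Rightarrow> 'a) \<Rightarrow> real" where
  "site_mass L' v t x = (\<integral>z. t z * p v x z \<partial>L' v)"

definition site_avg :: "('v \<Rightarrow> 'a measure) \<Rightarrow> 'v \<Rightarrow> ('a \<Rightarrow> real) \<Rightarrow> ('a \<Rightarrow> real) \<Rightarrow> ('v \<Rightarrow> 'a) \<Rightarrow> real" where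
  "site_avg L' v t f x = wavg (L' v) (\<lambda>z. t z * p v x z) f"

text \<open>The weight put on the previous configuration \<open>x\<close> when the new coordinate at
  \<open>v\<close> is integrated out and the other new coordinates in \<open>K\<close> are held at
  \<open>z\<close>. Division by the mass of \<open>t\<close> makes the entry at \<open>v\<close> an
  average of \<open>p v x\<close>, which keeps it in [\<epsilon>, 1/\<epsilon>] and makes the family
  an admissible tilt.\<close>

definition back_tilt :: "('v \<Rightarrow> 'a measure) \<Rightarrow> 'v set \<Rightarrow> 'v \<Rightarrow> ('v \<Rightarrow> 'a) \<Rightarrow> ('a \<Rightarrow> real) \<Rightarrow> 'v \<Rightarrow> ('v \<Rightarrow> 'a) \<Rightarrow> real" where
  "back_tilt L' K v z t w x =
     (if w = v then site_mass L' v t x / (\<integral>z. t z \<partial>L' v) else if w \<in> K then p w x (z w) else 1)"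

context
  fixes L' v t
  assumes L': "refs L'" and v: "v \<in> V" and t: "pos_density (\<psi> v) t"
begin

interpretation Lv: prob_space "L' v" by (rule refs_prob_space[OF L'])

lemma t_L': "pos_density (L' v) t"
  using t pos_density_sets_cong[OF refs_sets[OF L' v]] by blast

lemma t_mass_pos: "0 < (\<integral>z. t z \<partial>L' v)"
  by (rule Lv.pos_density_integral_pos[OF t_L'])

lemma pos_density_tp_pair: "pos_density (S \<Otimes>\<^sub>M L' v) (\<lambda>(x, z). t z * p v x z)"
proof -
  have "pos_density (S \<Otimes>\<^sub>M \<psi> v) (\<lambda>y. t (snd y))" using t by (rule pos_density_comp) simp
  from pos_density_mult[OF this pos_density_p[OF v]]
  have "pos_density (S \<Otimes>\<^sub>M \<psi> v) (\<lambda>(x, z). t z * p v x z)" by (simp add: case_prod_unfold)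
  then show ?thesis
    using pos_density_sets_cong[OF sets_pair_measure_cong[OF refl refs_sets[OF L' v]]] by blast
qed

lemma pos_density_site_mass: "pos_density S (site_mass L' v t)"
  unfolding site_mass_def[abs_def] by (rule pos_density_integral_snd[OF Lv.prob_space_axioms pos_density_tp_pair])

lemma site_mass_bounds:
  assumes x: "x \<in> space S"
  shows "\<epsilon> \<le> site_mass L' v t x / (\<integral>z. t z \<partial>L' v)" "site_mass L' v t x / (\<integral>z. t z \<partial>L' v) \<le> 1 / \<epsilon>"
proof -
  have pm: "(\<lambda>z. p v x z) \<in> borel_measurable (L' v)"
    using pos_density_measurable[OF pos_density_p_snd[OF v x]] borel_refs[OF L' v] by blast
  have "\<epsilon> \<le> wavg (L' v) t (p v x)" "wavg (L' v) t (p v x) \<le> 1 / \<epsilon>"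
    using p_bounds[OF v x] refs_space[OF L' v] by (auto intro!: Lv.wavg_bounds[OF t_L' pm])
  then show "\<epsilon> \<le> site_mass L' v t x / (\<integral>z. t z \<partial>L' v)" "site_mass L' v t x / (\<integral>z. t z \<partial>L' v) \<le> 1 / \<epsilon>"
    unfolding wavg_def site_mass_def by (simp_all add: mult.commute)
qed

lemma p_fun_upd_far:
  "a \<in> V - N v \<Longrightarrow> x \<in> space S \<Longrightarrow> b \<in> space (\<psi> a) \<Longrightarrow> z \<in> space (L' v) \<Longrightarrow> p v (x(a := b)) z = p v x z"
  using p_local[OF v] refs_space[OF L' v] by simp

lemma tilt_family_back_tilt:
  assumes z: "z \<in> space S"
  shows "tilt_family (back_tilt L' K v z t)"
  unfolding tilt_family_def
proof (intro ballI conjI)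
  fix w assume w: "w \<in> V"
  note zw = component_space[OF z w]
  show "back_tilt L' K v z t w \<in> borel_measurable S"
    unfolding back_tilt_def[abs_def]
    using pos_density_measurable[OF pos_density_site_mass] pos_density_measurable[OF pos_density_p_fst[OF w zw]]
    by (cases "w = v"; cases "w \<in> K") auto
  fix x assume x: "x \<in> space S"
  show "\<epsilon> \<le> back_tilt L' K v z t w x" "back_tilt L' K v z t w x \<le> 1 / \<epsilon>"
    using site_mass_bounds[OF x] p_bounds[OF w x zw] \<epsilon> by (auto simp: back_tilt_def)
  fix a b assume a: "a \<in> V - N w" and b: "b \<in> space (\<psi> a)"
  have "site_mass L' v t (x(a := b)) = site_mass L' v t x" if "w = v"
    unfolding site_mass_def using p_fun_upd_far[OF _ x b] a that
    by (intro Bochner_Integration.integral_cong) auto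
  then show "back_tilt L' K v z t w (x(a := b)) = back_tilt L' K v z t w x"
    using p_local[OF w a x b zw] by (auto simp: back_tilt_def)
qed

text \<open>The previous configuration enters through \<open>p v x\<close> alone, hence through
  \<open>N v\<close>. Exchanging one transition density costs 1 - \<epsilon>^2, which is at most
  \<eta> because \<Delta> \<ge> 1.\<close>

lemma site_avg_osc:
  assumes L: "refs L" and f: "f \<in> borel_measurable (\<psi> v)"
    and osc: "\<And>z z'. z \<in> space (\<psi> v) \<Longrightarrow> z' \<in> space (\<psi> v) \<Longrightarrow> \<bar>f z - f z'\<bar> \<le> \<delta>"
  shows "coord_osc_le V L (site_avg L' v t f) (\<lambda>a. if a \<in> N v then \<eta> * \<delta> else 0)"
  unfolding coord_osc_le_def
proof (intro ballI)
  fix a x b assume a: "a \<in> V" and "x \<in> space (PiM V L)" "b \<in> space (L a)"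
  then have x: "x \<in> space S" and b: "b \<in> space (\<psi> a)"
    using refs_PiM_space[OF L] refs_space[OF L a] by auto
  note xb = space_upd[OF a x b]
  show "\<bar>site_avg L' v t f (x(a := b)) - site_avg L' v t f x\<bar> \<le> (if a \<in> N v then \<eta> * \<delta> else 0)"
  proof (cases "a \<in> N v")
    case False
    then have "site_avg L' v t f (x(a := b)) = site_avg L' v t f x"
      unfolding site_avg_def using p_fun_upd_far[OF _ x b] a by (intro wavg_cong) auto
    with False show ?thesis by simp
  next
    case True
    have "tv_le (L' v) (\<lambda>z. t z * p v (x(a := b)) z) (\<lambda>z. t z * p v x z) (1 - \<epsilon> / (1 / \<epsilon>))"
      using p_bounds[OF v x] p_bounds[OF v xb] refs_space[OF L' v] \<epsilon>
        pos_density_measurable[OF pos_density_p_snd[OF v x]] pos_density_measurable[OF pos_density_p_snd[OF v xb]]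
      by (intro Lv.tv_le_ratio[OF t_L', unfolded borel_refs[OF L' v]]) auto
    moreover have "1 - \<epsilon> / (1 / \<epsilon>) \<le> \<eta>"
      using power_decreasing[of 2 "2 * \<Delta>" \<epsilon>] \<Delta>_pos \<epsilon> by (simp add: power2_eq_square)
    ultimately have "tv_le (L' v) (\<lambda>z. t z * p v (x(a := b)) z) (\<lambda>z. t z * p v x z) \<eta>"
      by (rule Lv.tv_le_mono)
    from tv_leD[OF this, unfolded borel_refs[OF L' v] refs_space[OF L' v], OF f osc] True
    show ?thesis unfolding site_avg_def by simp
  qed
qed

lemma measurable_site_avg:
  assumes f: "f \<in> borel_measurable (\<psi> v)"
  shows "site_avg L' v t f \<in> borel_measurable S"
proof -
  note m[measurable] = pos_density_measurable[OF pos_density_tp_pair]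
  have f'[measurable]: "f \<in> borel_measurable (L' v)"
    using f borel_refs[OF L' v] by blast
  have "(\<lambda>x. \<integral>z. t z * p v x z \<partial>L' v) \<in> borel_measurable S"
    by (rule Lv.borel_measurable_lebesgue_integral) (rule m)
  moreover have "(\<lambda>(x, z). f z * (\<lambda>(x, z). t z * p v x z) (x, z)) \<in> borel_measurable (S \<Otimes>\<^sub>M L' v)"
    by measurable
  then have "(\<lambda>x. \<integral>z. f z * (t z * p v x z) \<partial>L' v) \<in> borel_measurable S"
    by (intro Lv.borel_measurable_lebesgue_integral) simp
  ultimately show ?thesis unfolding site_avg_def[abs_def] wavg_def by simp
qed

text \<open>A conditional average at time \<open>n + 1\<close> is an average over the configuration at time \<open>n\<close>:
  integrating out the new coordinate turns its weight into one more tilt.\<close>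

lemma block_density_cond:
  assumes L: "refs L" and h: "pos_density S h" and K: "K \<subseteq> V" "v \<in> K" and z: "z \<in> space S"
    and f: "f \<in> borel_measurable (\<psi> v)" and B: "\<And>z. z \<in> space (\<psi> v) \<Longrightarrow> \<bar>f z\<bar> \<le> B"
  shows "wavg (L' v) (\<lambda>a. block_density L h K (z(v := a)) * t a) f =
    wavg (PiM V L) (tilted h (back_tilt L' K v z t)) (site_avg L' v t f)"
proof -
  interpret P: finite_product_prob_space L V by (rule refs_finite_product_prob_space[OF L])
  interpret PL: pair_prob_space "PiM V L" "L' v" by unfold_locales
  define s where "s x = (\<Prod>w\<in>K - {v}. p w x (z w)) * h x" for x
  have finK: "finite K" using K finite_V finite_subset by blast
  have s: "pos_density S s"
    unfolding s_def[abs_def] using K finK component_space[OF z]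
    by (intro pos_density_mult pos_density_prod h pos_density_p_fst) auto
  have sP: "sets (PiM V L \<Otimes>\<^sub>M L' v) = sets (S \<Otimes>\<^sub>M L' v)"
    by (rule sets_pair_measure_cong[OF refs_PiM_sets[OF L] refl])
  have stp: "pos_density (PiM V L \<Otimes>\<^sub>M L' v) (\<lambda>(x, a). s x * (t a * p v x a))"
  proof -
    have "pos_density (S \<Otimes>\<^sub>M L' v) (\<lambda>y. s (fst y))" using s by (rule pos_density_comp) simp
    from pos_density_mult[OF this pos_density_tp_pair]
    show ?thesis using pos_density_sets_cong[OF sP] by (simp add: case_prod_unfold)
  qed
  have block: "block_density L h K (z(v := a)) = (\<integral>x. p v x a * s x \<partial>PiM V L)" for a
    unfolding block_density_def s_def prod.remove[OF finK K(2)]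
    by (intro Bochner_Integration.integral_cong) (auto intro!: arg_cong2[where f=times] prod.cong)
  \<comment> \<open>Fubini moves the integral over the new coordinate inside the one over the
    previous configuration. \<open>F = f\<close> gives the numerator, \<open>F = 1\<close> the
    denominator.\<close>
  have swap: "(\<integral>a. F a * (block_density L h K (z(v := a)) * t a) \<partial>L' v) =
      (\<integral>x. (\<integral>a. F a * (t a * p v x a) \<partial>L' v) * s x \<partial>PiM V L)"
    if F: "F \<in> borel_measurable (\<psi> v)" "\<And>z. z \<in> space (\<psi> v) \<Longrightarrow> \<bar>F z\<bar> \<le> C" for F C
  proof -
    have F': "(\<lambda>y. F (snd y)) \<in> borel_measurable (PiM V L \<Otimes>\<^sub>M L' v)"
      using F(1) borel_refs[OF L' v] by (intro measurable_compose[OF measurable_snd]) auto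
    have "integrable (PiM V L \<Otimes>\<^sub>M L' v) (\<lambda>y. F (snd y) * (\<lambda>(x, a). s x * (t a * p v x a)) y)"
      using F(2) refs_space[OF L' v]
      by (intro PL.P.pos_density_integrable_mult[OF stp F', of C]) (auto simp: space_pair_measure)
    then have int: "integrable (PiM V L \<Otimes>\<^sub>M L' v) (\<lambda>(x, a). F a * (s x * (t a * p v x a)))"
      by (simp add: case_prod_unfold)
    have "(\<integral>a. F a * (block_density L h K (z(v := a)) * t a) \<partial>L' v) =
        (\<integral>a. (\<integral>x. F a * (s x * (t a * p v x a)) \<partial>PiM V L) \<partial>L' v)"
      unfolding block by (intro Bochner_Integration.integral_cong[OF refl])
        (simp add: integral_mult_right_zero[symmetric] integral_mult_left_zero[symmetric] mult_ac
          del: integral_mult_right_zero integral_mult_left_zero)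
    also have "\<dots> = (\<integral>x. (\<integral>a. F a * (s x * (t a * p v x a)) \<partial>L' v) \<partial>PiM V L)"
      by (rule PL.Fubini_integral[OF int])
    also have "\<dots> = (\<integral>x. (\<integral>a. F a * (t a * p v x a) \<partial>L' v) * s x \<partial>PiM V L)"
      by (subst integral_mult_left_zero[symmetric]) (simp add: mult_ac)
    finally show ?thesis .
  qed
  have num: "(\<integral>a. f a * (block_density L h K (z(v := a)) * t a) \<partial>L' v) =
      (\<integral>x. site_avg L' v t f x * (site_mass L' v t x * s x) \<partial>PiM V L)"
  proof (subst swap[OF f B], assumption, rule Bochner_Integration.integral_cong[OF refl])
    fix x assume "x \<in> space (PiM V L)"
    then have "0 < site_mass L' v t x"
      using pos_density_pos[OF pos_density_site_mass] refs_PiM_space[OF L] by auto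
    then show "(\<integral>a. f a * (t a * p v x a) \<partial>L' v) * s x = site_avg L' v t f x * (site_mass L' v t x * s x)"
      by (simp add: site_avg_def wavg_def site_mass_def)
  qed
  have den: "(\<integral>a. block_density L h K (z(v := a)) * t a \<partial>L' v) = (\<integral>x. site_mass L' v t x * s x \<partial>PiM V L)"
    using swap[of "\<lambda>_. 1" 1] by (simp add: site_mass_def)
  have tilt: "site_mass L' v t x * s x = (\<integral>z. t z \<partial>L' v) * tilted h (back_tilt L' K v z t) x" for x
  proof -
    have "(\<Prod>w\<in>V. back_tilt L' K v z t w x) =
        site_mass L' v t x / (\<integral>z. t z \<partial>L' v) * (\<Prod>w\<in>V - {v}. if w \<in> K - {v} then p w x (z w) else 1)"
      unfolding prod.remove[OF finite_V v] by (auto simp: back_tilt_def intro!: prod.cong)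
    also have "(\<Prod>w\<in>V - {v}. if w \<in> K - {v} then p w x (z w) else 1) = (\<Prod>w\<in>K - {v}. p w x (z w))"
      using K(1) finite_V by (intro prod.mono_neutral_cong_right) auto
    finally show ?thesis using t_mass_pos by (simp add: tilted_def s_def)
  qed
  have "wavg (L' v) (\<lambda>a. block_density L h K (z(v := a)) * t a) f =
      wavg (PiM V L) (\<lambda>x. site_mass L' v t x * s x) (site_avg L' v t f)"
    unfolding wavg_def num den ..
  also have "\<dots> = wavg (PiM V L) (tilted h (back_tilt L' K v z t)) (site_avg L' v t f)"
    unfolding tilt using t_mass_pos by (intro wavg_scale) simp
  finally show ?thesis .
qed

end

section \<open>Propagation of decay and closeness over one time step\<close>

lemma decayD:
  assumes "decay L h c"
  shows "tilt_family q \<Longrightarrow> i \<in> V \<Longrightarrow> j \<in> V \<Longrightarrow> i \<noteq> j \<Longrightarrow> x \<in> space S \<Longrightarrow> b \<in> space (\<psi> j) \<Longrightarrow>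
      tv_le (L i) (\<lambda>z. tilted h q (x(i := z))) (\<lambda>z. tilted h q (x(j := b, i := z))) (c i j)"
    and "i \<in> V \<Longrightarrow> j \<in> V \<Longrightarrow> 0 \<le> c i j" and "i \<in> V \<Longrightarrow> (\<Sum>j\<in>V. \<omega> i j * c i j) \<le> 1 / 3"
  using assms unfolding decay_def by blast+

lemma decay_row:
  assumes "decay L h c" "i \<in> V"
  shows "(\<Sum>j\<in>V. c i j) \<le> 1 / 2"
proof -
  have "(\<Sum>j\<in>V. c i j) \<le> (\<Sum>j\<in>V. \<omega> i j * c i j)"
    using \<omega>_ge_1 decayD(2)[OF assms(1)] assms(2) mult_right_mono[of 1 "\<omega> i _" "c i _"] by (intro sum_mono) auto
  with decayD(3)[OF assms] show ?thesis by linarith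
qed

text \<open>From \<open>i\<close> to \<open>j\<close> the weight \<open>\<omega> v\<close> grows by
  at most the factor \<open>\<omega> i j\<close>, so the row bound 1/3 turns
  \<open>2 * B * \<omega> v\<close> into at most two thirds of \<open>B * \<omega> v i\<close>.
  Adding \<open>b\<close> stays below twice that weight, and no inverse of 1 - c has to be
  computed.\<close>

lemma decay_supersolution:
  assumes c: "decay L h c" and v: "v \<in> V" and i: "i \<in> V" and B: "0 \<le> B" and b: "b \<le> B * \<omega> v i"
  shows "(\<Sum>j\<in>V. c i j * (2 * B * \<omega> v j)) + b \<le> 2 * B * \<omega> v i"
proof -
  have "(\<Sum>j\<in>V. c i j * (2 * B * \<omega> v j)) \<le> (\<Sum>j\<in>V. c i j * (2 * B * (\<omega> v i * \<omega> i j)))"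
    using decayD(2)[OF c i] B \<omega>_triangle[OF v i] by (intro sum_mono mult_left_mono) auto
  also have "\<dots> = (\<Sum>j\<in>V. \<omega> i j * c i j) * (2 * (B * \<omega> v i))"
    by (simp add: sum_distrib_left sum_distrib_right mult_ac)
  also have "\<dots> \<le> 1 / 3 * (2 * (B * \<omega> v i))"
    using decayD(3)[OF c i] B \<omega>_nonneg[OF v i] by (intro mult_right_mono) auto
  finally show ?thesis using b mult_nonneg_nonneg[OF B \<omega>_nonneg[OF v i]] by simp
qed

lemma sum_N_le:
  assumes "v \<in> V" "\<And>a. a \<in> N v \<Longrightarrow> g a \<le> C" "0 \<le> C"
  shows "(\<Sum>a\<in>N v. g a) \<le> real \<Delta> * C"
proof -
  have "(\<Sum>a\<in>N v. g a) \<le> real (card (N v)) * C" using assms(2) by (rule sum_bounded_above)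
  also have "\<dots> \<le> real \<Delta> * C" using N_card[OF assms(1)] assms(3) by (intro mult_right_mono) auto
  finally show ?thesis .
qed

text \<open>The test function is an average at site \<open>v\<close> one step later: it oscillates
  by at most \<open>\<eta> * \<delta>\<close> on \<open>N v\<close> and not at all elsewhere. The
  supersolution is therefore read off near \<open>v\<close> only.\<close>

lemma tilted_comparison:
  assumes L: "refs L" and h: "pos_density S h" and h': "pos_density S h'" and c: "decay L h c"
    and q: "tilt_family q" and q': "tilt_family q'" and v: "v \<in> V"
    and diff: "\<And>i x. i \<in> V \<Longrightarrow> x \<in> space S \<Longrightarrow>
      tv_le (L i) (\<lambda>z. tilted h q (x(i := z))) (\<lambda>z. tilted h' q' (x(i := z))) (b i)"
    and W: "\<And>i. i \<in> V \<Longrightarrow> 0 \<le> W i" "\<And>i. i \<in> V \<Longrightarrow> (\<Sum>j\<in>V. c i j * W j) + b i \<le> W i"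
    and F: "F \<in> borel_measurable S" and osc: "coord_osc_le V L F (\<lambda>a. if a \<in> N v then \<eta> * \<delta> else 0)"
  shows "\<bar>wavg (PiM V L) (tilted h q) F - wavg (PiM V L) (tilted h' q') F\<bar> \<le> \<eta> * (\<Sum>a\<in>N v. W a) * \<delta>"
proof -
  interpret finite_product_prob_space L V by (rule refs_finite_product_prob_space[OF L])
  note sc = pos_density_sets_cong[OF refs_PiM_sets[OF L]]
  have "\<bar>wavg (PiM V L) (tilted h q) F - wavg (PiM V L) (tilted h' q') F\<bar> \<le> (\<Sum>i\<in>V. (if i \<in> N v then \<eta> * \<delta> else 0) * W i)"
  proof (rule dobrushin_comparison[where C=c and b=b])
    show "pos_density P (tilted h q)" "pos_density P (tilted h' q')"
      unfolding sc by (rule pos_density_tilted[OF h q] pos_density_tilted[OF h' q'])+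
    show "F \<in> borel_measurable P" using F measurable_cong_sets[OF refs_PiM_sets[OF L] refl] by blast
  qed (use decayD[OF c] decay_row[OF c] diff W osc q refs_space[OF L] refs_PiM_space[OF L] in auto)
  also have "\<dots> = (\<Sum>i\<in>N v. (\<eta> * \<delta>) * W i)"
    using finite_V N_sub[OF v] by (intro sum.mono_neutral_cong_right) auto
  also have "\<dots> = \<eta> * (\<Sum>a\<in>N v. W a) * \<delta>" by (simp add: sum_distrib_left sum_distrib_right mult_ac)
  finally show ?thesis .
qed

lemma pos_density_tilt_site:
  assumes "tilt_family q" "v \<in> V" "z \<in> space S"
  shows "pos_density (\<psi> v) (\<lambda>a. \<Prod>w\<in>V. q w (z(v := a)))"
  using assms by (intro pos_density_prod finite_V pos_density_comp[OF pos_density_tilt measurable_upd])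

text \<open>Blocks not containing \<open>v\<close> contribute a factor that is constant in
  coordinate \<open>v\<close> and cancels, so only the block \<open>K\<close> of \<open>v\<close> is
  left.\<close>

lemma next_density_cond:
  assumes L: "refs L" and L': "refs L'" and h: "pos_density S h" and \<K>: "partition_on V \<K>"
    and K: "K \<in> \<K>" "v \<in> K" and z: "z \<in> space S" and q: "tilt_family q"
    and f: "f \<in> borel_measurable (\<psi> v)" and B: "\<And>z. z \<in> space (\<psi> v) \<Longrightarrow> \<bar>f z\<bar> \<le> B"
  defines "t \<equiv> \<lambda>a. \<Prod>w\<in>V. q w (z(v := a))"
  shows "wavg (L' v) (\<lambda>a. tilted (next_density L h \<K>) q (z(v := a))) f =
    wavg (PiM V L) (tilted h (back_tilt L' K v z t)) (site_avg L' v t f)"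
proof -
  have sub: "K \<subseteq> V" if "K \<in> \<K>" for K using \<K> that by (auto simp: partition_on_def)
  then have v: "v \<in> V" using K by blast
  have fin: "finite \<K>" using finite_V \<K> finite_elements by blast
  define k where "k = (\<Prod>K'\<in>\<K> - {K}. block_density L h K' z)"
  have "0 < k"
    unfolding k_def using pos_density_pos[OF pos_density_block_density[OF L h sub] z] by (intro prod_pos) auto
  have "block_density L h K' (z(v := a)) = block_density L h K' z" if "K' \<in> \<K> - {K}" for K' a
  proof -
    have "v \<notin> K'" using partition_onD2[OF \<K>] K that by (auto dest: disjointD)
    then have "(\<Prod>w\<in>K'. p w x ((z(v := a)) w)) = (\<Prod>w\<in>K'. p w x (z w))" for x
      by (intro prod.cong) auto
    then show ?thesis unfolding block_density_def by simp
  qed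
  then have "next_density L h \<K> (z(v := a)) = block_density L h K (z(v := a)) * k" for a
    unfolding next_density_def k_def prod.remove[OF fin K(1)] by simp
  then have "wavg (L' v) (\<lambda>a. tilted (next_density L h \<K>) q (z(v := a))) f =
      wavg (L' v) (\<lambda>a. k * (block_density L h K (z(v := a)) * t a)) f"
    by (intro wavg_cong) (simp_all add: tilted_def t_def)
  also have "\<dots> = wavg (L' v) (\<lambda>a. block_density L h K (z(v := a)) * t a) f"
    using \<open>0 < k\<close> by (intro wavg_scale) simp
  also have "\<dots> = wavg (PiM V L) (tilted h (back_tilt L' K v z t)) (site_avg L' v t f)"
    unfolding t_def using pos_density_tilt_site[OF q v z]
    by (rule block_density_cond[OF L' v _ L h sub[OF K(1)] K(2) z f]) (rule B)
  finally show ?thesis .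
qed

text \<open>The hypothesis on \<open>B\<close> is shaped for the supersolution
  \<open>2 * B v * \<omega> v a\<close>: old error plus blocking error may grow at most like
  \<open>\<omega> v a\<close> away from \<open>v\<close>. Summed over \<open>N v\<close> the
  supersolution is at most \<open>\<Delta> * (2 * B v * R)\<close>. The smallness condition contains
  R squared; one factor \<open>R\<close> pays for the neighbourhood and the other one is the
  gain.\<close>

lemma close_step:
  assumes L: "refs L" and L': "refs L'" and h: "pos_density S h" and h': "pos_density S h'"
    and c: "decay L h c" and w: "close L h h' w" and \<K>: "partition_on V \<K>"
    and w0: "\<And>a. a \<in> V \<Longrightarrow> 0 \<le> w a"
    and B: "\<And>v K a. v \<in> K \<Longrightarrow> K \<in> \<K> \<Longrightarrow> a \<in> V \<Longrightarrow> w a + (if N a \<subseteq> K then 0 else \<eta>) \<le> B v * \<omega> v a"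
  shows "close L' (next_density L h {V}) (next_density L h' \<K>) (\<lambda>v. B v / R)"
  unfolding close_def
proof (intro allI impI)
  fix q v z assume q: "tilt_family q" and v: "v \<in> V" and z: "z \<in> space S"
  interpret Lv: prob_space "L' v" by (rule refs_prob_space[OF L'])
  obtain K where K: "K \<in> \<K>" "v \<in> K" using \<K> v by (auto simp: partition_on_def)
  define t where "t = (\<lambda>a. \<Prod>w\<in>V. q w (z(v := a)))"
  have t: "pos_density (\<psi> v) t" unfolding t_def by (rule pos_density_tilt_site[OF q v z])
  have tf: "tilt_family (back_tilt L' K v z t)" for K
    by (rule tilt_family_back_tilt[OF L' v t z])
  \<comment> \<open>The hypothesis on \<open>B\<close> at \<open>a = v\<close>, where the left side
    is nonnegative and the weight is 1.\<close>
  have "0 \<le> B v * \<omega> v v" using B[OF K(2,1) v] w0[OF v] \<eta>_bounds by (smt (verit))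
  then have B0: "0 \<le> B v" using \<omega>_refl[OF v] by simp
  define W where "W a = 2 * B v * \<omega> v a" for a
  have W0: "0 \<le> W a" if "a \<in> V" for a
    unfolding W_def using B0 \<omega>_ge_1[OF v that] by auto
  have super: "(\<Sum>j\<in>V. c i j * W j) + (w i + (if N i \<subseteq> K then 0 else \<eta>)) \<le> W i" if i: "i \<in> V" for i
    unfolding W_def by (rule decay_supersolution[OF c v i B0 B[OF K(2,1) i]])
  have est: "\<eta> * (\<Sum>a\<in>N v. W a) \<le> B v / R"
  proof -
    have "(\<Sum>a\<in>N v. W a) \<le> real \<Delta> * (2 * B v * R)"
      unfolding W_def using B0 R \<omega>_N[OF v] by (intro sum_N_le[OF v] mult_left_mono) auto
    then have "\<eta> * (\<Sum>a\<in>N v. W a) \<le> \<eta> * (real \<Delta> * (2 * B v * R))"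
      using \<eta>_bounds by (intro mult_left_mono) auto
    also have "\<dots> = 2 * B v * (\<eta> * real \<Delta> * R)" by (simp add: mult_ac)
    also have "\<dots> \<le> 2 * B v * (1 / (18 * R))" using B0 \<eta>\<Delta>R(3) by (intro mult_left_mono) auto
    also have "\<dots> \<le> B v / R" using B0 R by (simp add: field_simps)
    finally show ?thesis .
  qed
  \<comment> \<open>First the law changes under a common tilt, then the tilt under a common law. The
    two tilts differ at vertices outside \<open>K\<close> only, and the conditional law at
    \<open>i\<close> sees such a vertex only if it lies in \<open>N i\<close>.\<close>
  have diff: "tv_le (L i) (\<lambda>a. tilted h (back_tilt L' V v z t) (x(i := a))) (\<lambda>a. tilted h' (back_tilt L' K v z t) (x(i := a)))
      (w i + (if N i \<subseteq> K then 0 else \<eta>))" if i: "i \<in> V" and x: "x \<in> space S" for i x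
  proof (rule tv_le_trans)
    show "tv_le (L i) (\<lambda>a. tilted h (back_tilt L' V v z t) (x(i := a))) (\<lambda>a. tilted h' (back_tilt L' V v z t) (x(i := a))) (w i)"
      using w tf i x unfolding close_def by blast
    show "tv_le (L i) (\<lambda>a. tilted h' (back_tilt L' V v z t) (x(i := a))) (\<lambda>a. tilted h' (back_tilt L' K v z t) (x(i := a)))
      (if N i \<subseteq> K then 0 else \<eta>)"
      by (rule tilt_change[OF L h' tf tf i x]) (use N_sub[OF i] in \<open>auto simp: back_tilt_def\<close>)
  qed
  have "tv_le (L' v) (\<lambda>a. tilted (next_density L h {V}) q (z(v := a))) (\<lambda>a. tilted (next_density L h' \<K>) q (z(v := a)))
      (\<eta> * (\<Sum>a\<in>N v. W a))"
  proof (rule refs_tv_leI[OF L' v])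
    fix f :: "'a \<Rightarrow> real" and \<delta> C
    assume f: "f \<in> borel_measurable (\<psi> v)"
      and osc: "\<And>z z'. z \<in> space (\<psi> v) \<Longrightarrow> z' \<in> space (\<psi> v) \<Longrightarrow> \<bar>f z - f z'\<bar> \<le> \<delta>"
      and C: "\<And>z. z \<in> space (\<psi> v) \<Longrightarrow> \<bar>f z\<bar> \<le> C"
    have V: "V \<noteq> {}" using v by blast
    have e: "wavg (L' v) (\<lambda>a. tilted (next_density L h {V}) q (z(v := a))) f =
        wavg (PiM V L) (tilted h (back_tilt L' V v z t)) (site_avg L' v t f)"
      "wavg (L' v) (\<lambda>a. tilted (next_density L h' \<K>) q (z(v := a))) f =
        wavg (PiM V L) (tilted h' (back_tilt L' K v z t)) (site_avg L' v t f)"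
      unfolding t_def
      by (rule next_density_cond[OF L L' h partition_on_space[OF V] _ v z q f C], simp, assumption)
         (rule next_density_cond[OF L L' h' \<K> K z q f C])
    show "\<bar>wavg (L' v) (\<lambda>a. tilted (next_density L h {V}) q (z(v := a))) f -
        wavg (L' v) (\<lambda>a. tilted (next_density L h' \<K>) q (z(v := a))) f\<bar> \<le> \<eta> * (\<Sum>a\<in>N v. W a) * \<delta>"
      unfolding e
      by (rule tilted_comparison[OF L h h' c tf tf v diff W0 super
            measurable_site_avg[OF L' v t f] site_avg_osc[OF L' v t L f osc]])
  qed
  then show "tv_le (L' v) (\<lambda>a. tilted (next_density L h {V}) q (z(v := a))) (\<lambda>a. tilted (next_density L h' \<K>) q (z(v := a))) (B v / R)"
    using est by (rule Lv.tv_le_mono)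
qed

text \<open>Coordinate \<open>j\<close> acts on \<open>i\<close> in two ways. Directly, through tilt
  factors that see both, which requires that \<open>N i\<close> and \<open>N j\<close> meet.
  Indirectly, through the previous configuration: a change of \<open>z j\<close> alters only the
  transition density of \<open>j\<close>, hence the conditional laws at sites in \<open>N j\<close>;
  this disturbance \<open>b _ j\<close> spreads by the old influence matrix and is read off on
  \<open>N i\<close>. Each way has weighted row sums at most 1/18.\<close>

lemma decay_step:
  assumes L: "refs L" and L': "refs L'" and h: "pos_density S h" and c: "decay L h c"
  shows "\<exists>c'. decay L' (next_density L h {V}) c'"
proof -
  define b where "b i j = (if i \<notin> N j then 0 else \<eta>)" for i j
  obtain W where W: "\<And>i l. i \<in> V \<Longrightarrow> l \<in> V \<Longrightarrow> 0 \<le> W i l"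
    "\<And>i l. i \<in> V \<Longrightarrow> l \<in> V \<Longrightarrow> (\<Sum>j\<in>V. c i j * W j l) + b i l \<le> W i l"
    "\<And>i. i \<in> V \<Longrightarrow> (\<Sum>l\<in>V. \<omega> i l * W i l) \<le> 2 * (\<eta> * real \<Delta> * R)"
  proof (rule supersolution_exists[where I=V and L=V and C=c and b=b and E=\<omega> and q=\<omega> and B="\<eta> * real \<Delta> * R"])
    fix i assume i: "i \<in> V"
    show "(\<Sum>j\<in>V. \<omega> i j * c i j) \<le> 1 / 2" using decayD(3)[OF c i] by simp
    have "(\<Sum>l\<in>V. \<omega> i l * b i l) = (\<Sum>l\<in>N i. \<omega> i l * \<eta>)"
      using N_sub[OF i] finite_V N_sym i by (intro sum.mono_neutral_cong_right) (auto simp: b_def)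
    also have "\<dots> \<le> real \<Delta> * (R * \<eta>)"
      using \<omega>_N[OF i] \<eta>_bounds R by (intro sum_N_le[OF i] mult_right_mono) auto
    finally show "(\<Sum>l\<in>V. \<omega> i l * b i l) \<le> \<eta> * real \<Delta> * R" by (simp add: mult_ac)
  qed (use finite_V decayD(2)[OF c] \<omega>_ge_1 \<omega>_nonneg \<omega>_triangle \<eta>_bounds R in \<open>auto simp: b_def\<close>)
  define c' where "c' i j = (if N i \<inter> N j = {} then 0 else \<eta>) + \<eta> * (\<Sum>a\<in>N i. W a j)" for i j
  have "decay L' (next_density L h {V}) c'"
    unfolding decay_def
  proof (intro conjI allI impI ballI)
    fix i j assume i: "i \<in> V" and j: "j \<in> V"
    have "0 \<le> (\<Sum>a\<in>N i. W a j)" using W(1)[OF _ j] N_sub[OF i] by (intro sum_nonneg) auto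
    then have "0 \<le> \<eta> * (\<Sum>a\<in>N i. W a j)" using \<eta>_bounds by (intro mult_nonneg_nonneg)
    then show "0 \<le> c' i j" unfolding c'_def using \<eta>_bounds by simp
  next
    fix i assume i: "i \<in> V"
    have Rpos: "0 \<le> R" using R by simp
    \<comment> \<open>At most \<Delta>^2 vertices \<open>j\<close> have a neighbourhood meeting
      \<open>N i\<close>, each reached through a common neighbour at weight at most R^2. This is the
      origin of \<Delta>^2 R^2 in the smallness condition.\<close>
    have "(\<Sum>j\<in>V. \<omega> i j * (if N i \<inter> N j = {} then 0 else \<eta>)) \<le> (\<Sum>j\<in>(\<Union>a\<in>N i. N a). R * R * \<eta>)"
    proof -
      have "(\<Sum>j\<in>V. \<omega> i j * (if N i \<inter> N j = {} then 0 else \<eta>)) = (\<Sum>j\<in>{j\<in>V. N i \<inter> N j \<noteq> {}}. \<omega> i j * \<eta>)"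
        using finite_V by (intro sum.mono_neutral_cong_right) auto
      also have "\<dots> \<le> (\<Sum>j\<in>{j\<in>V. N i \<inter> N j \<noteq> {}}. R * R * \<eta>)"
      proof (intro sum_mono mult_right_mono)
        fix j assume "j \<in> {j\<in>V. N i \<inter> N j \<noteq> {}}"
        then obtain a where a: "j \<in> V" "a \<in> N i" "a \<in> N j" by blast
        then have aV: "a \<in> V" using N_sub[OF i] by blast
        have "\<omega> i j \<le> \<omega> i a * \<omega> a j" by (rule \<omega>_triangle[OF i aV a(1)])
        also have "\<dots> \<le> R * R"
          using \<omega>_N[OF i a(2)] \<omega>_N[OF aV N_sym[OF a(1) aV a(3)]] \<omega>_ge_1[OF aV a(1)] Rpos by (intro mult_mono) auto
        finally show "\<omega> i j \<le> R * R" .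
      qed (rule \<eta>_bounds)
      also have "\<dots> \<le> (\<Sum>j\<in>(\<Union>a\<in>N i. N a). R * R * \<eta>)"
      proof (rule sum_mono2)
        show "finite (\<Union>a\<in>N i. N a)" using N_sub[OF i] N_sub finite_V by (meson UN_least finite_subset subsetD)
        show "{j \<in> V. N i \<inter> N j \<noteq> {}} \<subseteq> (\<Union>a\<in>N i. N a)" using N_sym N_sub[OF i] by blast
      qed (use \<eta>_bounds Rpos in auto)
      finally show ?thesis .
    qed
    also have "\<dots> = real (card (\<Union>a\<in>N i. N a)) * (R * R * \<eta>)" by simp
    also have "\<dots> \<le> real (\<Delta> * \<Delta>) * (R * R * \<eta>)"
    proof (intro mult_right_mono)
      have "finite (N i)" using N_sub[OF i] finite_V finite_subset by blast
      then have "card (\<Union>a\<in>N i. N a) \<le> (\<Sum>a\<in>N i. card (N a))" by (rule card_UN_le)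
      also have "\<dots> \<le> card (N i) * \<Delta>" using N_sub[OF i] N_card by (intro sum_bounded_above[of _ _ \<Delta>, simplified]) auto
      also have "\<dots> \<le> \<Delta> * \<Delta>" using N_card[OF i] by simp
      finally show "real (card (\<Union>a\<in>N i. N a)) \<le> real (\<Delta> * \<Delta>)" unfolding of_nat_le_iff .
    qed (use \<eta>_bounds Rpos in auto)
    also have "\<dots> = \<eta> * (real \<Delta> * R)\<^sup>2" by (simp add: power2_eq_square mult_ac)
    finally have 1: "(\<Sum>j\<in>V. \<omega> i j * (if N i \<inter> N j = {} then 0 else \<eta>)) \<le> 1 / 18" using \<eta>\<Delta>R(2) by linarith
    have "(\<Sum>j\<in>V. \<omega> i j * (\<eta> * (\<Sum>a\<in>N i. W a j))) = \<eta> * (\<Sum>a\<in>N i. \<Sum>j\<in>V. \<omega> i j * W a j)"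
      by (subst sum.swap) (simp add: sum_distrib_left sum_distrib_right mult_ac)
    also have "\<dots> \<le> \<eta> * (real \<Delta> * (R * (2 * (1 / 18))))"
    proof (intro mult_left_mono sum_N_le[OF i])
      fix a assume a: "a \<in> N i"
      then have aV: "a \<in> V" using N_sub[OF i] by blast
      have "(\<Sum>j\<in>V. \<omega> i j * W a j) \<le> (\<Sum>j\<in>V. R * (\<omega> a j * W a j))"
      proof (intro sum_mono)
        fix j assume j: "j \<in> V"
        have "\<omega> i j \<le> R * \<omega> a j"
          using \<omega>_triangle[OF i aV j] mult_right_mono[OF \<omega>_N[OF i a], of "\<omega> a j"] \<omega>_ge_1[OF aV j] by linarith
        from mult_right_mono[OF this W(1)[OF aV j]] show "\<omega> i j * W a j \<le> R * (\<omega> a j * W a j)"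
          by (simp add: mult.assoc)
      qed
      also have "\<dots> = R * (\<Sum>j\<in>V. \<omega> a j * W a j)" by (simp add: sum_distrib_left)
      also have "\<dots> \<le> R * (2 * (1 / 18))" using W(3)[OF aV] \<eta>\<Delta>R(1) Rpos by (intro mult_left_mono) auto
      finally show "(\<Sum>j\<in>V. \<omega> i j * W a j) \<le> R * (2 * (1 / 18))" .
    qed (use \<eta>_bounds Rpos in auto)
    also have "\<dots> = (\<eta> * real \<Delta> * R) * (1 / 9)" by simp
    also have "\<dots> \<le> 1 / 18" using \<eta>\<Delta>R(1) by linarith
    finally show "(\<Sum>j\<in>V. \<omega> i j * c' i j) \<le> 1 / 3"
      using 1 unfolding c'_def by (simp add: distrib_left sum.distrib)
  next
    fix q v j z d assume q: "tilt_family q" and v: "v \<in> V" and j: "j \<in> V" and vj: "v \<noteq> j"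
      and z: "z \<in> space S" and d: "d \<in> space (\<psi> j)"
    interpret Lv: prob_space "L' v" by (rule refs_prob_space[OF L'])
    note zd = space_upd[OF j z d]
    \<comment> \<open>The tilt factors are taken at the changed configuration. The weight with the
      old block density and these new factors lies between the two laws and separates the direct
      from the indirect effect.\<close>
    define t where "t = (\<lambda>a. \<Prod>w\<in>V. q w (z(j := d, v := a)))"
    have t: "pos_density (\<psi> v) t" unfolding t_def by (rule pos_density_tilt_site[OF q v zd])
    have tf: "tilt_family (back_tilt L' V v z t)" "tilt_family (back_tilt L' V v (z(j := d)) t)"
      by (rule tilt_family_back_tilt[OF L' v t] z zd)+
    have V: "V \<noteq> {}" using v by blast
    have nd: "next_density L h {V} = block_density L h V" by (simp add: next_density_def fun_eq_iff)
    have bd: "pos_density S (block_density L h V)" by (rule pos_density_block_density[OF L h]) simp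
    have "tv_le (L' v) (\<lambda>a. block_density L h V (z(v := a)) * (\<Prod>w\<in>V. q w (z(v := a))))
        (\<lambda>a. block_density L h V (z(v := a)) * t a) (if N v \<inter> N j = {} then 0 else \<eta>)"
      unfolding t_def
    proof (rule tilt_tv[OF L' pos_density_upd[OF L' v z bd] v q q z zd])
      fix w a assume "N v \<inter> N j = {}" and a: "a \<in> space (\<psi> v)" and "w \<in> N v"
      then have "w \<in> V" "j \<in> V - N w" using N_sub[OF v] j N_sym[of w j] by auto
      from tilt_familyD(4)[OF q this(1) space_upd[OF v z a] this(2) d]
      show "q w (z(v := a)) = q w (z(j := d, v := a))" using vj by (simp add: fun_upd_twist)
    qed
    then have 1: "tv_le (L' v) (\<lambda>a. tilted (next_density L h {V}) q (z(v := a)))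
        (\<lambda>a. block_density L h V (z(v := a)) * t a) (if N v \<inter> N j = {} then 0 else \<eta>)"
      unfolding nd tilted_def .
    have diff: "tv_le (L i) (\<lambda>a. tilted h (back_tilt L' V v z t) (x(i := a)))
        (\<lambda>a. tilted h (back_tilt L' V v (z(j := d)) t) (x(i := a))) (b i j)"
      if i: "i \<in> V" and x: "x \<in> space S" for i x
      unfolding b_def by (rule tilt_change[OF L h tf i x]) (use N_sym[OF i j] in \<open>auto simp: back_tilt_def\<close>)
    have 2: "tv_le (L' v) (\<lambda>a. block_density L h V (z(v := a)) * t a)
        (\<lambda>a. tilted (next_density L h {V}) q (z(j := d, v := a))) (\<eta> * (\<Sum>a\<in>N v. W a j))"
    proof (rule refs_tv_leI[OF L' v])
      fix f :: "'a \<Rightarrow> real" and \<delta> C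
      assume f: "f \<in> borel_measurable (\<psi> v)"
        and osc: "\<And>z z'. z \<in> space (\<psi> v) \<Longrightarrow> z' \<in> space (\<psi> v) \<Longrightarrow> \<bar>f z - f z'\<bar> \<le> \<delta>"
        and C: "\<And>z. z \<in> space (\<psi> v) \<Longrightarrow> \<bar>f z\<bar> \<le> C"
      have e: "wavg (L' v) (\<lambda>a. block_density L h V (z(v := a)) * t a) f =
          wavg (PiM V L) (tilted h (back_tilt L' V v z t)) (site_avg L' v t f)"
        by (rule block_density_cond[OF L' v t L h subset_refl v z f C])
      have e': "wavg (L' v) (\<lambda>a. tilted (next_density L h {V}) q (z(j := d, v := a))) f =
          wavg (PiM V L) (tilted h (back_tilt L' V v (z(j := d)) t)) (site_avg L' v t f)"
        unfolding t_def
        by (rule next_density_cond[OF L L' h partition_on_space[OF V] _ v zd q f C]) auto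
      show "\<bar>wavg (L' v) (\<lambda>a. block_density L h V (z(v := a)) * t a) f -
          wavg (L' v) (\<lambda>a. tilted (next_density L h {V}) q (z(j := d, v := a))) f\<bar> \<le> \<eta> * (\<Sum>a\<in>N v. W a j) * \<delta>"
        unfolding e e'
        by (rule tilted_comparison[OF L h h c tf v diff W(1)[OF _ j] W(2)[OF _ j]
              measurable_site_avg[OF L' v t f] site_avg_osc[OF L' v t L f osc]])
    qed
    show "tv_le (L' v) (\<lambda>a. tilted (next_density L h {V}) q (z(v := a)))
        (\<lambda>a. tilted (next_density L h {V}) q (z(j := d, v := a))) (c' v j)"
      using tv_le_trans[OF 1 2] unfolding c'_def .
  qed
  then show ?thesis by blast
qed

end

section \<open>The filter operators on densities\<close>

lemma PiM_density:
  assumes I: "finite I" and M: "\<And>i. sigma_finite_measure (M i)"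
    and f[measurable]: "\<And>i. i \<in> I \<Longrightarrow> f i \<in> borel_measurable (M i)"
    and sf: "\<And>i. sigma_finite_measure (L i)" and L: "\<And>i. i \<in> I \<Longrightarrow> L i = density (M i) (f i)"
  shows "PiM I L = density (PiM I M) (\<lambda>x. \<Prod>i\<in>I. f i (x i))"
proof -
  interpret M: product_sigma_finite M by (rule product_sigma_finite.intro) (rule M)
  interpret L: product_sigma_finite L by (rule product_sigma_finite.intro) (rule sf)
  have sL: "sets (L i) = sets (M i)" if "i \<in> I" for i using L[OF that] by simp
  show ?thesis
  proof (rule L.PiM_eqI[OF I, symmetric])
    show "sets (density (PiM I M) (\<lambda>x. \<Prod>i\<in>I. f i (x i))) = sets (PiM I L)"
      using sets_PiM_cong[OF refl, of I M L] sL by simp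
    fix A assume "\<And>i. i \<in> I \<Longrightarrow> A i \<in> sets (L i)"
    then have A[measurable]: "A i \<in> sets (M i)" if "i \<in> I" for i using that sL by blast
    have R: "Pi\<^sub>E I A \<in> sets (PiM I M)" using I A by (intro sets_PiM_I_finite) auto
    have m: "(\<lambda>x. \<Prod>i\<in>I. f i (x i)) \<in> borel_measurable (PiM I M)"
      by (intro borel_measurable_prod_ennreal) measurable
    have "emeasure (density (PiM I M) (\<lambda>x. \<Prod>i\<in>I. f i (x i))) (Pi\<^sub>E I A) =
        (\<integral>\<^sup>+x. (\<Prod>i\<in>I. f i (x i)) * indicator (Pi\<^sub>E I A) x \<partial>PiM I M)"
      by (rule emeasure_density[OF m R])
    also have "\<dots> = (\<integral>\<^sup>+x. (\<Prod>i\<in>I. f i (x i) * indicator (A i) (x i)) \<partial>PiM I M)"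
    proof (rule nn_integral_cong)
      fix x assume "x \<in> space (PiM I M)"
      then have "indicator (Pi\<^sub>E I A) x = (\<Prod>i\<in>I. indicator (A i) (x i) :: ennreal)"
        using I by (auto simp: space_PiM PiE_iff indicator_def prod_zero_iff)
      then show "(\<Prod>i\<in>I. f i (x i)) * indicator (Pi\<^sub>E I A) x = (\<Prod>i\<in>I. f i (x i) * indicator (A i) (x i))"
        by (simp add: prod.distrib)
    qed
    also have "\<dots> = (\<Prod>i\<in>I. \<integral>\<^sup>+x. f i x * indicator (A i) x \<partial>M i)"
      using I by (intro M.product_nn_integral_prod) auto
    also have "\<dots> = (\<Prod>i\<in>I. emeasure (L i) (A i))"
      by (intro prod.cong refl) (simp add: L emeasure_density)
    finally show "emeasure (density (PiM I M) (\<lambda>x. \<Prod>i\<in>I. f i (x i))) (Pi\<^sub>E I A) = (\<Prod>i\<in>I. emeasure (L i) (A i))" .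
  qed
qed

lemma PiM_return:
  assumes I: "finite I" and x: "x \<in> space (PiM I M)"
    and L: "\<And>i. prob_space (L i)" "\<And>i. i \<in> I \<Longrightarrow> L i = return (M i) (x i)"
  shows "PiM I L = return (PiM I M) x"
proof -
  interpret L: product_sigma_finite L
    by (rule product_sigma_finite.intro) (intro prob_space_imp_sigma_finite L)
  have sL: "sets (L i) = sets (M i)" if "i \<in> I" for i using L(2)[OF that] by simp
  show ?thesis
  proof (rule L.PiM_eqI[OF I, symmetric])
    show "sets (return (PiM I M) x) = sets (PiM I L)"
      using sets_PiM_cong[OF refl, of I M L] sL by simp
    fix A assume "\<And>i. i \<in> I \<Longrightarrow> A i \<in> sets (L i)"
    then have A: "A i \<in> sets (M i)" if "i \<in> I" for i using that sL by blast
    have "emeasure (return (PiM I M) x) (Pi\<^sub>E I A) = indicator (Pi\<^sub>E I A) x"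
      using I A by (intro emeasure_return sets_PiM_I_finite) auto
    also have "\<dots> = (\<Prod>i\<in>I. indicator (A i) (x i))"
      using I x by (auto simp: space_PiM PiE_iff indicator_def prod_zero_iff)
    also have "\<dots> = (\<Prod>i\<in>I. emeasure (L i) (A i))"
      using A by (intro prod.cong refl) (simp add: L(2))
    finally show "emeasure (return (PiM I M) x) (Pi\<^sub>E I A) = (\<Prod>i\<in>I. emeasure (L i) (A i))" .
  qed
qed

lemma local_dist_le:
  assumes le: "\<And>f. f \<in> borel_measurable M \<Longrightarrow> (\<And>x. x \<in> space M \<Longrightarrow> \<bar>f x\<bar> \<le> 1) \<Longrightarrow>
      (\<And>x x'. x \<in> space M \<Longrightarrow> x' \<in> space M \<Longrightarrow> (\<And>j. j \<in> J \<Longrightarrow> x j = x' j) \<Longrightarrow> f x = f x') \<Longrightarrow>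
      \<bar>(\<integral>x. f x \<partial>\<rho>) - (\<integral>x. f x \<partial>\<rho>')\<bar> \<le> C"
  shows "local_dist M J \<rho> \<rho>' \<le> C"
proof -
  define F where "F = {f \<in> borel_measurable M. (\<forall>x\<in>space M. \<bar>f x\<bar> \<le> 1) \<and>
                (\<forall>x\<in>space M. \<forall>x'\<in>space M. (\<forall>j\<in>J. x j = x' j) \<longrightarrow> f x = (f x' :: real))}"
  have "(\<lambda>_. 0) \<in> F" unfolding F_def by simp
  then have "F \<noteq> {}" by blast
  moreover have "\<bar>(\<integral>x. f x \<partial>\<rho>) - (\<integral>x. f x \<partial>\<rho>')\<bar> \<le> C" if "f \<in> F" for f
  proof (rule le)
    note f = that[unfolded F_def, THEN CollectD]
    show "f \<in> borel_measurable M" using f by (rule conjunct1)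
    show "\<bar>f x\<bar> \<le> 1" if "x \<in> space M" for x using f that by blast
    show "f x = f x'" if "x \<in> space M" "x' \<in> space M" "\<And>j. j \<in> J \<Longrightarrow> x j = x' j" for x x'
      using f[THEN conjunct2, THEN conjunct2, rule_format, OF that] .
  qed
  ultimately show ?thesis unfolding local_dist_def F_def[symmetric] by (rule cSUP_least)
qed

lemma block_eq:
  assumes "partition_on V \<K>" "K \<in> \<K>" "v \<in> K"
  shows "block \<K> v = K"
  unfolding block_def using assms by (intro the_equality) (auto dest: partition_onD2 disjointD)

lemma block_in:
  assumes "partition_on V \<K>" "v \<in> V"
  shows "block \<K> v \<in> \<K>" "v \<in> block \<K> v"
proof -
  obtain K where "K \<in> \<K>" "v \<in> K" using assms by (auto simp: partition_on_def)
  with block_eq[OF assms(1) this] show "block \<K> v \<in> \<K>" "v \<in> block \<K> v" by auto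
qed

lemma prod_partition:
  fixes f :: "'a set \<Rightarrow> 'a \<Rightarrow> 'b::comm_monoid_mult"
  assumes "finite V" "partition_on V \<K>"
  shows "(\<Prod>K\<in>\<K>. \<Prod>w\<in>K. f K w) = (\<Prod>w\<in>V. f (block \<K> w) w)"
proof -
  have "(\<Prod>K\<in>\<K>. \<Prod>w\<in>K. f K w) = (\<Prod>K\<in>\<K>. \<Prod>w\<in>K. f (block \<K> w) w)"
    using block_eq[OF assms(2)] by (intro prod.cong refl) simp
  also have "\<dots> = prod (\<lambda>w. f (block \<K> w) w) (\<Union>\<K>)"
    using assms partition_onD2[OF assms(2)]
    by (subst prod.Union_disjoint) (auto simp: partition_on_def disjoint_def intro: finite_subset[of _ V])
  finally show ?thesis using assms(2) by (simp add: partition_on_def)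
qed

locale filter_model = local_dynamics V N \<omega> \<epsilon> R \<Delta> \<psi> p
  for V :: "'v set" and N \<omega> \<epsilon> R \<Delta> and \<psi> :: "'v \<Rightarrow> 'a measure" and p +
  assumes \<psi>_sigma_finite: "\<And>i. sigma_finite_measure (\<psi> i)"
    and p_mass: "u \<in> V \<Longrightarrow> x \<in> space (PiM V \<psi>) \<Longrightarrow> (\<integral>\<^sup>+ z. ennreal (p u x z) \<partial>\<psi> u) = 1"
begin

sublocale \<Psi>: product_sigma_finite \<psi>
  by (rule product_sigma_finite.intro) (rule \<psi>_sigma_finite)

sublocale SS: sigma_finite_measure S
  by (rule \<Psi>.sigma_finite[OF finite_V])

text \<open>Zeros and singularities sit in \<open>L\<close>: point masses at time 0, observation
  densities later. \<open>h\<close> remains bounded above and away from 0 and is determined only up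
  to a constant factor.\<close>

definition represents :: "('v \<Rightarrow> 'a) measure \<Rightarrow> ('v \<Rightarrow> 'a measure) \<Rightarrow> (('v \<Rightarrow> 'a) \<Rightarrow> real) \<Rightarrow> bool" where
  "represents \<mu> L h \<longleftrightarrow> refs L \<and> pos_density S h \<and>
     \<mu> = density (PiM V L) (\<lambda>x. ennreal (h x / (\<integral>x. h x \<partial>PiM V L)))"

text \<open>The probability that one transition from \<open>x\<close> puts coordinate
  \<open>w\<close> into \<open>A w\<close>. Masses of rectangles are expressed through these
  numbers, and rectangles determine the predicted laws.\<close>

definition mass_in :: "('v \<Rightarrow> 'a set) \<Rightarrow> 'v \<Rightarrow> ('v \<Rightarrow> 'a) \<Rightarrow> ennreal" where
  "mass_in A w x = (\<integral>\<^sup>+z. ennreal (p w x z) * indicator (A w) z \<partial>\<psi> w)"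

lemma p_nonneg: "u \<in> V \<Longrightarrow> x \<in> space S \<Longrightarrow> z \<in> space (\<psi> u) \<Longrightarrow> 0 \<le> p u x z"
  using p_bounds \<epsilon> by force

lemma measurable_p_pair[measurable]:
  "w \<in> V \<Longrightarrow> (\<lambda>(x, z). ennreal (p w x z)) \<in> borel_measurable (S \<Otimes>\<^sub>M \<psi> w)"
  using measurable_compose[OF p_measurable measurable_ennreal] by (simp add: case_prod_unfold)

lemma measurable_mass_in:
  assumes "w \<in> V" "A w \<in> sets (\<psi> w)"
  shows "mass_in A w \<in> borel_measurable S"
proof -
  note assms[measurable]
  have "(\<lambda>(x, z). (\<lambda>(x, z). ennreal (p w x z)) (x, z) * indicator (A w) z) \<in> borel_measurable (S \<Otimes>\<^sub>M \<psi> w)"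
    by measurable
  then show ?thesis unfolding mass_in_def[abs_def]
    by (intro sigma_finite_measure.borel_measurable_nn_integral[OF \<psi>_sigma_finite]) simp
qed

lemma mass_in_space: "w \<in> V \<Longrightarrow> x \<in> space S \<Longrightarrow> A w = space (\<psi> w) \<Longrightarrow> mass_in A w x = 1"
  unfolding mass_in_def using p_mass[of w x]
  by (simp cong: nn_integral_cong)

text \<open>Each vertex may start from its own configuration \<open>\<xi> w\<close>. Blocked
  prediction needs this freedom, since every block there has its own copy of the previous
  configuration.\<close>

lemma trans_rectangle:
  assumes x: "\<And>w. w \<in> V \<Longrightarrow> \<xi> w \<in> space S" and A: "\<And>w. w \<in> V \<Longrightarrow> A w \<in> sets (\<psi> w)"
  shows "(\<integral>\<^sup>+z. (\<Prod>w\<in>V. ennreal (p w (\<xi> w) (z w))) * indicator (Pi\<^sub>E V A) z \<partial>S) = (\<Prod>w\<in>V. mass_in A w (\<xi> w))"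
proof -
  have "(\<integral>\<^sup>+z. (\<Prod>w\<in>V. ennreal (p w (\<xi> w) (z w))) * indicator (Pi\<^sub>E V A) z \<partial>S) =
      (\<integral>\<^sup>+z. (\<Prod>w\<in>V. ennreal (p w (\<xi> w) (z w)) * indicator (A w) (z w)) \<partial>S)"
  proof (rule nn_integral_cong)
    fix z assume "z \<in> space S"
    then have "indicator (Pi\<^sub>E V A) z = (\<Prod>i\<in>V. indicator (A i) (z i) :: ennreal)"
      using finite_V by (auto simp: space_PiM PiE_iff indicator_def prod_zero_iff)
    then show "(\<Prod>w\<in>V. ennreal (p w (\<xi> w) (z w))) * indicator (Pi\<^sub>E V A) z =
        (\<Prod>w\<in>V. ennreal (p w (\<xi> w) (z w)) * indicator (A w) (z w))"
      by (simp add: prod.distrib)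
  qed
  also have "\<dots> = (\<Prod>w\<in>V. mass_in A w (\<xi> w))"
    unfolding mass_in_def
  proof (rule \<Psi>.product_nn_integral_prod[OF finite_V])
    fix w assume w: "w \<in> V"
    have "(\<lambda>z. ennreal (p w (\<xi> w) z)) \<in> borel_measurable (\<psi> w)"
      using pos_density_measurable[OF pos_density_p_snd[OF w x[OF w]]] by simp
    with A[OF w] show "(\<lambda>z. ennreal (p w (\<xi> w) z) * indicator (A w) z) \<in> borel_measurable (\<psi> w)" by simp
  qed
  finally show ?thesis .
qed

lemma ennreal_joint_trans:
  "x \<in> space S \<Longrightarrow> z \<in> space S \<Longrightarrow> ennreal (joint_trans V p x z) = (\<Prod>w\<in>V. ennreal (p w x (z w)))"
  unfolding joint_trans_def using component_space p_nonneg by (intro prod_ennreal[symmetric]) auto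

lemma measurable_joint_trans: "(\<lambda>(x, z). ennreal (joint_trans V p x z)) \<in> borel_measurable (S \<Otimes>\<^sub>M S)"
proof -
  have "(\<lambda>y. ennreal (p w (fst y) (snd y w))) \<in> borel_measurable (S \<Otimes>\<^sub>M S)" if w: "w \<in> V" for w
  proof -
    have "(\<lambda>y. (fst y, snd y w)) \<in> S \<Otimes>\<^sub>M S \<rightarrow>\<^sub>M S \<Otimes>\<^sub>M \<psi> w" using w by measurable
    from measurable_compose[OF this measurable_p_pair[OF w]] show ?thesis by simp
  qed
  then have "(\<lambda>y. \<Prod>w\<in>V. ennreal (p w (fst y) (snd y w))) \<in> borel_measurable (S \<Otimes>\<^sub>M S)"
    by (rule borel_measurable_prod_ennreal)
  then show ?thesis
    by (subst measurable_cong[of _ _ "\<lambda>y. \<Prod>w\<in>V. ennreal (p w (fst y) (snd y w))"])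
       (auto simp: space_pair_measure ennreal_joint_trans)
qed

lemma measurable_joint_trans1: "x \<in> space S \<Longrightarrow> (\<lambda>z. ennreal (joint_trans V p x z)) \<in> borel_measurable S"
  using measurable_compose[OF measurable_Pair1' measurable_joint_trans] by simp

lemma measurable_kernel:
  "(\<lambda>x. density S (\<lambda>z. ennreal (joint_trans V p x z))) \<in> measurable S (subprob_algebra S)"
proof (rule measurable_subprob_algebra)
  fix x assume x: "x \<in> space S"
  have "emeasure (density S (\<lambda>z. ennreal (joint_trans V p x z))) (space S) =
      (\<integral>\<^sup>+z. (\<Prod>w\<in>V. ennreal (p w x (z w))) * indicator (Pi\<^sub>E V (\<lambda>w. space (\<psi> w))) z \<partial>S)"
    using ennreal_joint_trans[OF x]
    by (subst emeasure_density[OF measurable_joint_trans1[OF x] sets.top]) (auto simp: space_PiM intro!: nn_integral_cong)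
  also have "\<dots> = (\<Prod>w\<in>V. mass_in (\<lambda>w. space (\<psi> w)) w x)"
    using x by (intro trans_rectangle) auto
  also have "\<dots> = 1" using x by (intro prod.neutral) (auto intro: mass_in_space)
  finally show "subprob_space (density S (\<lambda>z. ennreal (joint_trans V p x z)))"
    using x by (intro prob_space_imp_subprob_space prob_spaceI) simp
next
  fix A assume A[measurable]: "A \<in> sets S"
  note measurable_joint_trans[measurable]
  have "(\<lambda>(x, z). (\<lambda>(x, z). ennreal (joint_trans V p x z)) (x, z) * indicator A z) \<in> borel_measurable (S \<Otimes>\<^sub>M S)"
    by measurable
  then have "(\<lambda>x. \<integral>\<^sup>+z. ennreal (joint_trans V p x z) * indicator A z \<partial>S) \<in> borel_measurable S"
    by (intro SS.borel_measurable_nn_integral) simp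
  then show "(\<lambda>x. emeasure (density S (\<lambda>z. ennreal (joint_trans V p x z))) A) \<in> borel_measurable S"
    by (subst measurable_cong[OF emeasure_density[OF measurable_joint_trans1 A]])
qed simp

lemma predict_rectangle:
  assumes \<mu>: "prob_space \<mu>" "sets \<mu> = sets S" and A: "\<And>w. w \<in> V \<Longrightarrow> A w \<in> sets (\<psi> w)"
  shows "emeasure (predict V \<psi> p \<mu>) (Pi\<^sub>E V A) = (\<integral>\<^sup>+x. (\<Prod>w\<in>V. mass_in A w x) \<partial>\<mu>)"
proof -
  interpret prob_space \<mu> by fact
  have R: "Pi\<^sub>E V A \<in> sets S" using finite_V A by (intro sets_PiM_I_finite) auto
  have "emeasure (predict V \<psi> p \<mu>) (Pi\<^sub>E V A) =
      (\<integral>\<^sup>+x. emeasure (density S (\<lambda>z. ennreal (joint_trans V p x z))) (Pi\<^sub>E V A) \<partial>\<mu>)"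
    unfolding predict_def
    using measurable_kernel measurable_cong_sets[OF \<mu>(2) refl] by (intro emeasure_bind[OF not_empty _ R]) auto
  also have "\<dots> = (\<integral>\<^sup>+x. (\<Prod>w\<in>V. mass_in A w x) \<partial>\<mu>)"
  proof (rule nn_integral_cong)
    fix x assume "x \<in> space \<mu>"
    then have x: "x \<in> space S" using sets_eq_imp_space_eq[OF \<mu>(2)] by simp
    have "emeasure (density S (\<lambda>z. ennreal (joint_trans V p x z))) (Pi\<^sub>E V A) =
        (\<integral>\<^sup>+z. (\<Prod>w\<in>V. ennreal (p w x (z w))) * indicator (Pi\<^sub>E V A) z \<partial>S)"
      using ennreal_joint_trans[OF x]
      by (subst emeasure_density[OF measurable_joint_trans1[OF x] R]) (auto intro!: nn_integral_cong)
    also have "\<dots> = (\<Prod>w\<in>V. mass_in A w x)" by (rule trans_rectangle[OF x A])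
    finally show "emeasure (density S (\<lambda>z. ennreal (joint_trans V p x z))) (Pi\<^sub>E V A) = (\<Prod>w\<in>V. mass_in A w x)" .
  qed
  finally show ?thesis .
qed

lemma sets_predict: "space \<mu> \<noteq> {} \<Longrightarrow> sets (predict V \<psi> p \<mu>) = sets S"
  unfolding predict_def by (subst sets_bind) auto

lemma representsD:
  assumes "represents \<mu> L h"
  shows "refs L" "pos_density S h" "pos_density (PiM V L) h" "0 < (\<integral>x. h x \<partial>PiM V L)"
    "\<mu> = density (PiM V L) (\<lambda>x. ennreal (h x / (\<integral>x. h x \<partial>PiM V L)))" "prob_space \<mu>" "sets \<mu> = sets S" "space \<mu> = space S"
proof -
  let ?Z = "\<integral>x. h x \<partial>PiM V L"
  show L: "refs L" and h: "pos_density S h" and \<mu>: "\<mu> = density (PiM V L) (\<lambda>x. ennreal (h x / ?Z))"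
    using assms unfolding represents_def by auto
  interpret finite_product_prob_space L V by (rule refs_finite_product_prob_space[OF L])
  show h': "pos_density P h" using h pos_density_sets_cong[OF refs_PiM_sets[OF L]] by blast
  show Z: "0 < ?Z" by (rule pos_density_integral_pos[OF h'])
  show s: "sets \<mu> = sets S" unfolding \<mu> using refs_PiM_sets[OF L] by simp
  show "space \<mu> = space S" by (rule sets_eq_imp_space_eq[OF s])
  have m: "(\<lambda>x. ennreal (h x / ?Z)) \<in> borel_measurable P"
    using pos_density_measurable[OF h'] by measurable
  have "(\<integral>\<^sup>+x. ennreal (h x / ?Z) \<partial>P) = ennreal (\<integral>x. h x / ?Z \<partial>P)"
    using pos_density_integrable[OF h'] pos_density_pos[OF h'] Z
    by (intro nn_integral_eq_integral) (auto intro!: AE_I2 divide_nonneg_pos less_imp_le)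
  also have "\<dots> = 1" using Z by simp
  finally have "(\<integral>\<^sup>+x. ennreal (h x / ?Z) \<partial>P) = 1" .
  then show "prob_space \<mu>"
    unfolding \<mu> by (intro prob_spaceI) (simp add: emeasure_density[OF m] cong: nn_integral_cong)
qed

lemma nn_integral_represents:
  assumes r: "represents \<mu> L h" and F: "F \<in> borel_measurable S" "\<And>x. x \<in> space S \<Longrightarrow> 0 \<le> F x"
    and B: "\<And>x. x \<in> space S \<Longrightarrow> F x \<le> B"
  shows "(\<integral>\<^sup>+x. ennreal (F x) \<partial>\<mu>) = ennreal (wavg (PiM V L) h F)"
proof -
  note D = representsD[OF r]
  let ?Z = "\<integral>x. h x \<partial>PiM V L"
  interpret finite_product_prob_space L V by (rule refs_finite_product_prob_space[OF D(1)])
  have F'[measurable]: "F \<in> borel_measurable P" using F(1) measurable_cong_sets[OF refs_PiM_sets[OF D(1)] refl] by blast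
  have hm[measurable]: "h \<in> borel_measurable P" by (rule pos_density_measurable[OF D(3)])
  have sp: "space P = space S" by (rule refs_PiM_space[OF D(1)])
  have int: "integrable P (\<lambda>x. F x * h x)"
    using F(2) B sp by (intro pos_density_integrable_mult[OF D(3) F', of B]) auto
  have "(\<integral>\<^sup>+x. ennreal (F x) \<partial>\<mu>) = (\<integral>\<^sup>+x. ennreal (h x / ?Z) * ennreal (F x) \<partial>P)"
    unfolding D(5) by (rule nn_integral_density) measurable
  also have "\<dots> = (\<integral>\<^sup>+x. ennreal (F x * h x / ?Z) \<partial>P)"
    using F(2) sp D(4) pos_density_pos[OF D(3)]
    by (intro nn_integral_cong) (auto simp: ennreal_mult'[symmetric] mult_ac)
  also have "\<dots> = ennreal (\<integral>x. F x * h x / ?Z \<partial>P)"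
    using int F(2) sp D(4) pos_density_pos[OF D(3)]
    by (intro nn_integral_eq_integral) (auto intro!: AE_I2 divide_nonneg_pos mult_nonneg_nonneg intro: less_imp_le)
  also have "\<dots> = ennreal (wavg P h F)" by (simp add: wavg_def)
  finally show ?thesis .
qed

lemma nn_integral_block:
  assumes r: "represents \<mu> L h" and K: "K \<subseteq> V" and z: "z \<in> space S"
  shows "(\<integral>\<^sup>+x. (\<Prod>w\<in>K. ennreal (p w x (z w))) \<partial>\<mu>) = ennreal (block_density L h K z / (\<integral>x. h x \<partial>PiM V L))"
proof -
  note D = representsD[OF r]
  have zw: "z w \<in> space (\<psi> w)" if "w \<in> K" for w using component_space[OF z] K that by blast
  have fK: "finite K" using K finite_V finite_subset by blast
  have pd: "pos_density S (\<lambda>x. \<Prod>w\<in>K. p w x (z w))"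
    using K zw by (intro pos_density_prod fK pos_density_p_fst) auto
  obtain l u where u: "0 < l" "0 < u" "\<And>x. x \<in> space S \<Longrightarrow> l \<le> (\<Prod>w\<in>K. p w x (z w))" "\<And>x. x \<in> space S \<Longrightarrow> (\<Prod>w\<in>K. p w x (z w)) \<le> u"
    using pos_densityE[OF pd] by blast
  have "(\<integral>\<^sup>+x. (\<Prod>w\<in>K. ennreal (p w x (z w))) \<partial>\<mu>) = (\<integral>\<^sup>+x. ennreal (\<Prod>w\<in>K. p w x (z w)) \<partial>\<mu>)"
    using D(8) K zw p_nonneg by (intro nn_integral_cong prod_ennreal) auto
  also have "\<dots> = ennreal (wavg (PiM V L) h (\<lambda>x. \<Prod>w\<in>K. p w x (z w)))"
    using pos_density_measurable[OF pd] u(4) less_imp_le[OF pos_density_pos[OF pd]]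
    by (intro nn_integral_represents[OF r, of _ u]) auto
  also have "wavg (PiM V L) h (\<lambda>x. \<Prod>w\<in>K. p w x (z w)) = block_density L h K z / (\<integral>x. h x \<partial>PiM V L)"
    by (simp add: wavg_def block_density_def)
  finally show ?thesis .
qed

text \<open>A product of integrals over blocks is one integral over independent copies of the previous
  configuration, one copy per block.\<close>

lemma blocked_rectangle:
  assumes r: "represents \<mu> L h" and \<K>: "partition_on V \<K>" and A: "\<And>w. w \<in> V \<Longrightarrow> A w \<in> sets (\<psi> w)"
  shows "(\<integral>\<^sup>+z. (\<Prod>K\<in>\<K>. ennreal (block_density L h K z / (\<integral>x. h x \<partial>PiM V L))) * indicator (Pi\<^sub>E V A) z \<partial>S) =
    (\<Prod>K\<in>\<K>. \<integral>\<^sup>+x. (\<Prod>w\<in>K. mass_in A w x) \<partial>\<mu>)"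
proof -
  note D = representsD[OF r]
  interpret \<mu>: prob_space \<mu> by (rule D)
  interpret Q: product_sigma_finite "\<lambda>_::'v set. \<mu>" by unfold_locales
  have sub: "K \<subseteq> V" if "K \<in> \<K>" for K using \<K> that by (auto simp: partition_on_def)
  have fin: "finite \<K>" using finite_V \<K> finite_elements by blast
  let ?Q = "PiM \<K> (\<lambda>_. \<mu>)"
  interpret QQ: sigma_finite_measure ?Q by (rule Q.sigma_finite[OF fin])
  interpret SQ: pair_sigma_finite ?Q S by unfold_locales
  have R[measurable]: "Pi\<^sub>E V A \<in> sets S" using finite_V A by (intro sets_PiM_I_finite) auto
  have pm: "(\<lambda>x. ennreal (p w x a)) \<in> borel_measurable \<mu>" if "w \<in> V" "a \<in> space (\<psi> w)" for w a
  proof -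
    have "(\<lambda>x. ennreal (p w x a)) \<in> borel_measurable S"
      using pos_density_measurable[OF pos_density_p_fst[OF that]] by simp
    then show ?thesis using measurable_cong_sets[OF D(7) refl] by blast
  qed
  have mm: "mass_in A w \<in> borel_measurable \<mu>" if "w \<in> V" for w
    using measurable_mass_in[of w A, OF that A[OF that]] measurable_cong_sets[OF D(7) refl] by blast
  have \<omega>: "\<omega> (block \<K> w) \<in> space S" if "\<omega> \<in> space ?Q" "w \<in> V" for \<omega> w
    using that block_in[OF \<K> that(2)] D(8) by (auto simp: space_PiM)
  have meas: "(\<lambda>(\<omega>, z). (\<Prod>w\<in>V. ennreal (p w (\<omega> (block \<K> w)) (z w))) * indicator (Pi\<^sub>E V A) z)
      \<in> borel_measurable (?Q \<Otimes>\<^sub>M S)"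
  proof -
    have "(\<lambda>y. ennreal (p w (fst y (block \<K> w)) (snd y w))) \<in> borel_measurable (?Q \<Otimes>\<^sub>M S)" if w: "w \<in> V" for w
    proof -
      have b: "block \<K> w \<in> \<K>" by (rule block_in[OF \<K> w])
      have "(\<lambda>y. (fst y (block \<K> w), snd y w)) \<in> ?Q \<Otimes>\<^sub>M S \<rightarrow>\<^sub>M \<mu> \<Otimes>\<^sub>M \<psi> w" using w b by measurable
      then have "(\<lambda>y. (fst y (block \<K> w), snd y w)) \<in> ?Q \<Otimes>\<^sub>M S \<rightarrow>\<^sub>M S \<Otimes>\<^sub>M \<psi> w"
        using measurable_cong_sets[OF refl sets_pair_measure_cong[OF D(7) refl]] by blast
      from measurable_compose[OF this measurable_p_pair[OF w]] show ?thesis by simp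
    qed
    then have "(\<lambda>y. (\<Prod>w\<in>V. ennreal (p w (fst y (block \<K> w)) (snd y w))) * indicator (Pi\<^sub>E V A) (snd y))
        \<in> borel_measurable (?Q \<Otimes>\<^sub>M S)"
      by (intro borel_measurable_times_ennreal borel_measurable_prod_ennreal) auto
    then show ?thesis by (simp add: case_prod_unfold)
  qed
  have "(\<integral>\<^sup>+z. (\<Prod>K\<in>\<K>. ennreal (block_density L h K z / (\<integral>x. h x \<partial>PiM V L))) * indicator (Pi\<^sub>E V A) z \<partial>S) =
      (\<integral>\<^sup>+z. \<integral>\<^sup>+\<omega>. (\<Prod>w\<in>V. ennreal (p w (\<omega> (block \<K> w)) (z w))) * indicator (Pi\<^sub>E V A) z \<partial>?Q \<partial>S)"
  proof (rule nn_integral_cong)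
    fix z assume z: "z \<in> space S"
    have m: "(\<lambda>x. \<Prod>w\<in>K. ennreal (p w x (z w))) \<in> borel_measurable \<mu>" if "K \<in> \<K>" for K
      using sub[OF that] component_space[OF z] by (intro borel_measurable_prod_ennreal pm) auto
    have "(\<Prod>K\<in>\<K>. ennreal (block_density L h K z / (\<integral>x. h x \<partial>PiM V L))) =
        (\<Prod>K\<in>\<K>. \<integral>\<^sup>+x. (\<Prod>w\<in>K. ennreal (p w x (z w))) \<partial>\<mu>)"
      using nn_integral_block[OF r sub z] by (intro prod.cong) auto
    also have "\<dots> = (\<integral>\<^sup>+\<omega>. (\<Prod>K\<in>\<K>. \<Prod>w\<in>K. ennreal (p w (\<omega> K) (z w))) \<partial>?Q)"
      using m by (intro Q.product_nn_integral_prod[OF fin, symmetric])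
    also have "\<dots> = (\<integral>\<^sup>+\<omega>. (\<Prod>w\<in>V. ennreal (p w (\<omega> (block \<K> w)) (z w))) \<partial>?Q)"
      by (subst prod_partition[OF finite_V \<K>]) (rule refl)
    finally have eq: "(\<Prod>K\<in>\<K>. ennreal (block_density L h K z / (\<integral>x. h x \<partial>PiM V L))) =
        (\<integral>\<^sup>+\<omega>. (\<Prod>w\<in>V. ennreal (p w (\<omega> (block \<K> w)) (z w))) \<partial>?Q)" .
    have "(\<lambda>\<omega>. \<Prod>w\<in>V. ennreal (p w (\<omega> (block \<K> w)) (z w))) \<in> borel_measurable ?Q"
    proof (rule borel_measurable_prod_ennreal)
      fix w assume w: "w \<in> V"
      have "(\<lambda>\<omega>. \<omega> (block \<K> w)) \<in> measurable ?Q \<mu>"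
        by (rule measurable_component_singleton[OF block_in(1)[OF \<K> w]])
      from measurable_compose[OF this pm[OF w component_space[OF z w]]]
      show "(\<lambda>\<omega>. ennreal (p w (\<omega> (block \<K> w)) (z w))) \<in> borel_measurable ?Q" .
    qed
    then show "(\<Prod>K\<in>\<K>. ennreal (block_density L h K z / (\<integral>x. h x \<partial>PiM V L))) * indicator (Pi\<^sub>E V A) z =
        (\<integral>\<^sup>+\<omega>. (\<Prod>w\<in>V. ennreal (p w (\<omega> (block \<K> w)) (z w))) * indicator (Pi\<^sub>E V A) z \<partial>?Q)"
      unfolding eq by (rule nn_integral_multc[symmetric])
  qed
  also have "\<dots> = (\<integral>\<^sup>+\<omega>. \<integral>\<^sup>+z. (\<Prod>w\<in>V. ennreal (p w (\<omega> (block \<K> w)) (z w))) * indicator (Pi\<^sub>E V A) z \<partial>S \<partial>?Q)"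
    by (rule SQ.Fubini'[OF meas])
  also have "\<dots> = (\<integral>\<^sup>+\<omega>. (\<Prod>w\<in>V. mass_in A w (\<omega> (block \<K> w))) \<partial>?Q)"
    by (intro nn_integral_cong trans_rectangle \<omega> A)
  also have "\<dots> = (\<integral>\<^sup>+\<omega>. (\<Prod>K\<in>\<K>. \<Prod>w\<in>K. mass_in A w (\<omega> K)) \<partial>?Q)"
    by (subst prod_partition[OF finite_V \<K>]) (rule refl)
  also have "\<dots> = (\<Prod>K\<in>\<K>. \<integral>\<^sup>+x. (\<Prod>w\<in>K. mass_in A w x) \<partial>\<mu>)"
    using mm sub by (intro Q.product_nn_integral_prod[OF fin] borel_measurable_prod_ennreal) auto
  finally show ?thesis .
qed

lemma prod_block_density:
  assumes r: "represents \<mu> L h" and \<K>: "partition_on V \<K>" and z: "z \<in> space S"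
  shows "(\<Prod>K\<in>\<K>. ennreal (block_density L h K z / (\<integral>x. h x \<partial>PiM V L))) =
    ennreal (next_density L h \<K> z / (\<integral>x. h x \<partial>PiM V L) ^ card \<K>)"
proof -
  note D = representsD[OF r]
  have "0 \<le> block_density L h K z / (\<integral>x. h x \<partial>PiM V L)" if "K \<in> \<K>" for K
  proof -
    have "K \<subseteq> V" using \<K> that by (auto simp: partition_on_def)
    then show ?thesis using D(4) pos_density_pos[OF pos_density_block_density[OF D(1,2)] z] by (intro divide_nonneg_pos less_imp_le)
  qed
  then show ?thesis by (simp add: prod_ennreal next_density_def prod_dividef)
qed

text \<open>A common criterion for both predictions: a measure whose mass of a rectangle factorises
  over the blocks into these integrals has the product of the block densities as its density. The
  exact prediction is the case of one block.\<close>

lemma eq_density_by_rectangles: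
  assumes r: "represents \<mu> L h" and \<K>: "partition_on V \<K>" and \<nu>: "sets \<nu> = sets S" "finite_measure \<nu>"
    and eq: "\<And>A. (\<And>w. w \<in> V \<Longrightarrow> A w \<in> sets (\<psi> w)) \<Longrightarrow>
      emeasure \<nu> (Pi\<^sub>E V A) = (\<Prod>K\<in>\<K>. \<integral>\<^sup>+x. (\<Prod>w\<in>K. mass_in A w x) \<partial>\<mu>)"
  shows "\<nu> = density S (\<lambda>z. ennreal (next_density L h \<K> z / (\<integral>x. h x \<partial>PiM V L) ^ card \<K>))"
proof (rule measure_eqI_PiM_finite[OF finite_V])
  note D = representsD[OF r]
  let ?k = "\<lambda>z. ennreal (next_density L h \<K> z / (\<integral>x. h x \<partial>PiM V L) ^ card \<K>)"
  have fin: "finite \<K>" using finite_V \<K> finite_elements by blast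
  have un: "\<Union>\<K> \<subseteq> V" using \<K> by (auto simp: partition_on_def)
  have m: "?k \<in> borel_measurable S"
    using pos_density_measurable[OF pos_density_next_density[OF D(1,2) fin un]] by measurable
  show "sets \<nu> = sets S" by (rule \<nu>)
  show "sets (density S ?k) = sets S" by simp
  fix A assume A: "\<And>i. i \<in> V \<Longrightarrow> A i \<in> sets (\<psi> i)"
  have R: "Pi\<^sub>E V A \<in> sets S" using finite_V A by (intro sets_PiM_I_finite) auto
  have "emeasure (density S ?k) (Pi\<^sub>E V A) =
      (\<integral>\<^sup>+z. (\<Prod>K\<in>\<K>. ennreal (block_density L h K z / (\<integral>x. h x \<partial>PiM V L))) * indicator (Pi\<^sub>E V A) z \<partial>S)"
    unfolding emeasure_density[OF m R] using prod_block_density[OF r \<K>] by (intro nn_integral_cong) simp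
  also have "\<dots> = (\<Prod>K\<in>\<K>. \<integral>\<^sup>+x. (\<Prod>w\<in>K. mass_in A w x) \<partial>\<mu>)"
    by (rule blocked_rectangle[OF r \<K> A])
  also have "\<dots> = emeasure \<nu> (Pi\<^sub>E V A)" by (rule eq[OF A, symmetric])
  finally show "emeasure \<nu> (Pi\<^sub>E V A) = emeasure (density S ?k) (Pi\<^sub>E V A)" ..
next
  show "range (\<lambda>_::nat. space S) \<subseteq> prod_algebra V \<psi>" using space_in_prod_algebra[of V \<psi>] by (auto simp: space_PiM)
  show "(\<Union>i::nat. space S) = space S" by simp
  show "emeasure \<nu> (space S) \<noteq> \<infinity>" using finite_measure.emeasure_finite[OF \<nu>(2)] by simp
qed

text \<open>Unrestricted coordinates contribute transition mass 1, so rectangles that are full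
  outside \<open>K\<close> describe the marginal of the predicted law on \<open>K\<close>.\<close>

lemma predict_full_rectangle:
  assumes r: "represents \<mu> L h" and A: "\<And>w. w \<in> V \<Longrightarrow> A w \<in> sets (\<psi> w)" and K: "K \<subseteq> V"
    and full: "\<And>w. w \<in> V - K \<Longrightarrow> A w = space (\<psi> w)"
  shows "emeasure (predict V \<psi> p \<mu>) (Pi\<^sub>E V A) = (\<integral>\<^sup>+x. (\<Prod>w\<in>K. mass_in A w x) \<partial>\<mu>)"
proof (subst predict_rectangle[OF representsD(6,7)[OF r]], erule A, rule nn_integral_cong)
  fix x assume "x \<in> space \<mu>"
  then have x: "x \<in> space S" using representsD(8)[OF r] by simp
  show "(\<Prod>w\<in>V. mass_in A w x) = (\<Prod>w\<in>K. mass_in A w x)"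
    using finite_V K full mass_in_space[OF _ x] by (intro prod.mono_neutral_right) auto
qed

lemma prob_space_predict:
  assumes r: "represents \<mu> L h"
  shows "prob_space (predict V \<psi> p \<mu>)" "sets (predict V \<psi> p \<mu>) = sets S" "space (predict V \<psi> p \<mu>) = space S"
proof -
  note D = representsD[OF r]
  interpret prob_space \<mu> by (rule D)
  show s: "sets (predict V \<psi> p \<mu>) = sets S" by (rule sets_predict[OF not_empty])
  then show sp: "space (predict V \<psi> p \<mu>) = space S" by (rule sets_eq_imp_space_eq)
  have "emeasure (predict V \<psi> p \<mu>) (Pi\<^sub>E V (\<lambda>w. space (\<psi> w))) = 1"
    using predict_full_rectangle[OF r, of "\<lambda>w. space (\<psi> w)" "{}"] emeasure_space_1 by simp
  then show "prob_space (predict V \<psi> p \<mu>)" by (intro prob_spaceI) (simp add: sp space_PiM)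
qed

lemma predict_eq:
  assumes r: "represents \<mu> L h" and V: "V \<noteq> {}"
  shows "predict V \<psi> p \<mu> = density S (\<lambda>z. ennreal (next_density L h {V} z / (\<integral>x. h x \<partial>PiM V L) ^ card {V}))"
proof (rule eq_density_by_rectangles[OF r partition_on_space[OF V]])
  show "finite_measure (predict V \<psi> p \<mu>)"
    using prob_space_predict(1)[OF r] by (rule prob_space.finite_measure)
  fix A assume "\<And>w. w \<in> V \<Longrightarrow> A w \<in> sets (\<psi> w)"
  then show "emeasure (predict V \<psi> p \<mu>) (Pi\<^sub>E V A) = (\<Prod>K\<in>{V}. \<integral>\<^sup>+x. (\<Prod>w\<in>K. mass_in A w x) \<partial>\<mu>)"
    using predict_full_rectangle[OF r, of A V] by simp
qed (rule prob_space_predict(2)[OF r])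

text \<open>The gluing map pulls a rectangle back to the product of its restrictions to the blocks.
  A block marginal gives such a restriction the predicted mass of the rectangle that is full outside
  the block.\<close>

lemma blocking_predict_eq:
  assumes r: "represents \<mu> L h" and \<K>: "partition_on V \<K>"
  shows "blocking V \<psi> \<K> (predict V \<psi> p \<mu>) =
    density S (\<lambda>z. ennreal (next_density L h \<K> z / (\<integral>x. h x \<partial>PiM V L) ^ card \<K>))"
proof -
  let ?\<rho> = "predict V \<psi> p \<mu>"
  note \<rho> = prob_space_predict[OF r]
  interpret \<rho>: prob_space ?\<rho> by (rule \<rho>)
  have sub: "K \<subseteq> V" if "K \<in> \<K>" for K using \<K> that by (auto simp: partition_on_def)
  have fin: "finite \<K>" using finite_V \<K> finite_elements by blast
  have finK: "finite K" if "K \<in> \<K>" for K using sub[OF that] finite_V finite_subset by blast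
  have res: "(\<lambda>x. restrict x K) \<in> measurable ?\<rho> (PiM K \<psi>)" if "K \<in> \<K>" for K
    using measurable_restrict_subset[OF sub[OF that], of \<psi>] measurable_cong_sets[OF \<rho>(2) refl] by blast
  \<comment> \<open>The family of marginals is extended by \<open>\<mu>\<close> to sets that are not
    blocks, which makes it a family of probability measures at every index.\<close>
  define m where "m K = (if K \<in> \<K> then marginal \<psi> K ?\<rho> else \<mu>)" for K
  have pm: "prob_space (m K)" for K
    using \<rho>.prob_space_distr[OF res] representsD(6)[OF r] by (auto simp: m_def marginal_def)
  interpret m: product_sigma_finite m
    by (rule product_sigma_finite.intro) (intro prob_space_imp_sigma_finite pm)
  have PiM_m: "PiM \<K> (\<lambda>K. marginal \<psi> K ?\<rho>) = PiM \<K> m"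
    by (rule PiM_cong) (auto simp: m_def)
  have sm: "sets (m K) = sets (PiM K \<psi>)" if "K \<in> \<K>" for K using that by (simp add: m_def marginal_def)
  have spm: "space (m K) = (\<Pi>\<^sub>E w\<in>K. space (\<psi> w))" if "K \<in> \<K>" for K
    using sets_eq_imp_space_eq[OF sm[OF that]] by (simp add: space_PiM)
  define G where "G = (\<lambda>\<omega>::'v set \<Rightarrow> 'v \<Rightarrow> 'a. \<lambda>v\<in>V. \<omega> (block \<K> v) v)"
  have G: "G \<in> measurable (PiM \<K> m) S"
    unfolding G_def
  proof (rule measurable_restrict)
    fix v assume v: "v \<in> V"
    note b = block_in[OF \<K> v]
    have "(\<lambda>\<omega>. \<omega> (block \<K> v)) \<in> measurable (PiM \<K> m) (m (block \<K> v))"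
      by (rule measurable_component_singleton[OF b(1)])
    then have "(\<lambda>\<omega>. \<omega> (block \<K> v)) \<in> measurable (PiM \<K> m) (PiM (block \<K> v) \<psi>)"
      using measurable_cong_sets[OF refl sm[OF b(1)]] by blast
    from measurable_compose[OF this measurable_component_singleton[OF b(2)]]
    show "(\<lambda>\<omega>. \<omega> (block \<K> v) v) \<in> measurable (PiM \<K> m) (\<psi> v)" .
  qed
  have bl: "blocking V \<psi> \<K> ?\<rho> = distr (PiM \<K> m) S G"
    unfolding blocking_def PiM_m G_def ..
  interpret Pm: prob_space "PiM \<K> m" by (rule prob_space_PiM) (rule pm)
  show ?thesis
  proof (rule eq_density_by_rectangles[OF r \<K>])
    show "sets (blocking V \<psi> \<K> ?\<rho>) = sets S" unfolding bl by simp
    show "finite_measure (blocking V \<psi> \<K> ?\<rho>)"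
      unfolding bl by (rule prob_space.finite_measure[OF Pm.prob_space_distr[OF G]])
    fix A assume A: "\<And>w. w \<in> V \<Longrightarrow> A w \<in> sets (\<psi> w)"
    have As: "A w \<subseteq> space (\<psi> w)" if "w \<in> V" for w by (rule sets.sets_into_space[OF A[OF that]])
    have R: "Pi\<^sub>E V A \<in> sets S" using finite_V A by (intro sets_PiM_I_finite) auto
    have RK: "Pi\<^sub>E K A \<in> sets (PiM K \<psi>)" if "K \<in> \<K>" for K
      using finK[OF that] A sub[OF that] by (intro sets_PiM_I_finite) auto
    have pre: "G -` Pi\<^sub>E V A \<inter> space (PiM \<K> m) = Pi\<^sub>E \<K> (\<lambda>K. Pi\<^sub>E K A)"
    proof (intro set_eqI iffI)
      fix \<omega> assume w: "\<omega> \<in> G -` Pi\<^sub>E V A \<inter> space (PiM \<K> m)"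
      show "\<omega> \<in> Pi\<^sub>E \<K> (\<lambda>K. Pi\<^sub>E K A)"
      proof (rule PiE_I)
        fix K assume K: "K \<in> \<K>"
        have sp: "\<omega> K \<in> (\<Pi>\<^sub>E w\<in>K. space (\<psi> w))" using w K spm[OF K] by (auto simp: space_PiM)
        show "\<omega> K \<in> Pi\<^sub>E K A"
        proof (rule PiE_I)
          fix u assume u: "u \<in> K"
          then have uV: "u \<in> V" using sub[OF K] by blast
          have "G \<omega> u \<in> A u" using w uV by auto
          then show "\<omega> K u \<in> A u" unfolding G_def using uV block_eq[OF \<K> K u] by simp
        next
          fix u assume "u \<notin> K" then show "\<omega> K u = undefined" using sp by (auto simp: PiE_iff extensional_def)
        qed
      next
        fix K assume "K \<notin> \<K>" then show "\<omega> K = undefined" using w by (auto simp: space_PiM PiE_iff extensional_def)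
      qed
    next
      fix \<omega> assume w: "\<omega> \<in> Pi\<^sub>E \<K> (\<lambda>K. Pi\<^sub>E K A)"
      have "\<omega> K \<in> space (m K)" if K: "K \<in> \<K>" for K
      proof -
        have "\<omega> K \<in> Pi\<^sub>E K A" using w K by blast
        moreover have "Pi\<^sub>E K A \<subseteq> (\<Pi>\<^sub>E w\<in>K. space (\<psi> w))"
          using As sub[OF K] by (intro PiE_mono) auto
        ultimately show ?thesis unfolding spm[OF K] by blast
      qed
      then have "\<omega> \<in> space (PiM \<K> m)" using w by (auto simp: space_PiM PiE_iff)
      moreover have "G \<omega> \<in> Pi\<^sub>E V A"
        unfolding G_def using w block_in[OF \<K>] by (auto simp: PiE_iff)
      ultimately show "\<omega> \<in> G -` Pi\<^sub>E V A \<inter> space (PiM \<K> m)" by simp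
    qed
    have "emeasure (blocking V \<psi> \<K> ?\<rho>) (Pi\<^sub>E V A) = emeasure (PiM \<K> m) (Pi\<^sub>E \<K> (\<lambda>K. Pi\<^sub>E K A))"
      unfolding bl by (simp add: emeasure_distr[OF G R] pre)
    also have "\<dots> = (\<Prod>K\<in>\<K>. emeasure (m K) (Pi\<^sub>E K A))"
      by (rule m.emeasure_PiM[OF fin]) (simp only: sm RK)
    also have "\<dots> = (\<Prod>K\<in>\<K>. \<integral>\<^sup>+x. (\<Prod>w\<in>K. mass_in A w x) \<partial>\<mu>)"
    proof (intro prod.cong refl)
      fix K assume K: "K \<in> \<K>"
      let ?A = "\<lambda>w. if w \<in> K then A w else space (\<psi> w)"
      have "(\<lambda>x. restrict x K) -` Pi\<^sub>E K A \<inter> space ?\<rho> = Pi\<^sub>E V ?A"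
      proof -
        have "x \<in> Pi\<^sub>E V ?A" if x: "restrict x K \<in> Pi\<^sub>E K A" "x \<in> (\<Pi>\<^sub>E w\<in>V. space (\<psi> w))" for x
        proof (rule PiE_I)
          fix w assume w: "w \<in> V"
          have "x w \<in> A w" if "w \<in> K" using PiE_mem[OF x(1) that] that by simp
          then show "x w \<in> ?A w" using PiE_mem[OF x(2) w] by simp
        qed (rule PiE_arb[OF x(2)])
        moreover have "restrict x K \<in> Pi\<^sub>E K A" if x: "x \<in> Pi\<^sub>E V ?A" for x
        proof (rule PiE_I)
          fix w assume w: "w \<in> K"
          then have "w \<in> V" using sub[OF K] by blast
          from PiE_mem[OF x this] show "restrict x K w \<in> A w" using w by simp
        qed simp
        moreover have "Pi\<^sub>E V ?A \<subseteq> (\<Pi>\<^sub>E w\<in>V. space (\<psi> w))" using As by (intro PiE_mono) auto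
        ultimately show ?thesis
          unfolding \<rho>(3) space_PiM by (intro equalityI subsetI IntI vimageI2) (auto dest: subsetD)
      qed
      then have "emeasure (m K) (Pi\<^sub>E K A) = emeasure ?\<rho> (Pi\<^sub>E V ?A)"
        using K by (simp add: m_def marginal_def emeasure_distr[OF res[OF K] RK[OF K]])
      also have "\<dots> = (\<integral>\<^sup>+x. (\<Prod>w\<in>K. mass_in ?A w x) \<partial>\<mu>)"
        using A by (intro predict_full_rectangle[OF r _ sub[OF K]]) auto
      also have "\<dots> = (\<integral>\<^sup>+x. (\<Prod>w\<in>K. mass_in A w x) \<partial>\<mu>)"
        by (intro nn_integral_cong prod.cong refl) (simp add: mass_in_def)
      finally show "emeasure (m K) (Pi\<^sub>E K A) = (\<integral>\<^sup>+x. (\<Prod>w\<in>K. mass_in A w x) \<partial>\<mu>)" .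
    qed
    finally show "emeasure (blocking V \<psi> \<K> ?\<rho>) (Pi\<^sub>E V A) = (\<Prod>K\<in>\<K>. \<integral>\<^sup>+x. (\<Prod>w\<in>K. mass_in A w x) \<partial>\<mu>)" .
  qed
qed

section \<open>Observations absorbed into the reference measure\<close>

definition obs_mass :: "('v \<Rightarrow> 'a \<Rightarrow> 'c \<Rightarrow> real) \<Rightarrow> ('v \<Rightarrow> 'c) \<Rightarrow> 'v \<Rightarrow> ennreal" where
  "obs_mass g y w = (\<integral>\<^sup>+x. ennreal (g w x (y w)) \<partial>\<psi> w)"

text \<open>With this reference, correction leaves the density function alone: a density over
  \<open>\<psi>\<close> becomes the same function, up to normalisation, over the product of these
  measures. Outside \<open>V\<close> a point mass is the default.\<close>

definition obs_ref :: "('v \<Rightarrow> 'a \<Rightarrow> 'c \<Rightarrow> real) \<Rightarrow> ('v \<Rightarrow> 'c) \<Rightarrow> 'v \<Rightarrow> 'a measure" where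
  "obs_ref g y w = (if w \<in> V then density (\<psi> w) (\<lambda>x. ennreal (g w x (y w)) / obs_mass g y w)
    else return (count_space UNIV) undefined)"

definition obs_ok :: "('v \<Rightarrow> 'a \<Rightarrow> 'c \<Rightarrow> real) \<Rightarrow> ('v \<Rightarrow> 'c) \<Rightarrow> bool" where
  "obs_ok g y \<longleftrightarrow> (\<forall>w\<in>V. (\<lambda>x. g w x (y w)) \<in> borel_measurable (\<psi> w) \<and> (\<forall>x\<in>space (\<psi> w). 0 \<le> g w x (y w)))"

lemma obs_okD:
  assumes "obs_ok g y" "w \<in> V"
  shows "(\<lambda>x. g w x (y w)) \<in> borel_measurable (\<psi> w)" "x \<in> space (\<psi> w) \<Longrightarrow> 0 \<le> g w x (y w)"
  using assms unfolding obs_ok_def by auto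

lemma measurable_obs_component:
  assumes "obs_ok g y" "w \<in> V"
  shows "(\<lambda>z. g w (z w) (y w)) \<in> borel_measurable S"
  using measurable_compose[OF measurable_component_singleton[of w V \<psi>, OF assms(2)] obs_okD(1)[OF assms]] .

lemma measurable_joint_obs: "obs_ok g y \<Longrightarrow> (\<lambda>z. joint_obs V g z y) \<in> borel_measurable S"
  unfolding joint_obs_def by (intro borel_measurable_prod measurable_obs_component)

lemma joint_obs_nonneg: "obs_ok g y \<Longrightarrow> z \<in> space S \<Longrightarrow> 0 \<le> joint_obs V g z y"
  unfolding joint_obs_def using obs_okD(2) component_space by (intro prod_nonneg) blast

lemma nn_integral_joint_obs:
  assumes "obs_ok g y"
  shows "(\<integral>\<^sup>+z. ennreal (joint_obs V g z y) \<partial>S) = (\<Prod>w\<in>V. obs_mass g y w)"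
proof -
  have "(\<integral>\<^sup>+z. ennreal (joint_obs V g z y) \<partial>S) = (\<integral>\<^sup>+z. (\<Prod>w\<in>V. ennreal (g w (z w) (y w))) \<partial>S)"
    unfolding joint_obs_def using obs_okD(2)[OF assms] component_space
    by (intro nn_integral_cong prod_ennreal[symmetric]) blast
  also have "\<dots> = (\<Prod>w\<in>V. obs_mass g y w)"
    unfolding obs_mass_def using obs_okD(1)[OF assms] by (intro \<Psi>.product_nn_integral_prod finite_V) auto
  finally show ?thesis .
qed

lemma likelihood_density:
  assumes "obs_ok g y" "pos_density S k"
  shows "likelihood V g y (density S (\<lambda>z. ennreal (k z))) = (\<integral>\<^sup>+z. ennreal (k z) * ennreal (joint_obs V g z y) \<partial>S)"
  unfolding likelihood_def using measurable_joint_obs[OF assms(1)] pos_density_measurable[OF assms(2)]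
  by (intro nn_integral_density) auto

text \<open>As \<open>k\<close> is bounded above and below, the likelihood lies between constant
  multiples of the product of the masses. A nonzero product forces nonzero factors, and a finite
  product of nonzero factors forces finite ones.\<close>

lemma obs_mass_finite:
  assumes ok: "obs_ok g y" and k: "pos_density S k"
    and lik: "likelihood V g y (density S (\<lambda>z. ennreal (k z))) \<in> {0<..<\<infinity>}" and w: "w \<in> V"
  shows "0 < obs_mass g y w" "obs_mass g y w < \<infinity>"
proof -
  let ?G = "\<lambda>z. ennreal (joint_obs V g z y)"
  obtain l u where l: "0 < l" "0 < u" "\<And>z. z \<in> space S \<Longrightarrow> l \<le> k z" "\<And>z. z \<in> space S \<Longrightarrow> k z \<le> u"
    using pos_densityE[OF k] by blast
  have G[measurable]: "?G \<in> borel_measurable S" using measurable_joint_obs[OF ok] by simp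
  have "ennreal l * (\<Prod>w\<in>V. obs_mass g y w) = (\<integral>\<^sup>+z. ennreal l * ?G z \<partial>S)"
    unfolding nn_integral_joint_obs[OF ok, symmetric] by (rule nn_integral_cmult[symmetric]) measurable
  also have "\<dots> \<le> likelihood V g y (density S (\<lambda>z. ennreal (k z)))"
    unfolding likelihood_density[OF ok k] using l(3) by (intro nn_integral_mono mult_right_mono ennreal_leI) auto
  finally have 1: "ennreal l * (\<Prod>w\<in>V. obs_mass g y w) < \<infinity>" using lik by (auto simp: less_top[symmetric] top_unique)
  have "likelihood V g y (density S (\<lambda>z. ennreal (k z))) \<le> (\<integral>\<^sup>+z. ennreal u * ?G z \<partial>S)"
    unfolding likelihood_density[OF ok k] using l(4) by (intro nn_integral_mono mult_right_mono ennreal_leI) auto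
  also have "\<dots> = ennreal u * (\<Prod>w\<in>V. obs_mass g y w)"
    unfolding nn_integral_joint_obs[OF ok, symmetric] by (rule nn_integral_cmult) measurable
  finally have 2: "likelihood V g y (density S (\<lambda>z. ennreal (k z))) \<le> ennreal u * (\<Prod>w\<in>V. obs_mass g y w)" .
  have "(\<Prod>w\<in>V. obs_mass g y w) \<noteq> 0"
  proof
    assume "(\<Prod>w\<in>V. obs_mass g y w) = 0"
    with 2 have "likelihood V g y (density S (\<lambda>z. ennreal (k z))) \<le> 0" by (simp only: mult_zero_right)
    with lik show False by auto
  qed
  then have nz: "\<And>w. w \<in> V \<Longrightarrow> obs_mass g y w \<noteq> 0" using finite_V by auto
  with w show "0 < obs_mass g y w" by (simp add: zero_less_iff_neq_zero)
  have "(\<Prod>w\<in>V. obs_mass g y w) \<noteq> \<infinity>"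
  proof
    assume "(\<Prod>w\<in>V. obs_mass g y w) = \<infinity>"
    with 1 l(1) show False by (simp add: ennreal_mult_top)
  qed
  moreover have "(\<Prod>w\<in>V. obs_mass g y w) = obs_mass g y w * (\<Prod>w\<in>V - {w}. obs_mass g y w)"
    by (rule prod.remove[OF finite_V w])
  moreover have "(\<Prod>w\<in>V - {w}. obs_mass g y w) \<noteq> 0" using nz finite_V by simp
  ultimately show "obs_mass g y w < \<infinity>" by (auto simp: ennreal_mult_eq_top_iff less_top)
qed

lemma refs_obs_ref:
  assumes ok: "obs_ok g y" and c: "\<And>w. w \<in> V \<Longrightarrow> 0 < obs_mass g y w \<and> obs_mass g y w < \<infinity>"
  shows "refs (obs_ref g y)"
  unfolding refs_def
proof (intro conjI allI ballI)
  fix w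
  show "prob_space (obs_ref g y w)"
  proof (cases "w \<in> V")
    case True
    have [measurable]: "(\<lambda>x. ennreal (g w x (y w))) \<in> borel_measurable (\<psi> w)" using obs_okD(1)[OF ok True] by simp
    have "(\<integral>\<^sup>+x. ennreal (g w x (y w)) / obs_mass g y w \<partial>\<psi> w) = obs_mass g y w / obs_mass g y w"
      unfolding obs_mass_def by (rule nn_integral_divide) measurable
    also have "\<dots> = 1" using c[OF True] by (intro ennreal_divide_self) auto
    finally have 1: "(\<integral>\<^sup>+x. ennreal (g w x (y w)) / obs_mass g y w \<partial>\<psi> w) = 1" .
    have m: "(\<lambda>x. ennreal (g w x (y w)) / obs_mass g y w) \<in> borel_measurable (\<psi> w)" by measurable
    show ?thesis
      using True 1 by (intro prob_spaceI) (simp add: obs_ref_def emeasure_density[OF m] cong: nn_integral_cong)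
  next
    case False
    then show ?thesis by (simp add: obs_ref_def prob_space_return)
  qed
qed (simp add: obs_ref_def)

text \<open>The product of the new references has density \<open>G / C\<close> over
  \<open>S\<close>, where \<open>G\<close> is the observation density. So \<open>k * G\<close> over
  \<open>S\<close> is \<open>C\<close> times \<open>k\<close> over that product, the likelihood is
  \<open>C * ?H\<close>, and \<open>C\<close> cancels.\<close>

lemma correct_represents:
  assumes ok: "obs_ok g y" and c: "\<And>w. w \<in> V \<Longrightarrow> 0 < obs_mass g y w \<and> obs_mass g y w < \<infinity>"
    and k: "pos_density S k"
  shows "represents (correct V g y (density S (\<lambda>z. ennreal (k z)))) (obs_ref g y) k"
proof -
  note refs = refs_obs_ref[OF ok c]
  let ?L = "obs_ref g y"
  interpret finite_product_prob_space ?L V by (rule refs_finite_product_prob_space[OF refs])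
  let ?H = "\<integral>z. k z \<partial>P"
  define G where "G z = joint_obs V g z y" for z
  have kP: "pos_density P k" using k pos_density_sets_cong[OF refs_PiM_sets[OF refs]] by blast
  have H: "0 < ?H" by (rule pos_density_integral_pos[OF kP])
  define cr where "cr w = enn2real (obs_mass g y w)" for w
  have cr: "obs_mass g y w = ennreal (cr w)" "0 < cr w" if "w \<in> V" for w
    using c[OF that] by (auto simp: cr_def enn2real_positive_iff)
  define C where "C = (\<Prod>w\<in>V. cr w)"
  have C: "0 < C" unfolding C_def using cr by (intro prod_pos) auto
  have Gm[measurable]: "G \<in> borel_measurable S" unfolding G_def[abs_def] by (rule measurable_joint_obs[OF ok])
  have km[measurable]: "k \<in> borel_measurable S" by (rule pos_density_measurable[OF k])
  have G0: "0 \<le> G z" if "z \<in> space S" for z unfolding G_def by (rule joint_obs_nonneg[OF ok that])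
  have k0: "0 \<le> k z" if "z \<in> space S" for z using pos_density_pos[OF k that] by simp
  have P_eq: "P = density S (\<lambda>z. ennreal (G z / C))"
  proof -
    have "P = density S (\<lambda>z. \<Prod>w\<in>V. ennreal (g w (z w) (y w)) / obs_mass g y w)"
    proof (rule PiM_density[OF finite_V \<psi>_sigma_finite])
      fix w assume w: "w \<in> V"
      have [measurable]: "(\<lambda>x. ennreal (g w x (y w))) \<in> borel_measurable (\<psi> w)" using obs_okD(1)[OF ok w] by simp
      show "(\<lambda>x. ennreal (g w x (y w)) / obs_mass g y w) \<in> borel_measurable (\<psi> w)" by measurable
      show "?L w = density (\<psi> w) (\<lambda>x. ennreal (g w x (y w)) / obs_mass g y w)" using w by (simp add: obs_ref_def)
    qed (intro prob_space_imp_sigma_finite refs_prob_space refs)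
    also have "\<dots> = density S (\<lambda>z. ennreal (G z / C))"
    proof (rule density_cong)
      have "(\<lambda>z. ennreal (g w (z w) (y w)) / obs_mass g y w) \<in> borel_measurable S" if "w \<in> V" for w
        using measurable_obs_component[OF ok that] by measurable
      then show "(\<lambda>z. \<Prod>w\<in>V. ennreal (g w (z w) (y w)) / obs_mass g y w) \<in> borel_measurable S"
        by (rule borel_measurable_prod_ennreal)
      show "AE z in S. (\<Prod>w\<in>V. ennreal (g w (z w) (y w)) / obs_mass g y w) = ennreal (G z / C)"
      proof (rule AE_I2)
        fix z assume z: "z \<in> space S"
        have "ennreal (g w (z w) (y w)) / obs_mass g y w = ennreal (g w (z w) (y w) / cr w)" if "w \<in> V" for w
          using cr[OF that] obs_okD(2)[OF ok that component_space[OF z that]] by (simp add: divide_ennreal)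
        then have "(\<Prod>w\<in>V. ennreal (g w (z w) (y w)) / obs_mass g y w) = (\<Prod>w\<in>V. ennreal (g w (z w) (y w) / cr w))"
          by (intro prod.cong) auto
        also have "\<dots> = ennreal (\<Prod>w\<in>V. g w (z w) (y w) / cr w)"
          using cr obs_okD(2)[OF ok _ component_space[OF z]] by (intro prod_ennreal) (auto intro: divide_nonneg_pos)
        also have "\<dots> = ennreal (G z / C)" by (simp add: prod_dividef G_def joint_obs_def C_def)
        finally show "(\<Prod>w\<in>V. ennreal (g w (z w) (y w)) / obs_mass g y w) = ennreal (G z / C)" .
      qed
    qed measurable
    finally show ?thesis .
  qed
  have "ennreal ?H = (\<integral>\<^sup>+z. ennreal (k z) \<partial>P)"
    using pos_density_integrable[OF kP] pos_density_pos[OF kP]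
    by (intro nn_integral_eq_integral[symmetric]) (auto intro!: AE_I2 intro: less_imp_le)
  also have "\<dots> = (\<integral>\<^sup>+z. ennreal (G z / C) * ennreal (k z) \<partial>S)"
    unfolding P_eq by (rule nn_integral_density) measurable
  finally have H_eq: "ennreal ?H = (\<integral>\<^sup>+z. ennreal (G z / C) * ennreal (k z) \<partial>S)" .
  have lik: "likelihood V g y (density S (\<lambda>z. ennreal (k z))) = ennreal (C * ?H)"
  proof -
    have "likelihood V g y (density S (\<lambda>z. ennreal (k z))) = (\<integral>\<^sup>+z. ennreal (k z) * ennreal (G z) \<partial>S)"
      unfolding likelihood_density[OF ok k] G_def ..
    also have "\<dots> = (\<integral>\<^sup>+z. ennreal C * (ennreal (G z / C) * ennreal (k z)) \<partial>S)"
    proof (rule nn_integral_cong)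
      fix z assume z: "z \<in> space S"
      have "k z * G z = C * (G z / C * k z)" using C by simp
      then show "ennreal (k z) * ennreal (G z) = ennreal C * (ennreal (G z / C) * ennreal (k z))"
        using C G0[OF z] k0[OF z] by (simp add: ennreal_mult''[symmetric] ennreal_mult'[symmetric] divide_nonneg_pos del: ennreal_mult_eq_top_iff)
    qed
    also have "\<dots> = ennreal C * (\<integral>\<^sup>+z. ennreal (G z / C) * ennreal (k z) \<partial>S)"
      by (rule nn_integral_cmult) measurable
    also have "\<dots> = ennreal (C * ?H)"
      unfolding H_eq[symmetric] using C H by (simp add: ennreal_mult)
    finally show ?thesis .
  qed
  have "correct V g y (density S (\<lambda>z. ennreal (k z))) = density S (\<lambda>z. ennreal (k z) * (ennreal (G z) / ennreal (C * ?H)))"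
    unfolding correct_def lik G_def[symmetric] by (rule density_density_eq) measurable
  also have "\<dots> = density S (\<lambda>z. ennreal (G z / C) * ennreal (k z / ?H))"
  proof (rule density_cong)
    show "AE z in S. ennreal (k z) * (ennreal (G z) / ennreal (C * ?H)) = ennreal (G z / C) * ennreal (k z / ?H)"
    proof (rule AE_I2)
      fix z assume z: "z \<in> space S"
      have "ennreal (k z) * (ennreal (G z) / ennreal (C * ?H)) = ennreal (k z) * ennreal (G z / (C * ?H))"
        using C H G0[OF z] by (simp add: divide_ennreal)
      also have "\<dots> = ennreal (k z * (G z / (C * ?H)))" using k0[OF z] by (rule ennreal_mult'[symmetric])
      also have "k z * (G z / (C * ?H)) = G z / C * (k z / ?H)" by simp
      also have "ennreal (G z / C * (k z / ?H)) = ennreal (G z / C) * ennreal (k z / ?H)"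
        using G0[OF z] C by (intro ennreal_mult') simp
      finally show "ennreal (k z) * (ennreal (G z) / ennreal (C * ?H)) = ennreal (G z / C) * ennreal (k z / ?H)" .
    qed
  qed measurable
  also have "\<dots> = density P (\<lambda>z. ennreal (k z / ?H))"
    unfolding P_eq by (rule density_density_eq[symmetric]) measurable
  finally show ?thesis unfolding represents_def using refs k by blast
qed

lemma represents_scale:
  assumes r: "represents \<mu> L (\<lambda>z. h z / c)" and c: "0 < c"
  shows "represents \<mu> L h"
proof -
  note D = representsD[OF r]
  have "pos_density S (\<lambda>z. c * (h z / c))"
    by (rule pos_density_mult[OF pos_density_const[OF c] D(2)])
  then have "pos_density S h" using c by simp
  moreover have "(\<lambda>x. ennreal (h x / c / (\<integral>x. h x / c \<partial>PiM V L))) = (\<lambda>x. ennreal (h x / (\<integral>x. h x \<partial>PiM V L)))"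
    using c by (simp add: fun_eq_iff)
  ultimately show ?thesis using D(1,5) unfolding represents_def by (simp only:)
qed

lemma filter_step_represents:
  assumes r: "represents \<mu> L h" and \<K>: "partition_on V \<K>" and ok: "obs_ok g y"
    and c: "\<And>w. w \<in> V \<Longrightarrow> 0 < obs_mass g y w \<and> obs_mass g y w < \<infinity>"
  shows "represents (correct V g y (blocking V \<psi> \<K> (predict V \<psi> p \<mu>))) (obs_ref g y) (next_density L h \<K>)"
    and "V \<noteq> {} \<Longrightarrow> represents (correct V g y (predict V \<psi> p \<mu>)) (obs_ref g y) (next_density L h {V})"
proof -
  note D = representsD[OF r]
  have Z: "0 < (\<integral>x. h x \<partial>PiM V L) ^ n" for n using D(4) by simp
  have step: "represents (correct V g y (density S (\<lambda>z. ennreal (next_density L h \<K> z / (\<integral>x. h x \<partial>PiM V L) ^ card \<K>))))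
      (obs_ref g y) (next_density L h \<K>)" if \<K>: "partition_on V \<K>" for \<K>
  proof -
    have "finite \<K>" "\<Union>\<K> \<subseteq> V" using finite_V \<K> finite_elements by (auto simp: partition_on_def)
    from pos_density_mult[OF pos_density_const pos_density_next_density[OF D(1,2) this], of "1 / (\<integral>x. h x \<partial>PiM V L) ^ card \<K>"] Z
    have "pos_density S (\<lambda>z. next_density L h \<K> z / (\<integral>x. h x \<partial>PiM V L) ^ card \<K>)" by simp
    from represents_scale[OF correct_represents[OF ok c this] Z] show ?thesis .
  qed
  show "represents (correct V g y (blocking V \<psi> \<K> (predict V \<psi> p \<mu>))) (obs_ref g y) (next_density L h \<K>)"
    unfolding blocking_predict_eq[OF r \<K>] by (rule step[OF \<K>])
  show "represents (correct V g y (predict V \<psi> p \<mu>)) (obs_ref g y) (next_density L h {V})" if "V \<noteq> {}"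
    unfolding predict_eq[OF r that] by (rule step[OF partition_on_space[OF that]])
qed

text \<open>The product of these point masses is the point mass at \<open>x\<close>; its density is
  the constant 1, and both the influence matrix and the error start from 0.\<close>

definition init_ref :: "('v \<Rightarrow> 'a) \<Rightarrow> 'v \<Rightarrow> 'a measure" where
  "init_ref x w = (if w \<in> V then return (\<psi> w) (x w) else return (count_space UNIV) undefined)"

lemma represents_init:
  assumes x: "x \<in> space S"
  shows "represents (return S x) (init_ref x) (\<lambda>_. 1)"
proof -
  have pr: "prob_space (init_ref x w)" for w
    unfolding init_ref_def using component_space[OF x] by (auto intro: prob_space_return)
  have refs: "refs (init_ref x)" unfolding refs_def using pr by (auto simp: init_ref_def)
  interpret finite_product_prob_space "init_ref x" V by (rule refs_finite_product_prob_space[OF refs])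
  have "P = return S x"
    by (rule PiM_return[OF finite_V x pr]) (simp add: init_ref_def)
  moreover have "density P (\<lambda>_. ennreal (1 / (\<integral>_. 1 \<partial>P))) = P"
    using P.prob_space by (simp add: density_1)
  ultimately show ?thesis
    unfolding represents_def using refs pos_density_const[of 1 S] by (simp only:)
qed

lemma init_tv:
  assumes x: "x \<in> space S" and q: "tilt_family q" and i: "i \<in> V" and z: "z \<in> space S" and z': "z' \<in> space S"
  shows "tv_le (init_ref x i) (\<lambda>a. tilted (\<lambda>_. 1) q (z(i := a))) (\<lambda>a. tilted (\<lambda>_. 1) q (z'(i := a))) 0"
proof -
  have "pos_density (\<psi> i) (\<lambda>a. tilted (\<lambda>_. 1) q (z(i := a)))" if "z \<in> space S" for z
    using pos_density_tilt_site[OF q i that] by (simp add: tilted_def)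
  then show ?thesis
    using i z z' component_space[OF x i] by (simp add: init_ref_def tv_le_return)
qed

lemma decay_init:
  assumes x: "x \<in> space S"
  shows "decay (init_ref x) (\<lambda>_. 1) (\<lambda>_ _. 0)"
  unfolding decay_def
proof (intro conjI allI impI)
  fix q i j z b assume "tilt_family q" "i \<in> V" "j \<in> V" "z \<in> space S" "b \<in> space (\<psi> j)"
  then show "tv_le (init_ref x i) (\<lambda>a. tilted (\<lambda>_. 1) q (z(i := a))) (\<lambda>a. tilted (\<lambda>_. 1) q (z(j := b, i := a))) 0"
    by (intro init_tv x space_upd)
qed auto

lemma close_init: "close L h h (\<lambda>_. 0)"
  unfolding close_def by (simp add: tv_le_refl)

text \<open>The trivial tilt gives the conditional laws of the filters themselves. A test function
  of coordinate \<open>v\<close> with |f| \<le> 1 oscillates by at most 2 at \<open>v\<close> and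
  not elsewhere, and the supersolution at \<open>v\<close> is \<open>2 * w v\<close>; hence the
  factor 4.\<close>

lemma close_local_dist:
  assumes r: "represents \<mu> L h" and r': "represents \<mu>' L h'" and c: "decay L h c" and w: "close L h h' w"
    and w_le: "\<And>a. a \<in> V \<Longrightarrow> w a \<le> w v * \<omega> v a" and w0: "0 \<le> w v" and v: "v \<in> V"
  shows "local_dist S {v} \<mu> \<mu>' \<le> 4 * w v"
proof (rule local_dist_le)
  note D = representsD[OF r] and D' = representsD[OF r']
  interpret finite_product_prob_space L V by (rule refs_finite_product_prob_space[OF D(1)])
  fix f :: "('v \<Rightarrow> 'a) \<Rightarrow> real"
  assume f: "f \<in> borel_measurable S" "\<And>x. x \<in> space S \<Longrightarrow> \<bar>f x\<bar> \<le> 1"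
    and f_local: "\<And>x x'. x \<in> space S \<Longrightarrow> x' \<in> space S \<Longrightarrow> (\<And>j. j \<in> {v} \<Longrightarrow> x j = x' j) \<Longrightarrow> f x = f x'"
  have fP: "f \<in> borel_measurable P" using f(1) measurable_cong_sets[OF refs_PiM_sets[OF D(1)] refl] by blast
  note sp = refs_space[OF D(1)] refs_PiM_space[OF D(1)]
  define W where "W a = 2 * w v * \<omega> v a" for a
  have W0: "0 \<le> W a" if "a \<in> V" for a unfolding W_def using w0 \<omega>_nonneg[OF v that] by simp
  have tilted_1: "tilted h (\<lambda>_ _. 1) = h" for h by (simp add: tilted_def fun_eq_iff)
  have "\<bar>wavg P h f - wavg P h' f\<bar> \<le> (\<Sum>a\<in>V. (if a = v then 2 else 0) * W a)"
  proof (rule dobrushin_comparison[OF D(3) D'(3), where C=c and b=w])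
    fix i j x b assume ij: "i \<in> V" "j \<in> V" "i \<noteq> j" and "x \<in> space P" "b \<in> space (L j)"
    then have "x \<in> space S" "b \<in> space (\<psi> j)" by (simp_all only: sp)
    from decayD(1)[OF c tilt_family_1 ij this]
    show "tv_le (L i) (\<lambda>z. h (x(i := z))) (\<lambda>z. h ((x(j := b))(i := z))) (c i j)"
      unfolding tilted_1 .
  next
    fix i x assume i: "i \<in> V" and "x \<in> space P"
    then have "x \<in> space S" by (simp only: sp)
    from w[unfolded close_def, rule_format, OF tilt_family_1 i this]
    show "tv_le (L i) (\<lambda>z. h (x(i := z))) (\<lambda>z. h' (x(i := z))) (w i)"
      unfolding tilted_1 .
  next
    fix i assume i: "i \<in> V"
    show "(\<Sum>j\<in>V. c i j * W j) + w i \<le> W i"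
      unfolding W_def by (rule decay_supersolution[OF c v i w0 w_le[OF i]])
  next
    show "coord_osc_le V L f (\<lambda>a. if a = v then 2 else 0)"
      unfolding coord_osc_le_def
    proof (intro ballI)
      fix a x z assume a: "a \<in> V" "x \<in> space P" "z \<in> space (L a)"
      then have x: "x \<in> space S" "x(a := z) \<in> space S" using sp space_upd by auto
      show "\<bar>f (x(a := z)) - f x\<bar> \<le> (if a = v then 2 else 0)"
      proof (cases "a = v")
        case True
        have "\<bar>f (x(a := z)) - f x\<bar> \<le> 2" using f(2)[OF x(1)] f(2)[OF x(2)] by linarith
        with True show ?thesis by simp
      next
        case False
        then have "f x = f (x(a := z))" by (intro f_local[OF x]) simp
        with False show ?thesis by simp
      qed
    qed
  qed (fact decayD(2)[OF c] decay_row[OF c] W0 fP)+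
  also have "\<dots> = (\<Sum>a\<in>V. if a = v then 2 * W a else 0)"
    by (intro sum.cong refl) simp
  also have "\<dots> = 4 * w v"
    using v by (simp only: sum.delta[OF finite_V] if_True) (simp add: W_def \<omega>_refl[OF v])
  finally have "\<bar>wavg P h f - wavg P h' f\<bar> \<le> 4 * w v" .
  moreover have "(\<integral>x. f x \<partial>\<mu>) = wavg P h f" "(\<integral>x. f x \<partial>\<mu>') = wavg P h' f"
    unfolding D(5) D'(5) by (rule wavg_real_density[OF D(3) fP] wavg_real_density[OF D'(3) fP])+
  ultimately show "\<bar>(\<integral>x. f x \<partial>\<mu>) - (\<integral>x. f x \<partial>\<mu>')\<bar> \<le> 4 * w v" by simp
qed

text \<open>Solved explicitly, \<open>err e n v\<close> is the sum of \<eta> e(s, v) / R^(n - s + 1)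
  over 1 \<le> s \<le> n: the blocking at time s is damped by every step from s to n.\<close>

fun err :: "(nat \<Rightarrow> 'v \<Rightarrow> real) \<Rightarrow> nat \<Rightarrow> 'v \<Rightarrow> real" where
  "err e 0 v = 0"
| "err e (Suc n) v = (err e n v + \<eta> * e (Suc n) v) / R"

text \<open>\<open>e s u\<close> stands for exp (-\<beta> d), where d is the distance from
  \<open>u\<close> to the border of its block at time s. \<open>e_le\<close> says that this distance
  is 1-Lipschitz, \<open>e_border\<close> that a vertex whose neighbourhood leaves the block is no
  closer to \<open>u\<close> than the border. The Lipschitz property passes to \<open>err\<close>,
  which can then take the role of the profile required by the step in time.\<close>

theorem filter_error:
  fixes g :: "'v \<Rightarrow> 'a \<Rightarrow> 'c \<Rightarrow> real" and \<K> :: "nat \<Rightarrow> 'v set set"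
  assumes x: "x \<in> space S" and v: "v \<in> V"
    and ok: "\<And>s. obs_ok g (y (Suc s))"
    and lik: "\<And>s. likelihood V g (y (Suc s)) (predict V \<psi> p (exact_filter V \<psi> p g y (return S x) s)) \<in> {0<..<\<infinity>}"
    and \<K>: "\<And>s. partition_on V (\<K> (\<sigma> s))"
    and e0: "\<And>s a. a \<in> V \<Longrightarrow> 0 \<le> e s a"
    and e_le: "\<And>s u a. u \<in> V \<Longrightarrow> a \<in> V \<Longrightarrow> e s a \<le> e s u * \<omega> u a"
    and e_border: "\<And>s K u a. K \<in> \<K> (\<sigma> s) \<Longrightarrow> u \<in> K \<Longrightarrow> a \<in> V \<Longrightarrow> \<not> N a \<subseteq> K \<Longrightarrow> 1 \<le> e s u * \<omega> u a"
  shows "local_dist S {v} (exact_filter V \<psi> p g y (return S x) n) (blocked_filter V \<psi> p g y \<K> \<sigma> (return S x) n)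
    \<le> 4 * err e n v"
proof -
  have V: "V \<noteq> {}" using v by blast
  have err0: "0 \<le> err e n a" if "a \<in> V" for n a
    using that by (induction n) (use e0 \<eta>_bounds R in \<open>auto intro!: divide_nonneg_nonneg add_nonneg_nonneg mult_nonneg_nonneg\<close>)
  have err_le: "err e n a \<le> err e n u * \<omega> u a" if "u \<in> V" "a \<in> V" for n u a
  proof (induction n)
    case 0
    then show ?case by simp
  next
    case (Suc n)
    have "\<eta> * e (Suc n) a \<le> \<eta> * (e (Suc n) u * \<omega> u a)"
      using e_le[OF that] \<eta>_bounds by (intro mult_left_mono) auto
    with Suc have "err e n a + \<eta> * e (Suc n) a \<le> (err e n u + \<eta> * e (Suc n) u) * \<omega> u a"
      by (simp only: distrib_right mult.assoc)
    then have "(err e n a + \<eta> * e (Suc n) a) / R \<le> (err e n u + \<eta> * e (Suc n) u) * \<omega> u a / R"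
      using R by (intro divide_right_mono) auto
    then show ?case by simp
  qed
  have "\<exists>L h h' c. represents (exact_filter V \<psi> p g y (return S x) n) L h \<and>
      represents (blocked_filter V \<psi> p g y \<K> \<sigma> (return S x) n) L h' \<and> decay L h c \<and> close L h h' (err e n)" for n
  proof (induction n)
    case 0
    have "err e 0 = (\<lambda>_. 0)" by (rule ext) simp
    show ?case
      unfolding \<open>err e 0 = (\<lambda>_. 0)\<close> exact_filter.simps blocked_filter.simps
      using represents_init[OF x] decay_init[OF x] close_init by blast
  next
    case (Suc n)
    then obtain L h h' c where r: "represents (exact_filter V \<psi> p g y (return S x) n) L h"
      and r': "represents (blocked_filter V \<psi> p g y \<K> \<sigma> (return S x) n) L h'" and c: "decay L h c" and w: "close L h h' (err e n)"
      by blast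
    note D = representsD[OF r] and D' = representsD[OF r']
    \<comment> \<open>The exact likelihood controls the observation masses; the reference measure
      built from them is shared by both filters.\<close>
    have m: "0 < obs_mass g (y (Suc n)) w \<and> obs_mass g (y (Suc n)) w < \<infinity>" if "w \<in> V" for w
    proof -
      have "pos_density S (\<lambda>z. 1 / (\<integral>x. h x \<partial>PiM V L) ^ card {V} * next_density L h {V} z)"
        using D(4) by (intro pos_density_mult pos_density_const pos_density_next_density[OF D(1,2)]) auto
      then have "pos_density S (\<lambda>z. next_density L h {V} z / (\<integral>x. h x \<partial>PiM V L) ^ card {V})" by simp
      from obs_mass_finite[OF ok this _ that] lik[of n] show ?thesis unfolding predict_eq[OF r V] by blast
    qed
    let ?L' = "obs_ref g (y (Suc n))"
    have refs': "refs ?L'" by (rule refs_obs_ref[OF ok m])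
    have "represents (exact_filter V \<psi> p g y (return S x) (Suc n)) ?L' (next_density L h {V})"
      using filter_step_represents(2)[OF r \<K> ok m V] by simp
    moreover have "represents (blocked_filter V \<psi> p g y \<K> \<sigma> (return S x) (Suc n)) ?L' (next_density L h' (\<K> (\<sigma> (Suc n))))"
      using filter_step_represents(1)[OF r' \<K> ok m] by simp
    moreover obtain c' where "decay ?L' (next_density L h {V}) c'"
      using decay_step[OF D(1) refs' D(2) c] by blast
    moreover have "close ?L' (next_density L h {V}) (next_density L h' (\<K> (\<sigma> (Suc n)))) (\<lambda>v. (err e n v + \<eta> * e (Suc n) v) / R)"
    proof (rule close_step[OF D(1) refs' D(2) D'(2) c w \<K> err0])
      fix u K a assume K: "u \<in> K" "K \<in> \<K> (\<sigma> (Suc n))" and a: "a \<in> V"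
      then have u: "u \<in> V" using \<K>[of "Suc n"] by (auto simp: partition_on_def)
      have "(if N a \<subseteq> K then 0 else \<eta>) \<le> \<eta> * (e (Suc n) u * \<omega> u a)"
      proof (cases "N a \<subseteq> K")
        case True
        then show ?thesis using \<eta>_bounds e0[OF u] \<omega>_nonneg[OF u a] by auto
      next
        case False
        then show ?thesis using mult_left_mono[OF e_border[OF K(2,1) a False] \<eta>_bounds(1)] by simp
      qed
      with err_le[OF u a, of n] show "err e n a + (if N a \<subseteq> K then 0 else \<eta>) \<le> (err e n u + \<eta> * e (Suc n) u) * \<omega> u a"
        by (simp only: distrib_right mult.assoc)
    qed
    moreover have "(\<lambda>v. (err e n v + \<eta> * e (Suc n) v) / R) = err e (Suc n)" by (rule ext) simp
    ultimately show ?case by (simp only:) blast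
  qed
  then obtain L h h' c where "represents (exact_filter V \<psi> p g y (return S x) n) L h"
      "represents (blocked_filter V \<psi> p g y \<K> \<sigma> (return S x) n) L h'" "decay L h c" "close L h h' (err e n)"
    by blast
  from close_local_dist[OF this err_le[OF v] err0[OF v] v] show ?thesis .
qed

end

section \<open>Distances to the border\<close>

context graph
begin

lemma gdist_le_length: "awalk u p w \<Longrightarrow> gdist G u w \<le> ereal (real (length p))"
proof -
  have "awalk_cost (\<lambda>_. 1) p = real (length p)" for p :: "'b list"
    by (induction p) auto
  then show "awalk u p w \<Longrightarrow> gdist G u w \<le> ereal (real (length p))"
    unfolding gdist_def using min_cost_le_walk_cost[of u p w "\<lambda>_. 1"] by simp
qed

lemma gdist_walk:
  assumes "gdist G u w \<noteq> \<infinity>"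
  obtains p where "awalk u p w" "gdist G u w = ereal (real (length p))"
proof -
  have cost: "awalk_cost (\<lambda>_. 1) p = real (length p)" for p :: "'b list"
    by (induction p) auto
  have "u \<rightarrow>\<^sup>* w" using assms \<mu>_reach_conv[of "\<lambda>_. 1" u w] unfolding gdist_def by auto
  from min_cost_awalk[OF this, of "\<lambda>_. 1"] obtain p where "apath u p w" "\<mu> (\<lambda>_. 1) u w = awalk_cost (\<lambda>_. 1) p" by auto
  then show ?thesis using that unfolding gdist_def cost by (auto simp: apath_def)
qed

lemma gdist_nonneg: "0 \<le> gdist G u w"
  by (cases "gdist G u w = \<infinity>") (auto elim: gdist_walk)

lemma gdist_refl: "u \<in> verts G \<Longrightarrow> gdist G u u = 0"
  using gdist_le_length[of u "[]" u] gdist_nonneg[of u u] by (simp add: awalk_Nil_iff zero_ereal_def[symmetric] antisym)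

lemma gdist_triangle: "gdist G u w \<le> gdist G u v + gdist G v w"
proof (cases "gdist G u v = \<infinity> \<or> gdist G v w = \<infinity>")
  case True
  then show ?thesis using gdist_nonneg by auto
next
  case False
  then obtain p q where "awalk u p v" "gdist G u v = ereal (real (length p))"
    "awalk v q w" "gdist G v w = ereal (real (length q))"
    by (metis gdist_walk)
  then show ?thesis using gdist_le_length[OF awalk_appendI, of u p v q w] by simp
qed

lemma awalk_reverse: "awalk u p w \<Longrightarrow> \<exists>q. awalk w q u \<and> length q = length p"
proof (induction p arbitrary: u)
  case Nil
  then show ?case by (auto simp: awalk_Nil_iff)
next
  case (Cons e p)
  then have e: "e \<in> arcs G" "u = tail G e" "awalk (head G e) p w" by (auto simp: awalk_Cons_iff)
  then obtain q where q: "awalk w q (head G e)" "length q = length p" using Cons.IH by blast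
  obtain e' where e': "e' \<in> arcs G" "tail G e = head G e'" "head G e = tail G e'"
    using sym_arcs e(1) unfolding symmetric_conv by blast
  then have "awalk (head G e) [e'] u" using e by (auto simp: awalk_Cons_iff awalk_Nil_iff)
  from awalk_appendI[OF q(1) this] q(2) show ?case by (intro exI[of _ "q @ [e']"]) simp
qed

lemma gdist_sym: "gdist G u w = gdist G w u"
proof -
  have "gdist G w u \<le> gdist G u w" for u w
  proof (cases "gdist G u w = \<infinity>")
    case False
    then obtain p where p: "awalk u p w" "gdist G u w = ereal (real (length p))" by (rule gdist_walk)
    then show ?thesis using awalk_reverse[OF p(1)] gdist_le_length by metis
  qed simp
  then show ?thesis by (intro antisym)
qed

text \<open>The vertex from which the walk first steps out of \<open>K\<close> belongs to the
  border, since its successor is at distance at most 1 \<le> r.\<close>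

lemma walk_meets_border:
  assumes "awalk u p w" "u \<in> K" "w \<notin> K" "r \<ge> 1"
  shows "\<exists>b\<in>border G r K. gdist G u b \<le> ereal (real (length p))"
  using assms
proof (induction p arbitrary: u)
  case Nil
  then show ?case by (auto simp: awalk_Nil_iff)
next
  case (Cons e p)
  then have e: "e \<in> arcs G" "u = tail G e" "awalk (head G e) p w" by (auto simp: awalk_Cons_iff)
  have "awalk u [e] (head G e)" using e by (auto simp: awalk_Cons_iff awalk_Nil_iff)
  then have d: "gdist G u (head G e) \<le> 1" using gdist_le_length[of u "[e]"] by (simp add: one_ereal_def)
  show ?case
  proof (cases "head G e \<in> K")
    case True
    then obtain b where b: "b \<in> border G r K" "gdist G (head G e) b \<le> ereal (real (length p))"
      using Cons e by blast
    have "gdist G u b \<le> 1 + ereal (real (length p))"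
      using gdist_triangle[of u b "head G e"] add_mono[OF d b(2)] by (rule order_trans)
    with b(1) show ?thesis by (auto simp: one_ereal_def)
  next
    case False
    have "gdist G u (head G e) \<le> ereal (real r)"
      by (rule order_trans[OF d]) (use \<open>r \<ge> 1\<close> in \<open>simp add: one_ereal_def\<close>)
    then have "head G e \<in> nbhd G r u" using e by (simp add: nbhd_def)
    with False Cons.prems have "u \<in> border G r K" by (auto simp: border_def)
    moreover have "gdist G u u \<le> ereal (real (length (e # p)))" using e by (simp add: gdist_refl)
    ultimately show ?thesis by blast
  qed
qed

lemma border_dist_le_outside:
  assumes \<K>: "partition_on (verts G) \<K>" and K: "K \<in> \<K>" "u \<in> K" and r: "r \<ge> 1"
    and a: "a \<notin> K \<or> a \<in> border G r K"
  shows "border_dist G r \<K> u \<le> gdist G u a"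
proof (cases "gdist G u a = \<infinity>")
  case False
  have *: "border_dist G r \<K> u \<le> gdist G u b" if "b \<in> border G r K" for b
    unfolding border_dist_def gdist_set_def block_eq[OF \<K> K] using that by (rule INF_lower)
  obtain p where p: "awalk u p a" "gdist G u a = ereal (real (length p))" using False by (rule gdist_walk)
  from a show ?thesis
  proof
    assume "a \<notin> K"
    from walk_meets_border[OF p(1) K(2) this r] * p(2) show ?thesis by (auto intro: order_trans)
  qed (rule *)
qed simp

lemma border_dist_nonneg: "0 \<le> border_dist G r \<K> u"
  unfolding border_dist_def gdist_set_def by (intro INF_greatest gdist_nonneg)

text \<open>In one block this is the triangle inequality. Borders of different blocks are unrelated,
  but then every walk from \<open>u\<close> to \<open>a\<close> already meets the border of the
  block of \<open>u\<close>, and the distance to \<open>a\<close> alone suffices.\<close>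

lemma border_dist_lipschitz:
  assumes \<K>: "partition_on (verts G) \<K>" and u: "u \<in> verts G" and a: "a \<in> verts G" and r: "r \<ge> 1"
  shows "border_dist G r \<K> u \<le> gdist G u a + border_dist G r \<K> a"
proof (cases "a \<in> block \<K> u")
  case False
  have "border_dist G r \<K> u \<le> gdist G u a"
    using border_dist_le_outside[OF \<K> block_in[OF \<K> u] r] False by blast
  also have "\<dots> \<le> gdist G u a + border_dist G r \<K> a"
    using border_dist_nonneg by (simp add: ereal_le_add_self)
  finally show ?thesis .
next
  case True
  let ?B = "border G r (block \<K> u)"
  have eq: "block \<K> a = block \<K> u" using block_eq[OF \<K> block_in(1)[OF \<K> u] True] .
  show ?thesis
  proof (cases "?B = {}")
    case True
    then have "border_dist G r \<K> a = \<infinity>" by (simp add: border_dist_def gdist_set_def eq top_ereal_def)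
    then show ?thesis using gdist_nonneg[of u a] by simp
  next
    case False
    have "border_dist G r \<K> u \<le> (INF b\<in>?B. gdist G u a + gdist G a b)"
      unfolding border_dist_def gdist_set_def by (intro INF_mono') (rule gdist_triangle)
    also have "\<dots> = gdist G u a + (INF b\<in>?B. gdist G a b)"
    proof (rule INF_ereal_add_right[OF False])
      show "gdist G u a \<noteq> - \<infinity>" using gdist_nonneg[of u a] by auto
    qed (rule gdist_nonneg)
    finally show ?thesis by (simp add: border_dist_def gdist_set_def eq)
  qed
qed

end

text \<open>Distances are truncated at a finite level, so that the exponential weights are real also between
  different components of the graph and for an empty border; the level tends to infinity at the end.\<close>

definition truncate :: "real \<Rightarrow> ereal \<Rightarrow> real" where
  "truncate l d = real_of_ereal (min d (ereal l))"

lemma truncate_simps [simp]: "truncate l (ereal d) = min d l" "truncate l \<infinity> = l"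
  by (simp_all add: truncate_def min_def)

lemma truncate_mono: "0 \<le> d \<Longrightarrow> d \<le> d' \<Longrightarrow> truncate l d \<le> truncate l d'"
  by (cases d; cases d') auto

lemma truncate_nonneg: "0 \<le> d \<Longrightarrow> 0 \<le> l \<Longrightarrow> 0 \<le> truncate l d"
  by (cases d) auto

text \<open>Together with monotonicity, subadditivity gives the exponentials of truncated distances
  the multiplicative triangle inequality required of \<open>\<omega>\<close>.\<close>

lemma truncate_add: "0 \<le> d \<Longrightarrow> 0 \<le> d' \<Longrightarrow> 0 \<le> l \<Longrightarrow> truncate l (d + d') \<le> truncate l d + truncate l d'"
  by (cases d; cases d') auto

lemma truncate_le: "0 \<le> d \<Longrightarrow> d \<le> ereal c \<Longrightarrow> truncate l d \<le> c"
  by (cases d) auto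

section \<open>Averaging over the partitions\<close>

definition exp_dist :: "real \<Rightarrow> ereal \<Rightarrow> real" where
  "exp_dist \<beta> d = (if d = \<infinity> then 0 else exp (- \<beta> * real_of_ereal d))"

lemma exp_ereal_infinity [simp]: "exp_ereal \<infinity> = \<infinity>" "exp_ereal (- \<infinity>) = 0"
  using exp_ereal.simps(2,3) by (simp_all only: PInfty_eq_infinity MInfty_eq_minfinity)

lemma nonneg_ereal_finite: "0 \<le> x \<Longrightarrow> x \<noteq> \<infinity> \<Longrightarrow> x = ereal (real_of_ereal x)"
  by (cases x) auto

lemma exp_ereal_nonneg: "0 \<le> exp_ereal z"
  by (cases z) auto

lemma exp_ereal_exp_dist:
  assumes "0 < \<beta>" "0 \<le> d"
  shows "exp_ereal (- (ereal \<beta> * d)) = ereal (exp_dist \<beta> d)"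
  using assms by (cases d) (auto simp: exp_dist_def)

lemma exp_dist_truncate_tendsto:
  assumes "0 < \<beta>" "0 \<le> d"
  shows "(\<lambda>l. exp (- \<beta> * truncate (real l) d)) \<longlonglongrightarrow> exp_dist \<beta> d"
proof (cases d)
  case (real c)
  obtain N where "c \<le> real N" using real_arch_simple by blast
  then have "\<forall>l\<ge>N. exp (- \<beta> * truncate (real l) d) = exp_dist \<beta> d"
    by (auto simp: real exp_dist_def min_def)
  then show ?thesis by (intro tendsto_eventually) (auto simp: eventually_sequentially)
next
  case PInf
  have "(\<lambda>l. exp (- (\<beta> * real l))) \<longlonglongrightarrow> 0"
    using assms(1) by real_asymp
  then show ?thesis using PInf by (simp add: exp_dist_def)
qed (use assms in auto)

text \<open>The inequality exp t \<ge> 1 + t gives t exp (-t) \<le> 1 - exp (-t), and exp (-\<tau>)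
  \<le> exp (-t). The result is an upper bound linear in t, which commutes with averaging.\<close>

lemma one_minus_le_exp_shifted:
  fixes t \<tau> :: real
  assumes "0 \<le> t" "t \<le> \<tau>"
  shows "exp (- t) \<le> 1 - t * exp (- \<tau>)"
proof -
  have "1 + t \<le> exp t" by (rule exp_ge_add_one_self)
  then have "(1 + t) * exp (- t) \<le> exp t * exp (- t)" by (intro mult_right_mono) auto
  then have "exp (- t) + t * exp (- t) \<le> 1" by (simp add: exp_minus distrib_right)
  moreover have "t * exp (- \<tau>) \<le> t * exp (- t)" using assms by (intro mult_left_mono) auto
  ultimately show ?thesis by linarith
qed

text \<open>A reverse to Jensen's inequality. With exp (-a) extracted, each term has a bound linear
  in \<open>u j - a\<close>; the average of these is 1 - s with s = \<open>T * ?c\<close>, and 1 - s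
  \<le> exp (-s). The price of linearisation is the exponential of the spread
  \<open>b - a\<close>.\<close>

lemma mean_exp_le:
  fixes u :: "nat \<Rightarrow> real"
  assumes m: "1 \<le> m" and a: "0 \<le> a" "\<And>j. j < m \<Longrightarrow> a \<le> u j" and b: "\<And>j. j < m \<Longrightarrow> u j \<le> b"
  shows "1 / real m * (\<Sum>j<m. exp (- u j)) \<le> exp (- (exp (- (b - a)) * (1 / real m * (\<Sum>j<m. u j))))"
proof -
  define T where "T = 1 / real m * (\<Sum>j<m. u j - a)"
  let ?c = "exp (- (b - a))"
  have mpos: "0 < real m" using m by simp
  have ab: "a \<le> b" using a(2)[of 0] b[of 0] m by force
  have mean: "1 / real m * (\<Sum>j<m. u j) = a + T" using mpos by (simp add: T_def sum_subtractf field_simps)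
  have "(\<Sum>j<m. exp (- u j)) \<le> (\<Sum>j<m. exp (- a) * (1 - (u j - a) * ?c))"
  proof (rule sum_mono)
    fix j assume "j \<in> {..<m}"
    then have "exp (- (u j - a)) \<le> 1 - (u j - a) * ?c" using a(2)[of j] b[of j] by (intro one_minus_le_exp_shifted) auto
    then have "exp (- a) * exp (- (u j - a)) \<le> exp (- a) * (1 - (u j - a) * ?c)" by (intro mult_left_mono) auto
    then show "exp (- u j) \<le> exp (- a) * (1 - (u j - a) * ?c)" by (simp add: exp_add[symmetric])
  qed
  also have "\<dots> = exp (- a) * (real m - (\<Sum>j<m. u j - a) * ?c)"
    by (simp only: sum_distrib_left[symmetric] sum_subtractf[of "\<lambda>_. 1"] sum_distrib_right[symmetric]) simp
  finally have "1 / real m * (\<Sum>j<m. exp (- u j)) \<le> 1 / real m * (exp (- a) * (real m - (\<Sum>j<m. u j - a) * ?c))"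
    using mpos by (intro mult_left_mono) auto
  also have "\<dots> = exp (- a) * (1 + - (T * ?c))" using mpos by (simp add: T_def field_simps)
  also have "\<dots> \<le> exp (- a) * exp (- (T * ?c))"
    by (intro mult_left_mono exp_ge_add_one_self) auto
  also have "\<dots> = exp (- (a + T * ?c))" by (simp add: exp_add[symmetric])
  \<comment> \<open>The excess \<open>T\<close> over \<open>a\<close> already carries the factor
    \<open>?c\<close>. As \<open>?c \<le> 1\<close> and \<open>a \<ge> 0\<close>, it may be put on
    \<open>a\<close> too, which restores the full average.\<close>
  also have "\<dots> \<le> exp (- (?c * (a + T)))"
  proof -
    have "?c * a \<le> 1 * a" using ab a(1) by (intro mult_right_mono) auto
    then show ?thesis by (simp add: algebra_simps)
  qed
  finally show ?thesis unfolding mean .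
qed

text \<open>If all distances are infinite, the left side is 0. If only some are, the gap is
  infinite, its exponential is 0 and annihilates the infinite mean, so the right side is 1. In the
  finite case the bound is applied to \<beta> d; the second division by m only enlarges the right
  side.\<close>

lemma mean_exp_ereal_le:
  fixes d :: "nat \<Rightarrow> ereal"
  assumes m: "1 \<le> m" and d: "\<And>j. j < m \<Longrightarrow> 0 \<le> d j" and \<beta>: "0 < \<beta>"
  shows "ereal (1 / real m) * (\<Sum>j<m. exp_ereal (- (ereal \<beta> * d j))) \<le>
    exp_ereal (- (ereal \<beta> * exp_ereal (- (ereal \<beta> * ereal_gap (MAX j\<in>{..<m}. d j) (MIN j\<in>{..<m}. d j))) *
      (ereal (1 / real m) * (ereal (1 / real m) * (\<Sum>j<m. d j)))))"
proof -
  have ne: "finite (d ` {..<m})" "d ` {..<m} \<noteq> {}" using m by (auto simp: lessThan_empty_iff)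
  let ?M = "MAX j\<in>{..<m}. d j" and ?N = "MIN j\<in>{..<m}. d j"
  have mpos: "0 < real m" using m by simp
  have lhs: "ereal (1 / real m) * (\<Sum>j<m. exp_ereal (- (ereal \<beta> * d j))) = ereal (1 / real m * (\<Sum>j<m. exp_dist \<beta> (d j)))"
    using exp_ereal_exp_dist[OF \<beta> d] by simp
  have le1: "exp_dist \<beta> (d j) \<le> 1" if "j < m" for j
    using d[OF that] \<beta> by (cases "d j") (auto simp: exp_dist_def)
  have lhs_le1: "1 / real m * (\<Sum>j<m. exp_dist \<beta> (d j)) \<le> 1"
  proof -
    have "(\<Sum>j<m. exp_dist \<beta> (d j)) \<le> (\<Sum>j<m. 1)" using le1 by (intro sum_mono) auto
    then show ?thesis using mpos by (simp add: field_simps)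
  qed
  have N0: "0 \<le> ?N" using ne d by auto
  have Mge: "d j \<le> ?M" "?N \<le> d j" if "j < m" for j using that by (auto intro!: Max_ge Min_le)
  show ?thesis
  proof (cases "?N = \<infinity>")
    case True
    then have "d j = \<infinity>" if "j < m" for j using Mge(2)[OF that] by simp
    then have "(\<Sum>j<m. exp_dist \<beta> (d j)) = 0" by (intro sum.neutral) (auto simp: exp_dist_def)
    then show ?thesis unfolding lhs by (simp add: exp_ereal_nonneg zero_ereal_def[symmetric])
  next
    case N: False
    show ?thesis
    proof (cases "?M = \<infinity>")
      case True
      then have "ereal_gap ?M ?N = \<infinity>" using N by (simp add: ereal_gap_def)
      then have "exp_ereal (- (ereal \<beta> * ereal_gap ?M ?N)) = 0" using \<beta> by simp
      then show ?thesis unfolding lhs using lhs_le1 by (simp add: zero_ereal_def[symmetric] del: ereal_less_eq) (simp add: zero_ereal_def one_ereal_def)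
    next
      case M: False
      define a where "a = real_of_ereal ?N"
      define b where "b = real_of_ereal ?M"
      define u where "u j = real_of_ereal (d j)" for j
      have Na: "?N = ereal a" unfolding a_def using N0 N by (rule nonneg_ereal_finite)
      have Mb: "?M = ereal b" 
      proof -
        have "0 \<le> ?M" using m by (intro order_trans[OF d[of 0] Mge(1)[of 0]]) auto
        then show ?thesis unfolding b_def using M by (rule nonneg_ereal_finite)
      qed
      have du: "d j = ereal (u j)" if "j < m" for j
        
      proof -
        have "d j \<noteq> \<infinity>" using Mge(1)[OF that] unfolding Mb by auto
        then show ?thesis unfolding u_def using d[OF that] by (intro nonneg_ereal_finite)
      qed
      have a0: "0 \<le> a" using N0 Na by simp
      have gap: "ereal_gap ?M ?N = ereal (b - a)" unfolding ereal_gap_def Na Mb by (simp add: zero_ereal_def)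
      have ab: "a \<le> u j \<and> u j \<le> b" if "j < m" for j using Mge[OF that] unfolding Na Mb du[OF that] by simp
      have sum_d: "(\<Sum>j<m. d j) = ereal (\<Sum>j<m. u j)" using du by simp
      have "1 / real m * (\<Sum>j<m. exp (- (\<beta> * u j))) \<le> exp (- (exp (- (\<beta> * b - \<beta> * a)) * (1 / real m * (\<Sum>j<m. \<beta> * u j))))"
        using a0 ab \<beta> by (intro mean_exp_le[OF m]) (auto intro: mult_left_mono)
      also have "\<dots> \<le> exp (- (\<beta> * exp (- (\<beta> * (b - a))) * (1 / real m * (1 / real m * (\<Sum>j<m. u j)))))"
      proof -
        have "0 \<le> (\<Sum>j<m. u j)" using ab a0 by (intro sum_nonneg) force
        then have X: "0 \<le> \<beta> * exp (- (\<beta> * (b - a))) * (1 / real m * (\<Sum>j<m. u j))" using \<beta> by (intro mult_nonneg_nonneg) auto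
        have "1 / real m * (\<beta> * exp (- (\<beta> * (b - a))) * (1 / real m * (\<Sum>j<m. u j))) \<le>
            1 * (\<beta> * exp (- (\<beta> * (b - a))) * (1 / real m * (\<Sum>j<m. u j)))"
          using m by (intro mult_right_mono X) simp
        then show ?thesis by (simp add: sum_distrib_left[symmetric] right_diff_distrib mult_ac)
      qed
      finally have main: "1 / real m * (\<Sum>j<m. exp (- (\<beta> * u j))) \<le>
          exp (- (\<beta> * exp (- (\<beta> * (b - a))) * (1 / real m * (1 / real m * (\<Sum>j<m. u j)))))" .
      have "(\<Sum>j<m. exp_dist \<beta> (d j)) = (\<Sum>j<m. exp (- (\<beta> * u j)))"
        using du by (intro sum.cong) (auto simp: exp_dist_def)
      with main show ?thesis unfolding lhs gap sum_d by simp
    qed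
  qed
qed

text \<open>With T the sum of \<open>E\<close> over all residues, the window sum satisfies S(n + 1)
  \<le> \<rho> S(n) + \<rho> T, because the at most m consecutive times in a window have distinct
  residues. The claimed bound is the fixed point of this recursion.\<close>

lemma windowed_sum_bound:
  fixes E :: "nat \<Rightarrow> real"
  assumes m: "1 \<le> m" and \<rho>: "0 \<le> \<rho>" "\<rho> < 1" and E: "\<And>j. 0 \<le> E j"
    and q0: "q 0 = 0" and qS: "\<And>n. q (Suc n) = \<rho> * (q n + E (Suc n mod m))"
  shows "(\<Sum>k<m. if k \<le> n then q (n - k) else 0) \<le> \<rho> / (1 - \<rho>) * (\<Sum>j<m. E j)"
proof (induction n)
  case 0
  have "(\<Sum>k<m. if k \<le> 0 then q (0 - k) else 0) = 0" using q0 by (intro sum.neutral) auto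
  moreover have "0 \<le> \<rho> / (1 - \<rho>) * (\<Sum>j<m. E j)" using \<rho> E by (intro mult_nonneg_nonneg sum_nonneg) auto
  ultimately show ?case by simp
next
  case (Suc n)
  let ?T = "\<Sum>j<m. E j"
  \<comment> \<open>The index k = n + 1, if it lies in the window, contributes
    \<open>q 0 = 0\<close>; the recursion therefore applies to k \<le> n only.\<close>
  have "(\<Sum>k<m. if k \<le> Suc n then q (Suc n - k) else 0) =
      (\<Sum>k<m. \<rho> * (if k \<le> n then q (n - k) else 0) + \<rho> * (if k \<le> n then E ((Suc n - k) mod m) else 0))"
  proof (rule sum.cong[OF refl])
    fix k
    show "(if k \<le> Suc n then q (Suc n - k) else 0) =
        \<rho> * (if k \<le> n then q (n - k) else 0) + \<rho> * (if k \<le> n then E ((Suc n - k) mod m) else 0)"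
      using qS[of "n - k"] q0 by (cases "k \<le> n") (auto simp: Suc_diff_le distrib_left le_Suc_eq)
  qed
  also have "\<dots> = \<rho> * (\<Sum>k<m. if k \<le> n then q (n - k) else 0) + \<rho> * (\<Sum>k<m. if k \<le> n then E ((Suc n - k) mod m) else 0)"
    by (simp only: sum.distrib sum_distrib_left)
  also have "\<dots> \<le> \<rho> * (\<rho> / (1 - \<rho>) * ?T) + \<rho> * ?T"
  proof (intro add_mono mult_left_mono Suc \<rho>(1))
    have inj: "inj_on (\<lambda>k. (Suc n - k) mod m) {k. k < m \<and> k \<le> n}"
    proof (rule inj_onI)
      have *: "k = l" if kl: "k \<le> l" "l < m" "l \<le> n" and eq: "(Suc n - k) mod m = (Suc n - l) mod m" for k l
      proof -
        have "m dvd (Suc n - k) - (Suc n - l)" using mod_eq_dvd_iff_nat[of "Suc n - l" "Suc n - k" m] eq kl by auto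
        then have "m dvd l - k" using kl by simp
        then show ?thesis using kl by (auto dest: dvd_imp_le)
      qed
      fix k l assume "k \<in> {k. k < m \<and> k \<le> n}" "l \<in> {k. k < m \<and> k \<le> n}" "(Suc n - k) mod m = (Suc n - l) mod m"
      then show "k = l" using *[of k l] *[of l k] by (cases "k \<le> l") auto
    qed
    have "(\<Sum>k<m. if k \<le> n then E ((Suc n - k) mod m) else 0) = (\<Sum>k\<in>{k. k < m \<and> k \<le> n}. E ((Suc n - k) mod m))"
      by (rule sum.mono_neutral_cong_right) auto
    also have "\<dots> = sum E ((\<lambda>k. (Suc n - k) mod m) ` {k. k < m \<and> k \<le> n})"
      using sum.reindex[OF inj, of E] by simp
    also have "\<dots> \<le> ?T" using m E by (intro sum_mono2) auto
    finally show "(\<Sum>k<m. if k \<le> n then E ((Suc n - k) mod m) else 0) \<le> ?T" .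
  qed
  also have "\<dots> = \<rho> / (1 - \<rho>) * ?T" using \<rho> by (simp add: field_simps)
  finally show ?case .
qed

section \<open>The filters depend on the reference measures on the vertices only\<close>

lemma marginal_cong: "(\<And>u. u \<in> K \<Longrightarrow> \<psi> u = \<psi>' u) \<Longrightarrow> marginal \<psi> K \<rho> = marginal \<psi>' K \<rho>"
  unfolding marginal_def using PiM_cong[of K K \<psi> \<psi>'] by simp

lemma predict_cong: "(\<And>u. u \<in> V \<Longrightarrow> \<psi> u = \<psi>' u) \<Longrightarrow> predict V \<psi> p \<rho> = predict V \<psi>' p \<rho>"
  unfolding predict_def using PiM_cong[of V V \<psi> \<psi>'] by simp

lemma blocking_cong:
  assumes eq: "\<And>u. u \<in> V \<Longrightarrow> \<psi> u = \<psi>' u" and \<K>: "partition_on V \<K>"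
  shows "blocking V \<psi> \<K> \<rho> = blocking V \<psi>' \<K> \<rho>"
proof -
  have "marginal \<psi> K \<rho> = marginal \<psi>' K \<rho>" if "K \<in> \<K>" for K
    using \<K> that by (intro marginal_cong eq) (auto simp: partition_on_def)
  then have "PiM \<K> (\<lambda>K. marginal \<psi> K \<rho>) = PiM \<K> (\<lambda>K. marginal \<psi>' K \<rho>)" by (intro PiM_cong) auto
  then show ?thesis unfolding blocking_def using PiM_cong[of V V \<psi> \<psi>', OF refl eq] by simp
qed

lemma exact_filter_cong:
  "(\<And>u. u \<in> V \<Longrightarrow> \<psi> u = \<psi>' u) \<Longrightarrow> exact_filter V \<psi> p g y \<mu> n = exact_filter V \<psi>' p g y \<mu> n"
  using predict_cong[of V \<psi> \<psi>'] by (induction n) auto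

lemma blocked_filter_cong:
  "(\<And>u. u \<in> V \<Longrightarrow> \<psi> u = \<psi>' u) \<Longrightarrow> (\<And>s. partition_on V (\<K> (\<sigma> s))) \<Longrightarrow>
   blocked_filter V \<psi> p g y \<K> \<sigma> \<mu> n = blocked_filter V \<psi>' p g y \<K> \<sigma> \<mu> n"
  using predict_cong[of V \<psi> \<psi>'] blocking_cong[of V \<psi> \<psi>'] by (induction n) auto

text \<open>Raised to the power 2 \<Delta>, the lower bound on \<epsilon> says \<open>c < 1\<close>,
  so the logarithm is negative. The last equation is c R^2 = 1 for R = exp (\<beta> r), the
  smallness condition with equality.\<close>

lemma decay_rate_pos:
  fixes \<epsilon> :: real and \<Delta> r :: nat
  assumes \<Delta>: "1 \<le> \<Delta>" and r: "1 \<le> r" and \<epsilon>: "1 > \<epsilon>" "\<epsilon> > (1 - 1 / (18 * (real \<Delta>)\<^sup>2)) powr (1 / (2 * real \<Delta>))"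
  defines "c \<equiv> 18 * (real \<Delta>)\<^sup>2 * (1 - \<epsilon> ^ (2 * \<Delta>))"
  shows "0 < \<epsilon>" "0 < c" "0 < - (1 / (2 * real r)) * ln c"
    "c * (exp (- (1 / (2 * real r)) * ln c * real r))\<^sup>2 = 1"
proof -
  have D: "1 \<le> (real \<Delta>)\<^sup>2" "0 < \<Delta>" using \<Delta> by simp_all
  define a where "a = 1 - 1 / (18 * (real \<Delta>)\<^sup>2)"
  have "1 / (18 * (real \<Delta>)\<^sup>2) \<le> 1 / 18" using D by (intro divide_left_mono) auto
  then have a: "0 < a" unfolding a_def by linarith
  show e0: "0 < \<epsilon>" using \<epsilon>(2) powr_ge_zero[of "1 - 1 / (18 * (real \<Delta>)\<^sup>2)" "1 / (2 * real \<Delta>)"] by linarith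
  have "(a powr (1 / (2 * real \<Delta>))) ^ (2 * \<Delta>) = a powr (1 / (2 * real \<Delta>) * real (2 * \<Delta>))"
    using a by (simp add: powr_realpow[symmetric] powr_powr)
  also have "\<dots> = a" using a \<Delta> by simp
  finally have "a < \<epsilon> ^ (2 * \<Delta>)"
    using power_strict_mono[OF \<epsilon>(2)[folded a_def], of "2 * \<Delta>"] \<Delta> by simp
  then have "18 * (real \<Delta>)\<^sup>2 * (1 - \<epsilon> ^ (2 * \<Delta>)) < 18 * (real \<Delta>)\<^sup>2 * (1 / (18 * (real \<Delta>)\<^sup>2))"
    using D unfolding a_def by (intro mult_strict_left_mono) auto
  also have "\<dots> = 1" using D by simp
  finally have c1: "c < 1" unfolding c_def .
  have "\<epsilon> ^ (2 * \<Delta>) < 1" using \<epsilon>(1) e0 \<Delta> by (intro power_less_one_iff[THEN iffD2]) auto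
  then show c0: "0 < c" unfolding c_def using D \<Delta> by simp
  have l: "ln c < 0" using c0 c1 by simp
  then show "0 < - (1 / (2 * real r)) * ln c" using r by (simp add: divide_neg_pos)
  have "(exp (- (1 / (2 * real r)) * ln c * real r))\<^sup>2 = exp (- ln c)"
    using r by (simp add: power2_eq_square exp_add[symmetric])
  then show "c * (exp (- (1 / (2 * real r)) * ln c * real r))\<^sup>2 = 1"
    using c0 by (simp add: exp_minus)
qed

theorem theorem2:
  fixes G :: "('v, 'e) pre_digraph" and V :: "'v set"
    and \<X> :: "'v \<Rightarrow> 'a topology" and \<Y> :: "'v \<Rightarrow> 'b topology"
    and \<psi> :: "'v \<Rightarrow> 'a measure" and \<phi> :: "'v \<Rightarrow> 'b measure"
    and p :: "'v \<Rightarrow> ('v \<Rightarrow> 'a) \<Rightarrow> 'a \<Rightarrow> real" and g :: "'v \<Rightarrow> 'a \<Rightarrow> 'b \<Rightarrow> real"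
    and y :: "nat \<Rightarrow> 'v \<Rightarrow> 'b"
    and r m n \<Delta> :: nat and \<K> :: "nat \<Rightarrow> 'v set set" and \<sigma> :: "nat \<Rightarrow> nat"
    and \<epsilon> \<beta> :: real and v :: 'v and x :: "'v \<Rightarrow> 'a"
  assumes graph: "graph G" and V: "V = verts G"
    and polish: "\<forall>u\<in>V. Polish (\<X> u) \<and> Polish (\<Y> u)"
    and reference: "\<forall>u\<in>V. reference_measure (\<X> u) (\<psi> u) \<and> reference_measure (\<Y> u) (\<phi> u)"
    and p_density: "\<forall>u\<in>V. transition_density (PiM V \<psi>) (\<psi> u) (p u)"
    and g_density: "\<forall>u\<in>V. transition_density (\<psi> u) (\<phi> u) (g u)"
    and r: "r \<ge> 1"
    and p_local: "\<forall>u\<in>V. \<forall>w\<in>space (PiM V \<psi>). \<forall>w'\<in>space (PiM V \<psi>). \<forall>z\<in>space (\<psi> u).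
           (\<forall>u'\<in>nbhd G r u. w u' = w' u') \<longrightarrow> p u w z = p u w' z"
    and \<Delta>: "\<Delta> = max_nbhd G r"
    and m: "m \<ge> 1"
    and partitions: "\<forall>j<m. partition_on V (\<K> j)"
    and y: "\<forall>s\<ge>1. y s \<in> space (PiM V \<phi>)"
    and p_bounds: "\<forall>u\<in>V. \<forall>w\<in>space (PiM V \<psi>). \<forall>z\<in>space (PiM V \<psi>).
           \<epsilon> \<le> p u w (z u) \<and> p u w (z u) \<le> 1 / \<epsilon>"
    and \<epsilon>: "1 > \<epsilon>" "\<epsilon> > (1 - 1 / (18 * (real \<Delta>)\<^sup>2)) powr (1 / (2 * real \<Delta>))"
    and \<beta>: "\<beta> = - (1 / (2 * real r)) * ln (18 * (real \<Delta>)\<^sup>2 * (1 - \<epsilon> ^ (2 * \<Delta>)))"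
    and \<sigma>: "\<forall>s. \<sigma> s = s mod m"
    and v: "v \<in> V"
    and x: "x \<in> space (PiM V \<psi>)"
    and exact_denominators: "\<forall>s.
           likelihood V g (y (Suc s))
             (predict V \<psi> p (exact_filter V \<psi> p g y (return (PiM V \<psi>) x) s)) \<in> {0<..<\<infinity>}"
    and blocked_denominators: "\<forall>s.
           likelihood V g (y (Suc s))
             (blocking V \<psi> (\<K> (\<sigma> (Suc s)))
               (predict V \<psi> p (blocked_filter V \<psi> p g y \<K> \<sigma> (return (PiM V \<psi>) x) s)))
             \<in> {0<..<\<infinity>}"
  shows "\<beta> > 0 \<and>
    ereal (1 / real m * (\<Sum>k<m. if k \<le> n
        then local_dist (PiM V \<psi>) {v}
               (exact_filter V \<psi> p g y (return (PiM V \<psi>) x) (n - k))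
               (blocked_filter V \<psi> p g y \<K> \<sigma> (return (PiM V \<psi>) x) (n - k))
        else 0))
      \<le> ereal (8 * exp (- \<beta>) / (1 - exp (- \<beta>)) * (1 - \<epsilon> ^ (2 * \<Delta>)))
          * mean_exp_border_dist \<beta> G r m \<K> v \<and>
    ereal (8 * exp (- \<beta>) / (1 - exp (- \<beta>)) * (1 - \<epsilon> ^ (2 * \<Delta>)))
          * mean_exp_border_dist \<beta> G r m \<K> v
      \<le> ereal (8 * exp (- \<beta>) / (1 - exp (- \<beta>)) * (1 - \<epsilon> ^ (2 * \<Delta>)))
          * exp_ereal (- (ereal \<beta>
              * exp_ereal (- (ereal \<beta> * ereal_gap (max_border_dist G r m \<K> v) (min_border_dist G r m \<K> v)))
              * (ereal (1 / real m) * mean_border_dist G r m \<K> v)))"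
proof -
  interpret Gr: graph G by (rule graph)
  \<comment> \<open>\<open>\<psi>\<close> is unconstrained outside \<open>V\<close>; a point mass
    there makes the family sigma-finite at every index.\<close>
  define \<psi>' where "\<psi>' u = (if u \<in> V then \<psi> u else return (count_space UNIV) undefined)" for u
  have \<psi>': "\<psi> u = \<psi>' u" if "u \<in> V" for u using that by (simp add: \<psi>'_def)
  have S_eq: "PiM V \<psi> = PiM V \<psi>'" using \<psi>' by (intro PiM_cong) auto
  have part: "partition_on V (\<K> (\<sigma> s))" for s using partitions \<sigma> m by simp
  have finV: "finite V" by (simp add: V)
  let ?N = "nbhd G r"
  have self: "u \<in> ?N u" if "u \<in> V" for u
    using that Gr.gdist_refl[of u] V by (simp add: nbhd_def)
  have finN: "finite (?N u)" for u by (simp add: nbhd_def)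
  have cardN: "card (?N u) \<le> \<Delta>" if "u \<in> V" for u
    unfolding \<Delta> max_nbhd_def using that V by (intro Max_ge) auto
  have "1 \<le> card (?N v)" using self[OF v] finN[of v] by (simp add: Suc_le_eq card_gt_0_iff) blast
  then have \<Delta>1: "1 \<le> \<Delta>" using cardN[OF v] by linarith
  note rate = decay_rate_pos[OF \<Delta>1 r \<epsilon>]
  have \<beta>0: "0 < \<beta>" unfolding \<beta> using rate(3) by simp
  define R where "R = exp (\<beta> * real r)"
  have R1: "1 \<le> R" unfolding R_def using \<beta>0 by simp
  have small: "18 * (real \<Delta>)\<^sup>2 * (1 - \<epsilon> ^ (2 * \<Delta>)) * R\<^sup>2 = 1"
    unfolding R_def \<beta> by (rule rate(4))
  let ?\<eta> = "1 - \<epsilon> ^ (2 * \<Delta>)"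
  have \<eta>0: "0 \<le> ?\<eta>" using rate(1) \<epsilon>(1) by (simp add: power_le_one)
  let ?C = "8 * exp (- \<beta>) / (1 - exp (- \<beta>)) * ?\<eta>"
  have C0: "0 \<le> ?C" using \<beta>0 \<eta>0 by (intro mult_nonneg_nonneg divide_nonneg_pos) auto
  let ?D = "\<lambda>j. border_dist G r (\<K> j) v"
  have D0: "0 \<le> ?D j" for j by (rule Gr.border_dist_nonneg)
  let ?ld = "\<lambda>n. local_dist (PiM V \<psi>) {v} (exact_filter V \<psi> p g y (return (PiM V \<psi>) x) n)
      (blocked_filter V \<psi> p g y \<K> \<sigma> (return (PiM V \<psi>) x) n)"
  let ?lhs = "1 / real m * (\<Sum>k<m. if k \<le> n then ?ld (n - k) else 0)"
  \<comment> \<open>At each level the weights are real and fit the same \<open>R\<close>, since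
    truncation does not increase distances. The left side does not depend on the level, so the bound
    passes to the limit.\<close>
  have trunc_bound: "?lhs \<le> ?C * (1 / real m * (\<Sum>j<m. exp (- \<beta> * truncate (real l) (?D j))))" for l :: nat
  proof -
    define \<omega> where "\<omega> u w = exp (\<beta> * truncate (real l) (gdist G u w))" for u w
    have t0: "0 \<le> truncate (real l) (gdist G u w)" for u w
      by (intro truncate_nonneg Gr.gdist_nonneg) simp
    have pd: "transition_density (PiM V \<psi>') (\<psi>' u) (p u)" if "u \<in> V" for u
      using p_density[rule_format, OF that] by (simp only: S_eq \<psi>'[OF that])
    have sf: "sigma_finite_measure (\<psi>' u)" for u
    proof (cases "u \<in> V")
      case True
      then have "sigma_finite_measure (\<psi> u)" using reference unfolding reference_measure_def by blast
      then show ?thesis by (simp only: \<psi>'[OF True])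
    next
      case False
      then show ?thesis by (simp add: \<psi>'_def prob_space_imp_sigma_finite prob_space_return)
    qed
    interpret F: filter_model V ?N \<omega> \<epsilon> R \<Delta> \<psi>' p
    proof
      show "finite V" by (rule finV)
      show "?N u \<subseteq> V" for u by (auto simp: nbhd_def V)
      show "u \<in> ?N w" if "u \<in> V" "w \<in> V" "w \<in> ?N u" for u w
        using that Gr.gdist_sym[of u w] by (simp add: nbhd_def V)
      show "card (?N u) \<le> \<Delta>" if "u \<in> V" for u by (rule cardN[OF that])
      show "1 \<le> \<Delta>" by (rule \<Delta>1)
      show "1 \<le> \<omega> u w" for u w unfolding \<omega>_def using \<beta>0 t0[of u w] by simp
      show "\<omega> u u = 1" if "u \<in> V" for u
        using that Gr.gdist_refl[of u] by (simp add: \<omega>_def V zero_ereal_def)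
      show "\<omega> u w \<le> \<omega> u a * \<omega> a w" for u a w
      proof -
        have "truncate (real l) (gdist G u w) \<le> truncate (real l) (gdist G u a + gdist G a w)"
          by (intro truncate_mono Gr.gdist_nonneg Gr.gdist_triangle)
        also have "\<dots> \<le> truncate (real l) (gdist G u a) + truncate (real l) (gdist G a w)"
          by (intro truncate_add Gr.gdist_nonneg) simp
        finally show ?thesis unfolding \<omega>_def exp_add[symmetric] using \<beta>0 by (simp add: distrib_left[symmetric])
      qed
      show "\<omega> u w \<le> R" if "w \<in> ?N u" for u w
        unfolding \<omega>_def R_def using that \<beta>0 truncate_le[OF Gr.gdist_nonneg, of u w "real r" "real l"]
        by (simp add: nbhd_def)
      show "1 \<le> R" by (rule R1)
      show "0 < \<epsilon>" "\<epsilon> < 1" using rate(1) \<epsilon>(1) by auto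
      show "18 * (real \<Delta>)\<^sup>2 * (1 - \<epsilon> ^ (2 * \<Delta>)) * R\<^sup>2 \<le> 1" using small by simp
      show "(\<lambda>(x, z). p u x z) \<in> borel_measurable (PiM V \<psi>' \<Otimes>\<^sub>M \<psi>' u)" if "u \<in> V" for u
        using pd[OF that] unfolding transition_density_def by blast
      show "\<epsilon> \<le> p u w z \<and> p u w z \<le> 1 / \<epsilon>" if "u \<in> V" "w \<in> space (PiM V \<psi>')" "z \<in> space (\<psi>' u)" for u w z
      proof -
        have "z \<in> space (\<psi> u)" using that(3) by (simp only: \<psi>'[OF that(1)])
        then have "x(u := z) \<in> space (PiM V \<psi>)" by (rule space_PiM_fun_upd[OF that(1) x])
        moreover have "w \<in> space (PiM V \<psi>)" using that(2) by (simp only: S_eq)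
        ultimately show ?thesis using p_bounds[rule_format, OF that(1), of w "x(u := z)"] by simp
      qed
      show "p u (w(a := b)) z = p u w z"
        if "u \<in> V" "a \<in> V - ?N u" "w \<in> space (PiM V \<psi>')" "b \<in> space (\<psi>' a)" "z \<in> space (\<psi>' u)" for u a w b z
      proof -
        have "a \<in> V" using that(2) by blast
        from space_PiM_fun_upd[OF this that(3,4)]
        have w: "w(a := b) \<in> space (PiM V \<psi>)" "w \<in> space (PiM V \<psi>)" using that(3) by (simp_all only: S_eq)
        have z: "z \<in> space (\<psi> u)" using that(5) by (simp only: \<psi>'[OF that(1)])
        show ?thesis by (rule p_local[rule_format, OF that(1) w z]) (use that(2) in auto)
      qed
      show "(\<integral>\<^sup>+ z. ennreal (p u w z) \<partial>\<psi>' u) = 1" if "u \<in> V" "w \<in> space (PiM V \<psi>')" for u w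
        using pd[OF that(1)] that(2) unfolding transition_density_def by blast
    qed (rule sigma_finite_measure.sigma_finite_countable[OF sf])
    define e where "e s u = exp (- \<beta> * truncate (real l) (border_dist G r (\<K> (\<sigma> s)) u))" for s u
    have ok: "F.obs_ok g (y (Suc s))" for s
      unfolding F.obs_ok_def
    proof (intro ballI conjI)
      fix w assume w: "w \<in> V"
      have yw: "y (Suc s) w \<in> space (\<phi> w)" using y w by (auto simp: space_PiM)
      have gd: "transition_density (\<psi>' w) (\<phi> w) (g w)"
        using g_density[rule_format, OF w] by (simp only: \<psi>'[OF w])
      then have "(\<lambda>(x, z). g w x z) \<in> borel_measurable (\<psi>' w \<Otimes>\<^sub>M \<phi> w)" by (simp add: transition_density_def)
      from measurable_compose[OF measurable_Pair2'[OF yw] this]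
      show "(\<lambda>x. g w x (y (Suc s) w)) \<in> borel_measurable (\<psi>' w)" by simp
      fix z assume "z \<in> space (\<psi>' w)"
      then show "0 \<le> g w z (y (Suc s) w)" using gd yw by (simp add: transition_density_def)
    qed
    have lip: "e s a \<le> e s u * \<omega> u a" if u: "u \<in> V" and a: "a \<in> V" for s u a
    proof -
      let ?B = "border_dist G r (\<K> (\<sigma> s))"
      have "truncate (real l) (?B u) \<le> truncate (real l) (gdist G u a + ?B a)"
        using u a part[of s] r unfolding V
        by (intro truncate_mono Gr.border_dist_nonneg Gr.border_dist_lipschitz)
      also have "\<dots> \<le> truncate (real l) (gdist G u a) + truncate (real l) (?B a)"
        by (intro truncate_add Gr.gdist_nonneg Gr.border_dist_nonneg) simp
      finally have "\<beta> * truncate (real l) (?B u) \<le> \<beta> * (truncate (real l) (gdist G u a) + truncate (real l) (?B a))"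
        using \<beta>0 by (intro mult_left_mono) auto
      then show ?thesis unfolding e_def \<omega>_def exp_add[symmetric] by (simp add: distrib_left)
    qed
    have border: "1 \<le> e s u * \<omega> u a" if K: "K \<in> \<K> (\<sigma> s)" "u \<in> K" and a: "a \<in> V" "\<not> ?N a \<subseteq> K" for s K u a
    proof -
      let ?B = "border_dist G r (\<K> (\<sigma> s))"
      have "a \<notin> K \<or> a \<in> border G r K" using a by (auto simp: border_def)
      with part[of s] K r have "?B u \<le> gdist G u a"
        unfolding V by (intro Gr.border_dist_le_outside)
      then have "truncate (real l) (?B u) \<le> truncate (real l) (gdist G u a)"
        by (intro truncate_mono Gr.border_dist_nonneg)
      then have "\<beta> * truncate (real l) (?B u) \<le> \<beta> * truncate (real l) (gdist G u a)"
        using \<beta>0 by (intro mult_left_mono) auto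
      then show ?thesis unfolding e_def \<omega>_def exp_add[symmetric] by simp
    qed
    have ld: "?ld k \<le> 4 * F.err e k v" for k
    proof -
      have "local_dist (PiM V \<psi>') {v} (exact_filter V \<psi>' p g y (return (PiM V \<psi>') x) k)
          (blocked_filter V \<psi>' p g y \<K> \<sigma> (return (PiM V \<psi>') x) k) \<le> 4 * F.err e k v"
      proof (rule F.filter_error)
        show "v \<in> V" by (rule v)
        show "F.obs_ok g (y (Suc s))" for s by (rule ok)
        show "partition_on V (\<K> (\<sigma> s))" for s by (rule part)
        show "0 \<le> e s a" for s a by (simp add: e_def)
        show "e s a \<le> e s u * \<omega> u a" if "u \<in> V" "a \<in> V" for s u a by (rule lip[OF that])
        show "1 \<le> e s u * \<omega> u a" if "K \<in> \<K> (\<sigma> s)" "u \<in> K" "a \<in> V" "\<not> ?N a \<subseteq> K" for s K u a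
          by (rule border[OF that])
        show "x \<in> space (PiM V \<psi>')" using x by (simp only: S_eq)
        show "likelihood V g (y (Suc s)) (predict V \<psi>' p (exact_filter V \<psi>' p g y (return (PiM V \<psi>') x) s)) \<in> {0<..<\<infinity>}" for s
          using exact_denominators[rule_format, of s]
          by (simp only: predict_cong[of V \<psi> \<psi>', OF \<psi>'] exact_filter_cong[of V \<psi> \<psi>', OF \<psi>'] S_eq)
      qed
      moreover have "blocked_filter V \<psi> p g y \<K> \<sigma> \<mu> k = blocked_filter V \<psi>' p g y \<K> \<sigma> \<mu> k" for \<mu>
        by (rule blocked_filter_cong) (fact \<psi>' part)+
      moreover have "exact_filter V \<psi> p g y \<mu> k = exact_filter V \<psi>' p g y \<mu> k" for \<mu>
        by (rule exact_filter_cong[OF \<psi>'])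
      ultimately show ?thesis by (simp only: S_eq)
    qed
    define E where "E j = ?\<eta> * exp (- \<beta> * truncate (real l) (?D j))" for j
    let ?\<rho> = "1 / R"
    \<comment> \<open>The contraction per step is exp (-\<beta> r), at most exp (-\<beta>) because r
      \<ge> 1.\<close>
    have \<rho>: "?\<rho> \<le> exp (- \<beta>)"
    proof -
      have "\<beta> * 1 \<le> \<beta> * real r" using \<beta>0 r by (intro mult_left_mono) auto
      then show ?thesis unfolding R_def by (simp add: exp_minus[symmetric] inverse_eq_divide[symmetric])
    qed
    have e1: "exp (- \<beta>) < 1" using \<beta>0 by simp
    have E0: "0 \<le> E j" for j unfolding E_def using \<eta>0 by simp
    have "(\<Sum>k<m. if k \<le> n then F.err e (n - k) v else 0) \<le> ?\<rho> / (1 - ?\<rho>) * (\<Sum>j<m. E j)"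
    proof (rule windowed_sum_bound[OF m, where q="\<lambda>k. F.err e k v"])
      show "F.err e (Suc k) v = ?\<rho> * (F.err e k v + E (Suc k mod m))" for k
        using \<sigma> by (simp add: e_def E_def)
      show "?\<rho> < 1" using \<rho> e1 by (rule le_less_trans)
    qed (use R1 E0 in auto)
    also have "\<dots> \<le> exp (- \<beta>) / (1 - exp (- \<beta>)) * (\<Sum>j<m. E j)"
      using \<rho> e1 R1 E0 by (intro mult_right_mono frac_le sum_nonneg) auto
    finally have win: "(\<Sum>k<m. if k \<le> n then F.err e (n - k) v else 0) \<le> exp (- \<beta>) / (1 - exp (- \<beta>)) * (\<Sum>j<m. E j)" .
    have "(\<Sum>k<m. if k \<le> n then ?ld (n - k) else 0) \<le> (\<Sum>k<m. 4 * (if k \<le> n then F.err e (n - k) v else 0))"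
      using ld by (intro sum_mono) auto
    also have "\<dots> \<le> 4 * (exp (- \<beta>) / (1 - exp (- \<beta>)) * (\<Sum>j<m. E j))"
      unfolding sum_distrib_left[symmetric] using win by simp
    \<comment> \<open>The comparison yields the factor 4; it is relaxed to the 8 of the
      claim.\<close>
    also have "\<dots> \<le> 8 * (exp (- \<beta>) / (1 - exp (- \<beta>)) * (\<Sum>j<m. E j))"
      using e1 E0 by (intro mult_right_mono mult_nonneg_nonneg sum_nonneg) auto
    also have "\<dots> = ?C * (\<Sum>j<m. exp (- \<beta> * truncate (real l) (?D j)))"
      by (simp add: E_def sum_distrib_left[symmetric])
    finally have "?lhs \<le> 1 / real m * (?C * (\<Sum>j<m. exp (- \<beta> * truncate (real l) (?D j))))"
      using m by (intro mult_left_mono) auto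
    then show ?thesis by (simp add: mult_ac)
  qed
  \<comment> \<open>Terms with infinite border distance tend to 0 as the level grows, in agreement
    with the value of \<open>exp_ereal\<close> at minus infinity.\<close>
  have "(\<lambda>l. ?C * (1 / real m * (\<Sum>j<m. exp (- \<beta> * truncate (real l) (?D j))))) \<longlonglongrightarrow>
      ?C * (1 / real m * (\<Sum>j<m. exp_dist \<beta> (?D j)))"
    by (intro tendsto_mult tendsto_const tendsto_sum exp_dist_truncate_tendsto[OF \<beta>0 D0])
  from LIMSEQ_le_const[OF this] trunc_bound
  have lim: "?lhs \<le> ?C * (1 / real m * (\<Sum>j<m. exp_dist \<beta> (?D j)))" by blast
  have mean: "mean_exp_border_dist \<beta> G r m \<K> v = ereal (1 / real m * (\<Sum>j<m. exp_dist \<beta> (?D j)))"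
    unfolding mean_exp_border_dist_def using exp_ereal_exp_dist[OF \<beta>0 D0] by simp
  have first: "ereal ?lhs \<le> ereal ?C * mean_exp_border_dist \<beta> G r m \<K> v"
    unfolding mean times_ereal.simps using lim by (simp only: ereal_less_eq)
  have second: "mean_exp_border_dist \<beta> G r m \<K> v \<le> exp_ereal (- (ereal \<beta>
              * exp_ereal (- (ereal \<beta> * ereal_gap (max_border_dist G r m \<K> v) (min_border_dist G r m \<K> v)))
              * (ereal (1 / real m) * mean_border_dist G r m \<K> v)))"
    unfolding mean_exp_border_dist_def max_border_dist_def min_border_dist_def mean_border_dist_def
    by (rule mean_exp_ereal_le[OF m D0 \<beta>0])
  have "0 \<le> ereal ?C" unfolding zero_ereal_def ereal_less_eq(3) by (rule C0)
  from ereal_mult_left_mono[OF second this] show ?thesis by (intro conjI \<beta>0 first)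
qed

end
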